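(* Let $d\ge1$, $T>0$, and let $b:[0,T]\times\mathbb{T}^d\to\mathbb{R}^d$ satisfy $$\sup_{t\in[0,T]}\int_{\mathbb{T}^d}\exp\{\beta|\nabla b_t(x)|\}\,dx<\infty\quad\text{for every }\beta>0,\qquad \|\operatorname{div} b\|_{L^\infty([0,T]\times\mathbb{T}^d)}<\infty,$$ and let $X_t$ be the flow of $b$. Then, for any $t\in[0,T]$, $X_t$ and its inverse belong to $W^{1,p}(\mathbb{T}^d;\mathbb{R}^d)$ for every $1\le p<\infty$.
   Context: $\mathbb{T}^d=\mathbb{R}^d/\mathbb{Z}^d$ is the flat torus with Haar (Lebesgue) measure. Derivatives of $b$ are spatial and distributional; each $b_t=b(t,\cdot)$ is identified with its continuous representative, which exists under these assumptions. The flow $X:[0,T]\times\mathbb{T}^d\to\mathbb{T}^d$ of $b$ is the solution of $\frac{d}{dt}X(t,x)=b(t,X(t,x))$, $X(0,x)=x$, with $X_t=X(t,\cdot)$; under these hypotheses it is known to exist and be unique, and each $X_t$ is invertible. Identifying $b$ with a $\mathbb{Z}^d$-periodic field, $X_t$ and $(X_t)^{-1}$ are regarded as maps on $\mathbb{R}^d$ (their lifts, with $X_t-\mathrm{id}$ and $(X_t)^{-1}-\mathrm{id}$ being $\mathbb{Z}^d$-periodic), and membership in $W^{1,p}(\mathbb{T}^d;\mathbb{R}^d)$ means that the lift and its weak gradient are in $L^p$ on a unit cell. *)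

theory Defs
  imports "HOL-Analysis.Analysis" "HOL-Probability.Essential_Supremum"
begin

text \<open>Functions on the torus are represented by their lifts to \<^typ>\<open>real ^ 'n\<close>.\<close>

definition periodic :: "(real ^ 'n \<Rightarrow> 'b) \<Rightarrow> bool" where
  "periodic f \<longleftrightarrow> (\<forall>x k. (\<forall>i. k $ i \<in> \<int>) \<longrightarrow> f (x + k) = f x)"

text \<open>The closed cube; its boundary is a null set, so integrals of periodic functions over
  it are integrals over the torus.\<close>

definition unit_cell :: "(real ^ 'n) set" where
  "unit_cell = cbox 0 1"

definition partial_deriv :: "'n \<Rightarrow> (real ^ 'n \<Rightarrow> real) \<Rightarrow> real ^ 'n \<Rightarrow> real" where
  "partial_deriv j \<phi> x = frechet_derivative \<phi> (at x) (axis j 1)"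

primrec Ck :: "nat \<Rightarrow> (real ^ 'n \<Rightarrow> real) \<Rightarrow> bool" where
  "Ck 0 \<phi> \<longleftrightarrow> continuous_on UNIV \<phi>"
| "Ck (Suc k) \<phi> \<longleftrightarrow> \<phi> differentiable_on UNIV \<and> (\<forall>j. Ck k (partial_deriv j \<phi>))"

definition test_function :: "(real ^ 'n \<Rightarrow> real) \<Rightarrow> bool" where
  "test_function \<phi> \<longleftrightarrow> (\<forall>k. Ck k \<phi>) \<and> compact (closure {x. \<phi> x \<noteq> 0})"

definition locally_integrable ::
    "(real ^ 'n \<Rightarrow> 'b::{banach, second_countable_topology}) \<Rightarrow> bool" where
  "locally_integrable f \<longleftrightarrow> (\<forall>K. compact K \<longrightarrow> set_integrable lebesgue K f)"

text \<open>Distributional derivatives are taken on all of \<^typ>\<open>real ^ 'n\<close>, since the lift of a torus map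
  need not be periodic. For a periodic function this is the distributional derivative on the
  torus. The entry \<open>G x $ i $ j\<close> is the \<open>j\<close>-th partial derivative of the \<open>i\<close>-th component.\<close>

definition weak_gradient ::
    "(real ^ 'n \<Rightarrow> real ^ 'n) \<Rightarrow> (real ^ 'n \<Rightarrow> real ^ 'n ^ 'n) \<Rightarrow> bool" where
  "weak_gradient f G \<longleftrightarrow> locally_integrable f \<and> locally_integrable G \<and>
     (\<forall>\<phi> i j. test_function \<phi> \<longrightarrow>
        (LINT x|lebesgue. f x $ i * partial_deriv j \<phi> x) = - (LINT x|lebesgue. G x $ i $ j * \<phi> x))"

definition weak_divergence ::
    "(real ^ 'n \<Rightarrow> real ^ 'n) \<Rightarrow> (real ^ 'n \<Rightarrow> real) \<Rightarrow> bool" where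
  "weak_divergence f D \<longleftrightarrow> locally_integrable f \<and> locally_integrable D \<and>
     (\<forall>\<phi>. test_function \<phi> \<longrightarrow>
        (LINT x|lebesgue. f x \<bullet> (\<chi> j. partial_deriv j \<phi> x)) = - (LINT x|lebesgue. D x * \<phi> x))"

definition Lp_on :: "real \<Rightarrow> 'a::euclidean_space set \<Rightarrow> ('a \<Rightarrow> 'b::euclidean_space) \<Rightarrow> bool" where
  "Lp_on p S f \<longleftrightarrow> f \<in> borel_measurable (lebesgue_on S) \<and>
     set_integrable lebesgue S (\<lambda>x. norm (f x) powr p)"

definition Linfty_on :: "'a::euclidean_space set \<Rightarrow> ('a \<Rightarrow> real) \<Rightarrow> bool" where
  "Linfty_on S f \<longleftrightarrow> f \<in> borel_measurable (lebesgue_on S) \<and>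
     esssup (lebesgue_on S) (\<lambda>x. ereal \<bar>f x\<bar>) < \<infinity>"

definition in_W1p :: "real \<Rightarrow> (real ^ 'n \<Rightarrow> real ^ 'n) \<Rightarrow> bool" where
  "in_W1p p f \<longleftrightarrow> periodic (\<lambda>x. f x - x) \<and> Lp_on p unit_cell f \<and>
     (\<exists>G. weak_gradient f G \<and> Lp_on p unit_cell G)"

text \<open>Since \<open>b\<close> is only measurable in time, the flow equation is read in the sense of
  Caratheodory: each trajectory is an absolutely continuous solution, i.e. one of the integral
  equation. The maps \<open>X t\<close> are the lifts, so that \<open>X t - id\<close> is periodic.\<close>

definition is_flow :: "real \<Rightarrow> (real \<Rightarrow> real ^ 'n \<Rightarrow> real ^ 'n) \<Rightarrow>
    (real \<Rightarrow> real ^ 'n \<Rightarrow> real ^ 'n) \<Rightarrow> bool" where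
  "is_flow T b X \<longleftrightarrow>
     (\<forall>t\<in>{0..T}. periodic (\<lambda>x. X t x - x)) \<and>
     (\<forall>x. X 0 x = x) \<and>
     (\<forall>x. set_integrable lebesgue {0..T} (\<lambda>s. b s (X s x))) \<and>
     (\<forall>x. \<forall>t\<in>{0..T}. X t x = X 0 x + (LINT s:{0..t}|lebesgue. b s (X s x)))"

end

theory Submission
  imports Defs "HOL-Computational_Algebra.Polynomial"
begin

text \<open>The theorem rests on an estimate along trajectories. Formally the derivative of the flow
  satisfies \<open>norm (D X_t) powr q \<le> exp (q * (integral over s of norm (D b_s (X_s x))))\<close>. Jensen's
  inequality in time bounds the right-hand side by a time average of
  \<open>exp (q * t * norm (D b_s (X_s x)))\<close>. The divergence bound says that the maps \<open>X_s\<close> compress volume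
  by at most a constant factor, so the integral over \<open>x\<close> is bounded by the exponential integrals of
  the hypothesis, with \<open>\<beta> = q * t\<close>.

  To make this rigorous the flow is approximated by smooth maps. Each approximation is
  a composition of Euler steps \<open>x + V i x\<close>, where \<open>V i\<close> is the
  integral over one time step of the field mollified at scale \<open>1 / 16 ^ k\<close>. The derivative is then an
  explicit product of matrices, and the compression of each step follows from the expansion of the
  determinant near the identity (\<open>nn_integral_near_identity\<close>, \<open>Y_push\<close>). The estimate above becomes
  \<open>W_powr_integral\<close>.

  Convergence uses the exponential integrability a second time. By Jensen's inequality the Lipschitz
  constant of the mollified field is bounded by a logarithm of the scale times an arbitrarily small
  factor (\<open>mollify_grad_exp_bound\<close>), so that the Gronwall factor is beaten by the mollification
  error (\<open>mollify_error_bound\<close>, \<open>euler_error\<close>). Hence the approximations converge uniformly to the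
  endpoint of any trajectory with the given starting point, which also yields uniqueness of
  trajectories and continuity of the flow map.

  In the limit, weak compactness is replaced by strong convergence of convex combinations of the
  derivatives (\<open>Mazur_L2\<close>), and Fatou's lemma gives integrability of every power
  (\<open>flow_endpoint\<close>). The flow map is surjective by Brouwer's theorem. Its inverse is the endpoint map
  of the field reversed in time, which satisfies the same hypotheses; uniqueness of the reversed
  trajectories gives injectivity, and the same result gives regularity of the inverse
  (\<open>flow_map_bij_sobolev\<close>).\<close>

section \<open>Smooth functions with compact support\<close>

lemma Ck_Suc_imp: "Ck (Suc k) f \<Longrightarrow> Ck k f"
proof (induction k arbitrary: f)
  case 0
  then show ?case by (simp add: differentiable_imp_continuous_on)
next
  case (Suc k)
  then show ?case by auto
qed

lemma partial_deriv_eq: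
  assumes "(f has_derivative f') (at x)"
  shows "partial_deriv j f x = f' (axis j 1)"
  using frechet_derivative_at[OF assms] by (simp add: partial_deriv_def)

lemma Ck_add: "Ck k f \<Longrightarrow> Ck k g \<Longrightarrow> Ck k (\<lambda>x. f x + g x)"
proof (induction k arbitrary: f g)
  case 0
  then show ?case by (simp add: continuous_on_add)
next
  case (Suc k)
  have d: "f differentiable (at x)" "g differentiable (at x)" for x
    using Suc.prems by (auto simp: differentiable_on_def)
  have "partial_deriv j (\<lambda>x. f x + g x) = (\<lambda>x. partial_deriv j f x + partial_deriv j g x)" for j
  proof
    fix x
    show "partial_deriv j (\<lambda>x. f x + g x) x = partial_deriv j f x + partial_deriv j g x"
      using partial_deriv_eq[OF has_derivative_add[OF d(1)[of x, unfolded frechet_derivative_works]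
            d(2)[of x, unfolded frechet_derivative_works]]]
      by (simp add: partial_deriv_def)
  qed
  then show ?case using Suc by (auto intro: differentiable_on_add)
qed

lemma Ck_mult: "Ck k f \<Longrightarrow> Ck k g \<Longrightarrow> Ck k (\<lambda>x. f x * g x)"
proof (induction k arbitrary: f g)
  case 0
  then show ?case by (simp add: continuous_on_mult)
next
  case (Suc k)
  have d: "f differentiable (at x)" "g differentiable (at x)" for x
    using Suc.prems by (auto simp: differentiable_on_def)
  have "partial_deriv j (\<lambda>x. f x * g x) = (\<lambda>x. f x * partial_deriv j g x + partial_deriv j f x * g x)" for j
  proof
    fix x
    show "partial_deriv j (\<lambda>x. f x * g x) x = f x * partial_deriv j g x + partial_deriv j f x * g x"
      using partial_deriv_eq[OF has_derivative_mult[OF d(1)[of x, unfolded frechet_derivative_works]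
            d(2)[of x, unfolded frechet_derivative_works]]]
      by (simp add: partial_deriv_def)
  qed
  moreover have "Ck k f" "Ck k g" using Suc.prems Ck_Suc_imp by blast+
  ultimately show ?case using Suc by (auto intro: differentiable_on_mult Ck_add)
qed

lemma Ck_const: "Ck k (\<lambda>x :: real ^ 'n. c)"
proof (induction k arbitrary: c)
  case 0
  then show ?case by simp
next
  case (Suc k)
  have "partial_deriv j (\<lambda>x :: real ^ 'n. c) = (\<lambda>x. 0)" for j
    using partial_deriv_eq[OF has_derivative_const] by auto
  then show ?case using Suc by auto
qed

lemma Ck_prod:
  "finite I \<Longrightarrow> (\<And>i. i \<in> I \<Longrightarrow> Ck k (f i)) \<Longrightarrow> Ck k (\<lambda>x. \<Prod>i\<in>I. f i x)"
  by (induction I rule: finite_induct) (auto intro: Ck_const Ck_mult)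

text \<open>One-dimensional smoothness is witnessed by the sequence of all derivatives.\<close>

lemma Ck_coordinate:
  assumes D: "\<And>m s. (D m has_real_derivative D (Suc m) s) (at s)"
  shows "Ck k (\<lambda>x. D m (x $ i))"
proof (induction k arbitrary: m)
  case 0
  have "continuous_on UNIV (D m)"
    using DERIV_isCont[OF D] by (auto simp: continuous_on_eq_continuous_at)
  then show ?case
    by (auto intro!: continuous_on_compose2[of UNIV "D m"] continuous_intros)
next
  case (Suc k)
  have d: "((\<lambda>x. D m (x $ i)) has_derivative (\<lambda>v. v $ i * D (Suc m) (x $ i))) (at x)" for x
    by (rule DERIV_compose_FDERIV[OF D])
       (intro bounded_linear_imp_has_derivative bounded_linear_vec_nth)
  have "partial_deriv j (\<lambda>x. D m (x $ i)) = (\<lambda>x. axis j 1 $ i * D (Suc m) (x $ i))" for j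
    using partial_deriv_eq[OF d] by auto
  then show ?case using Suc d
    by (auto intro!: Ck_mult Ck_const simp: differentiable_on_def differentiable_def)
qed

text \<open>The classical flat function \<open>exp (- 1 / s)\<close> on the positive half line. Carrying a polynomial
  factor in \<open>1 / s\<close> along gives a family that is closed under differentiation.\<close>

definition flat_family :: "real poly \<Rightarrow> real \<Rightarrow> real" where
  "flat_family p s = (if s > 0 then poly p (1 / s) * exp (- (1 / s)) else 0)"

abbreviation flat :: "real \<Rightarrow> real" where "flat \<equiv> flat_family 1"

lemma poly_exp_decay: "((\<lambda>u. poly p u * exp (- u)) \<longlongrightarrow> 0) at_top" for p :: "real poly"
proof -
  have "((\<lambda>u. \<Sum>i\<le>degree p. coeff p i * (u ^ i / exp u)) \<longlongrightarrow> (\<Sum>i\<le>degree p. coeff p i * 0)) at_top"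
    by (intro tendsto_sum tendsto_mult tendsto_const tendsto_power_div_exp_0)
  then show ?thesis
    by (simp add: poly_altdef sum_divide_distrib[symmetric] exp_minus divide_inverse sum_distrib_right mult.assoc)
qed

lemma flat_family_deriv:
  "(flat_family p has_real_derivative flat_family ([:0, 0, 1:] * (p - pderiv p)) s) (at s)"
proof -
  consider "s > 0" | "s < 0" | "s = 0" by linarith
  then show ?thesis
  proof cases
    case 1
    have "((\<lambda>s. poly p (1 / s) * exp (- (1 / s))) has_real_derivative
        flat_family ([:0, 0, 1:] * (p - pderiv p)) s) (at s)"
      using 1 by (auto intro!: derivative_eq_intros DERIV_chain2[OF poly_DERIV]
          simp: flat_family_def field_simps power2_eq_square)
    moreover have "eventually (\<lambda>s. s > 0) (nhds s)"
      using 1 eventually_nhds_in_open[of "{0<..}" s] by simp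
    then have "eventually (\<lambda>s. flat_family p s = poly p (1 / s) * exp (- (1 / s))) (nhds s)"
      by eventually_elim (simp add: flat_family_def)
    ultimately show ?thesis by (simp add: DERIV_cong_ev)
  next
    case 2
    have "eventually (\<lambda>s. s < 0) (nhds s)"
      using 2 eventually_nhds_in_open[of "{..<0}" s] by simp
    then have "eventually (\<lambda>s. flat_family p s = 0) (nhds s)"
      by eventually_elim (simp add: flat_family_def)
    then have "(flat_family p has_real_derivative 0) (at s)"
      by (subst DERIV_cong_ev[OF refl _ refl]) auto
    then show ?thesis using 2 by (simp add: flat_family_def)
  next
    case 3
    have "((\<lambda>u. poly ([:0, 1:] * p) u * exp (- u)) \<longlongrightarrow> 0) at_top"
      by (rule poly_exp_decay)
    then have "((\<lambda>y. poly ([:0, 1:] * p) (inverse y) * exp (- inverse y)) \<longlongrightarrow> 0) (at_right 0)"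
      by (rule filterlim_compose) (rule filterlim_inverse_at_top_right)
    then have r: "((\<lambda>y. (flat_family p y - flat_family p 0) / (y - 0)) \<longlongrightarrow> 0) (at_right 0)"
      by (rule tendsto_cong[THEN iffD1, rotated])
         (auto simp: eventually_at_right_less flat_family_def divide_simps
           intro!: eventually_at_rightI[of 0 1])
    have l: "((\<lambda>y. (flat_family p y - flat_family p 0) / (y - 0)) \<longlongrightarrow> 0) (at_left 0)"
      by (rule tendsto_cong[THEN iffD1, rotated, OF tendsto_const])
         (auto simp: flat_family_def intro!: eventually_at_leftI[of "-1" 0])
    have "((\<lambda>y. (flat_family p y - flat_family p 0) / (y - 0)) \<longlongrightarrow> 0) (at 0)"
      using l r by (simp add: filterlim_at_split)
    then show ?thesis using 3 by (simp add: has_field_derivative_iff flat_family_def)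
  qed
qed

lemma flat_nonneg: "0 \<le> flat s" and flat_le_1: "flat s \<le> 1"
  and flat_zero: "s \<le> 0 \<Longrightarrow> flat s = 0"
  by (auto simp: flat_family_def)

lemma flat_ge_half: "s \<ge> 1/2 \<Longrightarrow> exp (- 2) \<le> flat s"
  by (auto simp: flat_family_def field_simps)

lemma Ck_flat_affine: "Ck k (\<lambda>x. flat (c * (x $ i) + d))"
proof -
  define P where "P m = ((\<lambda>p::real poly. [:0, 0, 1:] * (p - pderiv p)) ^^ m) 1" for m
  define D where "D m s = c ^ m * flat_family (P m) (c * s + d)" for m s
  have "(D m has_real_derivative D (Suc m) s) (at s)" for m s
  proof -
    have "((\<lambda>s. flat_family (P m) (c * s + d)) has_real_derivative
       flat_family (P (Suc m)) (c * s + d) * c) (at s)"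
      using flat_family_deriv[of "P m" "c * s + d"]
      by (intro DERIV_chain2[where g = "\<lambda>s. c * s + d"])
         (auto simp: P_def intro!: derivative_eq_intros)
    from DERIV_cmult[OF this, of "c ^ m"] show ?thesis
      unfolding D_def by (simp add: mult_ac)
  qed
  from Ck_coordinate[of D, OF this, of k 0 i] show ?thesis
    by (simp add: D_def P_def)
qed

text \<open>A smooth function that is positive on an open box and vanishes outside it; the parameter
  \<open>a\<close> is the steepness, and the function tends to the indicator of the box as \<open>a\<close> grows.\<close>

definition box_bump :: "real \<Rightarrow> real ^ 'n \<Rightarrow> real ^ 'n \<Rightarrow> real ^ 'n \<Rightarrow> real" where
  "box_bump a l u x = (\<Prod>i\<in>UNIV. flat (a * (x $ i - l $ i)) * flat (a * (u $ i - x $ i)))"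

lemma Ck_box_bump: "Ck k (box_bump a l u)"
proof -
  have "Ck k (\<lambda>x. \<Prod>i\<in>UNIV. flat (a * x $ i + - a * l $ i) * flat (- a * x $ i + a * u $ i))"
    by (intro Ck_prod Ck_mult Ck_flat_affine finite)
  moreover have "(\<lambda>x. \<Prod>i\<in>UNIV. flat (a * x $ i + - a * l $ i) * flat (- a * x $ i + a * u $ i)) = box_bump a l u"
    by (auto simp: box_bump_def fun_eq_iff algebra_simps)
  ultimately show ?thesis by simp
qed

lemma box_bump_nonneg: "0 \<le> box_bump a l u x"
  by (auto simp: box_bump_def intro!: prod_nonneg mult_nonneg_nonneg flat_nonneg)

lemma box_bump_le_1: "box_bump a l u x \<le> 1"
  by (auto simp: box_bump_def intro!: prod_le_1 mult_nonneg_nonneg flat_nonneg mult_le_one flat_le_1)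

lemma box_bump_zero: assumes "a > 0" "x \<notin> box l u" shows "box_bump a l u x = 0"
proof -
  obtain i where "a * (x $ i - l $ i) \<le> 0 \<or> a * (u $ i - x $ i) \<le> 0"
  proof -
    obtain i where "x $ i \<le> l $ i \<or> u $ i \<le> x $ i"
      using assms(2) by (auto simp: mem_box_cart not_less)
    with assms(1) show ?thesis by (intro that[of i]) (auto simp: mult_nonneg_nonpos)
  qed
  then have "flat (a * (x $ i - l $ i)) * flat (a * (u $ i - x $ i)) = 0"
    using flat_zero by auto
  then show ?thesis unfolding box_bump_def by (subst prod_zero_iff) auto
qed

lemma test_function_box_bump: assumes "a > 0" shows "test_function (box_bump a l u)"
  unfolding test_function_def
proof
  have "{x. box_bump a l u x \<noteq> 0} \<subseteq> cbox l u"
    using box_bump_zero[OF assms] box_subset_cbox by blast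
  then have "bounded {x. box_bump a l u x \<noteq> 0}" using bounded_cbox bounded_subset by blast
  then show "compact (closure {x. box_bump a l u x \<noteq> 0})" by simp
qed (simp add: Ck_box_bump)

lemma box_bump_tendsto_indicator:
  "(\<lambda>n. box_bump (real (Suc n)) l u x) \<longlonglongrightarrow> indicator (box l u) x"
proof (cases "x \<in> box l u")
  case True
  have *: "(\<lambda>n. flat (real (Suc n) * s)) \<longlonglongrightarrow> 1" if "s > 0" for s
  proof -
    have "(\<lambda>n. exp (- ((1 / s) * (1 / real (Suc n))))) \<longlonglongrightarrow> exp (- ((1 / s) * 0))"
      by (intro tendsto_intros LIMSEQ_Suc[OF lim_1_over_n])
    moreover have "flat (real (Suc n) * s) = exp (- ((1 / s) * (1 / real (Suc n))))" for n
      using that by (simp add: flat_family_def field_simps add_pos_nonneg)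
    ultimately show ?thesis by simp
  qed
  have "(\<lambda>n. \<Prod>i\<in>UNIV. flat (real (Suc n) * (x $ i - l $ i)) * flat (real (Suc n) * (u $ i - x $ i)))
    \<longlonglongrightarrow> (\<Prod>i\<in>(UNIV::'a set). 1 * 1)"
    using True by (intro tendsto_prod tendsto_mult *) (auto simp: mem_box_cart)
  then show ?thesis using True by (simp add: box_bump_def)
next
  case False
  then show ?thesis using box_bump_zero[of _ x l u] by simp
qed

lemma test_function_differentiable: "test_function \<phi> \<Longrightarrow> \<phi> differentiable (at x)"
  using Ck.simps(2)[of 0 \<phi>] unfolding test_function_def differentiable_on_def by (metis UNIV_I)

lemma test_function_has_derivative:
  assumes "test_function \<phi>"
  shows "(\<phi> has_derivative (\<lambda>v. \<Sum>j\<in>UNIV. partial_deriv j \<phi> x * v $ j)) (at x)"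
proof -
  have d: "(\<phi> has_derivative frechet_derivative \<phi> (at x)) (at x)"
    using test_function_differentiable[OF assms] frechet_derivative_works by blast
  then interpret bounded_linear "frechet_derivative \<phi> (at x)" by (rule has_derivative_bounded_linear)
  have "frechet_derivative \<phi> (at x) v = (\<Sum>j\<in>UNIV. partial_deriv j \<phi> x * v $ j)" for v
  proof -
    have "frechet_derivative \<phi> (at x) v = frechet_derivative \<phi> (at x) (\<Sum>j\<in>UNIV. v $ j *\<^sub>R axis j 1)"
      using basis_expansion[of v] by (simp add: scalar_mult_eq_scaleR)
    also have "\<dots> = (\<Sum>j\<in>UNIV. partial_deriv j \<phi> x * v $ j)"
      by (simp add: sum scale partial_deriv_def mult.commute)
    finally show ?thesis .
  qed
  then have "frechet_derivative \<phi> (at x) = (\<lambda>v. \<Sum>j\<in>UNIV. partial_deriv j \<phi> x * v $ j)" by blast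
  with d show ?thesis by simp
qed

lemma test_function_continuous: "test_function \<phi> \<Longrightarrow> continuous_on UNIV \<phi>"
  using Ck.simps(1)[of \<phi>] unfolding test_function_def by metis

lemma test_function_partial_continuous: "test_function \<phi> \<Longrightarrow> continuous_on UNIV (partial_deriv j \<phi>)"
  using Ck.simps(2)[of 0 \<phi>] Ck.simps(1) unfolding test_function_def by metis

lemma partial_deriv_outside_support:
  assumes "closed S" "\<And>y. y \<notin> S \<Longrightarrow> \<phi> y = 0" "x \<notin> S"
  shows "partial_deriv j \<phi> x = 0"
proof -
  have "(\<phi> has_derivative (\<lambda>_. 0)) (at x)"
    by (rule has_derivative_transform_within_open[of "\<lambda>_. 0" _ _ _ "- S"])
       (use assms in auto)
  from partial_deriv_eq[OF this] show ?thesis .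
qed

lemma test_function_partial_support:
  assumes "test_function \<phi>" "x \<notin> closure {x. \<phi> x \<noteq> 0}"
  shows "partial_deriv j \<phi> x = 0"
  using closure_subset[of "{x. \<phi> x \<noteq> 0}"] assms(2)
  by (intro partial_deriv_outside_support[of "closure {x. \<phi> x \<noteq> 0}"]) auto

lemma test_function_support_bounded:
  assumes "test_function \<phi>"
  obtains R where "R > 0" "\<And>x. x \<notin> cball 0 R \<Longrightarrow> \<phi> x = 0"
    "\<And>x j. x \<notin> cball 0 R \<Longrightarrow> partial_deriv j \<phi> x = 0"
proof -
  have "bounded (closure {x. \<phi> x \<noteq> 0})" using assms compact_imp_bounded test_function_def by blast
  then obtain R where R: "R > 0" "closure {x. \<phi> x \<noteq> 0} \<subseteq> cball 0 R"
    using bounded_subset_ballD[of _ 0] ball_subset_cball by (meson subset_trans)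
  show ?thesis
  proof (rule that[OF R(1)])
    fix x :: "real ^ 'a" assume x: "x \<notin> cball 0 R"
    then have x': "x \<notin> closure {x. \<phi> x \<noteq> 0}" using R by blast
    show "\<phi> x = 0" using x' closure_subset[of "{x. \<phi> x \<noteq> 0}"] by auto
    show "partial_deriv j \<phi> x = 0" for j using test_function_partial_support[OF assms x'] .
  qed
qed

lemma compactly_supported_continuous_bounded:
  fixes f :: "'a::euclidean_space \<Rightarrow> real"
  assumes "continuous_on UNIV f" "\<And>x. x \<notin> cball 0 R \<Longrightarrow> f x = 0"
  obtains B where "B > 0" "\<And>x. \<bar>f x\<bar> \<le> B"
proof -
  have "compact (f ` cball 0 R)"
    by (intro compact_continuous_image continuous_on_subset[OF assms(1)]) auto
  then have "bounded (f ` cball 0 R)" by (rule compact_imp_bounded)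
  then obtain B where "B > 0" "\<And>x. x \<in> cball 0 R \<Longrightarrow> \<bar>f x\<bar> \<le> B"
    unfolding bounded_pos by auto
  then show ?thesis by (intro that[of B]) (use assms(2) in force)+
qed

lemma test_function_bounded:
  assumes "test_function \<phi>"
  obtains B where "B > 0" "\<And>x. \<bar>\<phi> x\<bar> \<le> B" "\<And>x j. \<bar>partial_deriv j \<phi> x\<bar> \<le> B"
proof -
  obtain R where R: "\<And>x. x \<notin> cball 0 R \<Longrightarrow> \<phi> x = 0"
    "\<And>x j. x \<notin> cball 0 R \<Longrightarrow> partial_deriv j \<phi> x = 0"
    using test_function_support_bounded[OF assms] by metis
  obtain B0 where B0: "B0 > 0" "\<And>x. \<bar>\<phi> x\<bar> \<le> B0"
    using compactly_supported_continuous_bounded[OF test_function_continuous[OF assms] R(1)] by metis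
  have "\<exists>B. B > 0 \<and> (\<forall>x. \<bar>partial_deriv j \<phi> x\<bar> \<le> B)" for j
    using compactly_supported_continuous_bounded[OF test_function_partial_continuous[OF assms] R(2)] by metis
  then obtain B where B: "\<And>j. B j > 0" "\<And>j x. \<bar>partial_deriv j \<phi> x\<bar> \<le> B j" by metis
  have le: "B j \<le> (\<Sum>j\<in>UNIV. B j)" for j
    by (rule member_le_sum) (auto intro: less_imp_le B)
  show ?thesis
  proof (rule that[of "B0 + (\<Sum>j\<in>UNIV. B j)"])
    show "B0 + (\<Sum>j\<in>UNIV. B j) > 0" using B0 B by (intro add_pos_nonneg sum_nonneg) (auto intro: less_imp_le)
    show "\<bar>\<phi> x\<bar> \<le> B0 + (\<Sum>j\<in>UNIV. B j)" for x
      using B0(2)[of x] sum_nonneg[of UNIV B] B(1) by (smt (verit))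
    show "\<bar>partial_deriv j \<phi> x\<bar> \<le> B0 + (\<Sum>j\<in>UNIV. B j)" for x j
      using B(2)[of j x] le[of j] B0(1) by linarith
  qed
qed

lemma test_function_lipschitz:
  assumes "test_function \<phi>"
  obtains L where "L > 0" "\<And>x y. \<bar>\<phi> x - \<phi> y\<bar> \<le> L * norm (x - y)"
proof -
  obtain B where B: "B > 0" "\<And>x j. \<bar>partial_deriv j \<phi> x\<bar> \<le> B"
    using test_function_bounded[OF assms] by metis
  have "\<bar>\<phi> x - \<phi> y\<bar> \<le> (real CARD('a) * B) * norm (x - y)" for x y
  proof -
    have "onorm (\<lambda>v. \<Sum>j\<in>UNIV. partial_deriv j \<phi> z * v $ j) \<le> real CARD('a) * B" for z
    proof (rule onorm_le)
      fix v :: "real ^ 'a"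
      have "norm (\<Sum>j\<in>UNIV. partial_deriv j \<phi> z * v $ j) \<le> (\<Sum>j\<in>(UNIV::'a set). B * norm v)"
        using B by (intro sum_norm_le) (auto simp: abs_mult intro!: mult_mono component_le_norm_cart)
      then show "norm (\<Sum>j\<in>UNIV. partial_deriv j \<phi> z * v $ j) \<le> real CARD('a) * B * norm v" by simp
    qed
    then show ?thesis
      using differentiable_bound[of UNIV \<phi> "\<lambda>z v. \<Sum>j\<in>UNIV. partial_deriv j \<phi> z * v $ j" "real CARD('a) * B" x y]
        test_function_has_derivative[OF assms] by auto
  qed
  then show ?thesis using B by (intro that[of "real CARD('a) * B"]) auto
qed

section \<open>Locally integrable functions\<close>

text \<open>Borel functions and \<open>lborel\<close> are used throughout, because Fubini and composition with
  continuous maps need no exceptional sets there; the Lebesgue measurable data of the theorem are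
  replaced by Borel versions at the end.\<close>

definition loc_integrable :: "('a::euclidean_space \<Rightarrow> 'b::{banach, second_countable_topology}) \<Rightarrow> bool" where
  "loc_integrable f \<longleftrightarrow> f \<in> borel_measurable borel \<and> (\<forall>R. set_integrable lborel (cball 0 R) f)"

lemma loc_integrable_measurable [measurable_dest]: "loc_integrable f \<Longrightarrow> f \<in> borel_measurable borel"
  by (simp add: loc_integrable_def)

lemma loc_integrable_times_bounded:
  fixes w :: "'a::euclidean_space \<Rightarrow> real" and f :: "'a \<Rightarrow> 'b::{banach, second_countable_topology}"
  assumes f: "loc_integrable f" and [measurable]: "w \<in> borel_measurable borel"
    and w: "\<And>x. \<bar>w x\<bar> \<le> B" and supp: "\<And>x. x \<notin> cball 0 R \<Longrightarrow> w x = 0"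
  shows "integrable lborel (\<lambda>x. w x *\<^sub>R f x)"
proof (rule Bochner_Integration.integrable_bound)
  note [measurable] = loc_integrable_measurable[OF f]
  show "integrable lborel (\<lambda>x. B *\<^sub>R (indicator (cball 0 R) x *\<^sub>R f x))"
    using f unfolding loc_integrable_def set_integrable_def by (intro integrable_scaleR_right) auto
  show "(\<lambda>x. w x *\<^sub>R f x) \<in> borel_measurable lborel" by simp
  have "\<bar>w x\<bar> * norm (f x) \<le> \<bar>B\<bar> * (indicator (cball 0 R) x * norm (f x))" for x
  proof (cases "x \<in> cball 0 R")
    case True
    then show ?thesis using w[of x] by (auto intro!: mult_right_mono)
  next
    case False
    then show ?thesis using supp by simp
  qed
  then show "AE x in lborel. norm (w x *\<^sub>R f x) \<le> norm (B *\<^sub>R (indicator (cball 0 R) x *\<^sub>R f x))"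
    by (intro AE_I2) (simp add: abs_mult mult.assoc)
qed

lemma continuous_loc_integrable:
  fixes f :: "'a::euclidean_space \<Rightarrow> 'b::{banach, second_countable_topology}"
  assumes "continuous_on UNIV f"
  shows "loc_integrable f"
  unfolding loc_integrable_def
proof (intro conjI allI)
  show "f \<in> borel_measurable borel" using assms by (rule borel_measurable_continuous_onI)
  show "set_integrable lborel (cball 0 R) f" for R
    using borel_integrable_compact[of "cball 0 R" f] continuous_on_subset[OF assms, of "cball 0 R"]
    unfolding set_integrable_def by (auto simp: indicator_scaleR_eq_if)
qed

lemma loc_integrable_minus:
  "loc_integrable f \<Longrightarrow> loc_integrable (\<lambda>x. - f x)"
  unfolding loc_integrable_def set_integrable_def by auto

lemma loc_integrable_comp:
  fixes f :: "'a::euclidean_space \<Rightarrow> real ^ 'm"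
  assumes "loc_integrable f"
  shows "loc_integrable (\<lambda>x. f x $ i)"
proof -
  note [measurable] = loc_integrable_measurable[OF assms]
  have "integrable lborel (\<lambda>x. (indicat_real (cball 0 R) x *\<^sub>R f x) $ i)" for R
    using assms unfolding loc_integrable_def set_integrable_def
    by (intro integrable_bounded_linear[OF bounded_linear_vec_nth]) auto
  moreover have "(\<lambda>x. f x $ i) \<in> borel_measurable borel"
    by (rule measurable_compose[OF loc_integrable_measurable[OF assms]
        borel_measurable_continuous_onI[OF linear_continuous_on[OF bounded_linear_vec_nth]]])
  ultimately show ?thesis unfolding loc_integrable_def set_integrable_def by simp
qed

section \<open>The lemma of du Bois-Reymond\<close>

text \<open>The bumps of a box converge boundedly to its indicator, so the integrals of \<open>h\<close> over all boxes
  vanish. Boxes form an intersection-stable generator, hence the positive and the negative part of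
  \<open>h\<close> have the same integral over every Borel set.\<close>

lemma du_bois_reymond:
  fixes h :: "real ^ 'n \<Rightarrow> real"
  assumes h: "loc_integrable h"
    and zero: "\<And>\<phi>. test_function \<phi> \<Longrightarrow> (LINT x|lborel. h x * \<phi> x) = 0"
  shows "AE x in lborel. h x = 0"
proof -
  note [measurable] = loc_integrable_measurable[OF h]
  have int_box: "integrable lborel (\<lambda>x. h x * indicator (box l u) x)" for l u
  proof -
    obtain R where R: "box l u \<subseteq> cball 0 R"
      using bounded_subset_ballD[OF bounded_box, of l u 0] ball_subset_cball by (meson subset_trans)
    have "integrable lborel (\<lambda>x. indicator (box l u) x *\<^sub>R h x)"
      by (rule loc_integrable_times_bounded[OF h, of _ 1 R]) (use R in \<open>auto simp: indicator_def\<close>)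
    then show ?thesis by (simp add: mult.commute)
  qed
  have box0: "(LINT x|lborel. h x * indicator (box l u) x) = 0" for l u
  proof -
    have "(\<lambda>n. LINT x|lborel. h x * box_bump (real (Suc n)) l u x)
        \<longlonglongrightarrow> (LINT x|lborel. h x * indicator (box l u) x)"
    proof (rule integral_dominated_convergence[where w = "\<lambda>x. \<bar>h x * indicator (box l u) x\<bar>"])
      have [measurable]: "box_bump a l u \<in> borel_measurable borel" if "a > 0" for a
        using test_function_continuous[OF test_function_box_bump[OF that]]
        by (rule borel_measurable_continuous_onI)
      show "(\<lambda>x. h x * box_bump (real (Suc i)) l u x) \<in> borel_measurable lborel" for i
        by simp
      show "AE x in lborel. (\<lambda>n. h x * box_bump (real (Suc n)) l u x) \<longlonglongrightarrow> h x * indicator (box l u) x"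
        by (intro AE_I2 tendsto_mult tendsto_const box_bump_tendsto_indicator)
      show "AE x in lborel. norm (h x * box_bump (real (Suc i)) l u x) \<le> \<bar>h x * indicator (box l u) x\<bar>" for i
      proof (rule AE_I2)
        fix x
        show "norm (h x * box_bump (real (Suc i)) l u x) \<le> \<bar>h x * indicator (box l u) x\<bar>"
          using box_bump_zero[of "real (Suc i)" x l u] box_bump_nonneg[of "real (Suc i)" l u x]
            box_bump_le_1[of "real (Suc i)" l u x]
          by (cases "x \<in> box l u") (auto simp: abs_mult intro: mult_left_le)
      qed
    qed (use int_box in auto)
    moreover have "(LINT x|lborel. h x * box_bump (real (Suc n)) l u x) = 0" for n
      by (rule zero[OF test_function_box_bump]) simp
    ultimately have "(\<lambda>n. 0) \<longlonglongrightarrow> (LINT x|lborel. h x * indicator (box l u) x)" by simp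
    then show ?thesis using LIMSEQ_unique[OF _ tendsto_const] by metis
  qed
  have local: "AE x in lborel. x \<in> box l0 u0 \<longrightarrow> h x = 0" for l0 u0
  proof -
    define p where "p x = ennreal (h x * indicator (box l0 u0) x)" for x
    define q where "q x = ennreal (- (h x * indicator (box l0 u0) x))" for x
    have [measurable]: "p \<in> borel_measurable lborel" "q \<in> borel_measurable lborel"
      unfolding p_def q_def by measurable
    have pq: "(\<integral>\<^sup>+x\<in>box l u. p x \<partial>lborel) = (\<integral>\<^sup>+x\<in>box l u. q x \<partial>lborel)
      \<and> (\<integral>\<^sup>+x\<in>box l u. p x \<partial>lborel) < \<infinity>" for l u
    proof -
      obtain l' u' where b: "box l0 u0 \<inter> box l u = box l' u'" by (rule that[OF box_Int_box])
      define k where "k x = h x * indicator (box l' u') x" for x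
      have k: "integrable lborel k" "integral\<^sup>L lborel k = 0"
        unfolding k_def using int_box box0 by auto
      have "x \<in> box l' u' \<longleftrightarrow> x \<in> box l0 u0 \<and> x \<in> box l u" for x
        using b by blast
      then have "p x * indicator (box l u) x = ennreal (k x)"
          "q x * indicator (box l u) x = ennreal (- k x)" for x
        unfolding p_def q_def k_def by (auto simp: indicator_def)
      then have e: "(\<integral>\<^sup>+x\<in>box l u. p x \<partial>lborel) = (\<integral>\<^sup>+x. ennreal (k x) \<partial>lborel)"
          "(\<integral>\<^sup>+x\<in>box l u. q x \<partial>lborel) = (\<integral>\<^sup>+x. ennreal (- k x) \<partial>lborel)"
        by simp_all
      have f: "(\<integral>\<^sup>+x. ennreal (k x) \<partial>lborel) < \<infinity>" "(\<integral>\<^sup>+x. ennreal (- k x) \<partial>lborel) < \<infinity>"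
        using k(1) unfolding real_integrable_def by (auto simp: top.not_eq_extremum)
      have "enn2real (\<integral>\<^sup>+x. ennreal (k x) \<partial>lborel) = enn2real (\<integral>\<^sup>+x. ennreal (- k x) \<partial>lborel)"
        using real_lebesgue_integral_def[OF k(1)] k(2) by simp
      then show ?thesis using f ennreal_enn2real[OF f(1)[unfolded infinity_ennreal_def]]
          ennreal_enn2real[OF f(2)[unfolded infinity_ennreal_def]] unfolding e by metis
    qed
    have "density lborel p = density lborel q"
    proof (rule measure_eqI_generator_eq)
      let ?E = "range (\<lambda>(a, b). box a b::(real ^ 'n) set)"
      show "Int_stable ?E" by (auto simp: Int_stable_def box_Int_box)
      show "?E \<subseteq> Pow UNIV" "sets (density lborel p) = sigma_sets UNIV ?E"
        "sets (density lborel q) = sigma_sets UNIV ?E"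
        by (simp_all add: borel_eq_box)
      let ?A = "\<lambda>n::nat. box (- (real n *\<^sub>R One)) (real n *\<^sub>R One) :: (real ^ 'n) set"
      show "range ?A \<subseteq> ?E" "(\<Union>i. ?A i) = UNIV"
        unfolding UN_box_eq_UNIV by auto
      show "emeasure (density lborel p) (?A i) \<noteq> \<infinity>" for i
        using pq[of "- (real i *\<^sub>R One)" "real i *\<^sub>R One"]
        by (auto simp: emeasure_density less_top)
      show "emeasure (density lborel p) X = emeasure (density lborel q) X" if "X \<in> ?E" for X
        using that pq by (auto simp: emeasure_density)
    qed
    then have "AE x in lborel. p x = q x"
      by (intro sigma_finite_measure.density_unique[OF lborel.sigma_finite_measure_axioms]) auto
    then show ?thesis
    proof eventually_elim
      case (elim x)
      show ?case
      proof
        assume "x \<in> box l0 u0"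
        then have "ennreal (h x) = ennreal (- h x)" using elim by (simp add: p_def q_def)
        then show "h x = 0" by (cases "h x \<ge> 0") (auto simp: ennreal_neg ennreal_eq_0_iff ennreal_eq_zero_iff)
      qed
    qed
  qed
  have "AE x in lborel. \<forall>n. x \<in> box (- (real n *\<^sub>R One)) (real n *\<^sub>R One) \<longrightarrow> h x = 0"
    unfolding AE_all_countable using local by blast
  moreover have ex: "\<exists>n. x \<in> box (- (real n *\<^sub>R One)) (real n *\<^sub>R One)" for x :: "real ^ 'n"
    using UN_box_eq_UNIV[where 'a = "real ^ 'n"] by blast
  ultimately show ?thesis by (auto elim!: eventually_mono)
qed

section \<open>Differentiation under the integral sign\<close>

text \<open>A Lipschitz bound at \<open>x0\<close> with an integrable constant dominates the difference quotients. This
  serves for convolutions, for averages over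
  time and for translations.\<close>

lemma has_derivative_integral:
  fixes F :: "'a::real_normed_vector \<Rightarrow> 'w \<Rightarrow> 'b::{banach, second_countable_topology}"
  assumes r: "r > 0"
    and int: "\<And>x. x \<in> ball x0 r \<Longrightarrow> integrable M (F x)"
    and intD: "\<And>v. integrable M (\<lambda>w. D w v)"
    and K: "integrable M K"
    and der: "AE w in M. ((\<lambda>x. F x w) has_derivative D w) (at x0)"
    and lip: "\<And>x. x \<in> ball x0 r \<Longrightarrow> AE w in M. norm (F x w - F x0 w) \<le> K w * norm (x - x0)"
    and bound: "\<And>v. AE w in M. norm (D w v) \<le> K w * norm v"
  shows "((\<lambda>x. LINT w|M. F x w) has_derivative (\<lambda>v. LINT w|M. D w v)) (at x0)"
proof -
  have lin: "AE w in M. bounded_linear (D w)"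
    using der by eventually_elim (rule has_derivative_bounded_linear)
  have add: "(LINT w|M. D w (u + v)) = (LINT w|M. D w u) + (LINT w|M. D w v)" for u v
  proof -
    have "(LINT w|M. D w (u + v)) = (LINT w|M. D w u + D w v)"
    proof (rule integral_cong_AE)
      show "AE w in M. D w (u + v) = D w u + D w v"
        using lin by eventually_elim (simp add: bounded_linear.linear linear_add)
    qed (use intD in auto)
    then show ?thesis using intD by simp
  qed
  have scale: "(LINT w|M. D w (c *\<^sub>R v)) = c *\<^sub>R (LINT w|M. D w v)" for c v
  proof -
    have "(LINT w|M. D w (c *\<^sub>R v)) = (LINT w|M. c *\<^sub>R D w v)"
    proof (rule integral_cong_AE)
      show "AE w in M. D w (c *\<^sub>R v) = c *\<^sub>R D w v"
        using lin by eventually_elim (simp add: bounded_linear.linear linear_scale)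
    qed (use intD in auto)
    then show ?thesis by simp
  qed
  have nb: "norm (LINT w|M. D w v) \<le> norm v * (LINT w|M. K w)" for v
  proof -
    have "norm (LINT w|M. D w v) \<le> (LINT w|M. norm (D w v))" by simp
    also have "\<dots> \<le> (LINT w|M. K w * norm v)"
      using bound intD K by (intro integral_mono_AE) auto
    finally show ?thesis by (simp add: mult.commute)
  qed
  have bl: "bounded_linear (\<lambda>v. LINT w|M. D w v)"
    by (rule bounded_linear_intro[OF add scale nb])
  have "((\<lambda>h. norm ((LINT w|M. F (x0 + h) w) - (LINT w|M. F x0 w) - (LINT w|M. D w h)) / norm h) \<longlongrightarrow> 0) (at 0)"
  proof (subst tendsto_at_iff_sequentially, intro allI impI)
    fix h :: "nat \<Rightarrow> 'a"
    assume h0: "\<forall>i. h i \<in> UNIV - {0}" and hlim: "h \<longlonglongrightarrow> 0"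
    have "\<forall>\<^sub>F i in sequentially. dist (h i) 0 < r" using hlim r by (rule tendstoD)
    then obtain N where N: "\<And>i. i \<ge> N \<Longrightarrow> norm (h i) < r"
      unfolding eventually_sequentially by auto
    define k where "k i = h (i + N)" for i
    have k: "k i \<noteq> 0" "norm (k i) < r" "x0 + k i \<in> ball x0 r" for i
      using h0 N[of "i + N"] by (auto simp: k_def dist_norm)
    have klim: "k \<longlonglongrightarrow> 0" unfolding k_def using hlim by (rule LIMSEQ_ignore_initial_segment)
    define G where "G i w = (1 / norm (k i)) *\<^sub>R (F (x0 + k i) w - F x0 w - D w (k i))" for i w
    have x0b: "x0 \<in> ball x0 r" using r by simp
    have "(\<lambda>i. LINT w|M. G i w) \<longlonglongrightarrow> (LINT w|M. 0)"
    proof (rule integral_dominated_convergence[where w = "\<lambda>w. 2 * K w"])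
      show "G i \<in> borel_measurable M" for i
        unfolding G_def using int[OF k(3), THEN borel_measurable_integrable]
          int[OF x0b, THEN borel_measurable_integrable]
          intD[THEN borel_measurable_integrable] by measurable
      show "integrable M (\<lambda>w. 2 * K w)" using K by simp
      show "AE w in M. (\<lambda>i. G i w) \<longlonglongrightarrow> 0" using der
      proof eventually_elim
        case (elim w)
        then have "((\<lambda>h. norm (F (x0 + h) w - F x0 w - D w h) / norm h) \<longlongrightarrow> 0) (at 0)"
          unfolding has_derivative_at by blast
        then have "(\<lambda>i. norm (F (x0 + k i) w - F x0 w - D w (k i)) / norm (k i)) \<longlonglongrightarrow> 0"
          using klim k unfolding tendsto_at_iff_sequentially comp_def by auto
        then show ?case by (subst tendsto_norm_zero_iff[symmetric]) (simp add: G_def)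
      qed
      show "AE w in M. norm (G i w) \<le> 2 * K w" for i
        using lip[OF k(3)[of i]] bound[of "k i"]
      proof eventually_elim
        case (elim w)
        have "norm (F (x0 + k i) w - F x0 w - D w (k i)) \<le> 2 * K w * norm (k i)"
          using elim norm_triangle_ineq4[of "F (x0 + k i) w - F x0 w" "D w (k i)"] by simp
        then have "norm (F (x0 + k i) w - F x0 w - D w (k i)) / norm (k i) \<le> 2 * K w"
          using k(1)[of i] by (simp add: divide_le_eq)
        then show ?case unfolding G_def norm_scaleR by simp
      qed
    qed simp
    then have "(\<lambda>i. norm (LINT w|M. G i w)) \<longlonglongrightarrow> 0" using tendsto_norm_zero by fastforce
    moreover have "norm (LINT w|M. G i w) = norm ((LINT w|M. F (x0 + k i) w) - (LINT w|M. F x0 w) - (LINT w|M. D w (k i))) / norm (k i)" for i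
      unfolding G_def using int[OF k(3)] int[OF x0b] intD by simp
    ultimately have "(\<lambda>i. norm ((LINT w|M. F (x0 + k i) w) - (LINT w|M. F x0 w) - (LINT w|M. D w (k i))) / norm (k i)) \<longlonglongrightarrow> 0"
      by simp
    then show "((\<lambda>h. norm ((LINT w|M. F (x0 + h) w) - (LINT w|M. F x0 w) - (LINT w|M. D w h)) / norm h) \<circ> h) \<longlonglongrightarrow> 0"
      unfolding k_def comp_def by (rule LIMSEQ_offset)
  qed
  then show ?thesis unfolding has_derivative_at using bl by blast
qed

section \<open>Jensen's inequality for the exponential\<close>

text \<open>The graph of \<open>exp\<close> lies above its tangent at the mean value; integrating this against the
  weight gives the inequality. The right-hand side may be infinite.\<close>

lemma exp_weighted_integral_le:
  fixes u w :: "'a \<Rightarrow> real"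
  assumes w: "\<And>x. 0 \<le> w x" "integrable M w" "integral\<^sup>L M w = 1"
    and [measurable]: "u \<in> borel_measurable M" and wu: "integrable M (\<lambda>x. w x * u x)"
  shows "ennreal (exp (LINT x|M. w x * u x)) \<le> (\<integral>\<^sup>+x. ennreal (w x) * ennreal (exp (u x)) \<partial>M)"
proof (cases "(\<integral>\<^sup>+x. ennreal (w x) * ennreal (exp (u x)) \<partial>M) = \<infinity>")
  case False
  note [measurable] = borel_measurable_integrable[OF w(2)]
  have eq: "(\<integral>\<^sup>+x. ennreal (w x) * ennreal (exp (u x)) \<partial>M) = (\<integral>\<^sup>+x. ennreal (w x * exp (u x)) \<partial>M)"
    using w(1) by (simp add: ennreal_mult')
  have int: "integrable M (\<lambda>x. w x * exp (u x))"
    using False w(1) unfolding eq by (intro integrableI_nonneg) (auto simp: top.not_eq_extremum)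
  define a where "a = (LINT x|M. w x * u x)"
  have int2: "integrable M (\<lambda>x. w x * (exp a * (1 + (u x - a))))"
  proof -
    have "integrable M (\<lambda>x. exp a * (w x * u x + (1 - a) * w x))" using w wu by simp
    then show ?thesis by (simp add: algebra_simps)
  qed
  have "exp a = exp a * (a + (1 - a))" by simp
  also have "\<dots> = (LINT x|M. exp a * (w x * u x + (1 - a) * w x))"
    using w wu by (simp add: a_def)
  also have "\<dots> = (LINT x|M. w x * (exp a * (1 + (u x - a))))"
    by (simp add: algebra_simps)
  also have "\<dots> \<le> (LINT x|M. w x * exp (u x))"
  proof (rule integral_mono[OF int2 int])
    fix x
    have "exp a * (1 + (u x - a)) \<le> exp a * exp (u x - a)"
      using exp_ge_add_one_self by (intro mult_left_mono) auto
    also have "\<dots> = exp (u x)" by (simp add: exp_diff)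
    finally show "w x * (exp a * (1 + (u x - a))) \<le> w x * exp (u x)"
      using w(1) by (intro mult_left_mono)
  qed
  finally show ?thesis unfolding eq a_def[symmetric]
    using nn_integral_eq_integral[OF int] w(1) by (simp add: ennreal_leI)
qed auto

section \<open>Reflection and translation of Lebesgue measure\<close>

lemma lborel_distr_reflect: "distr lborel borel (\<lambda>y. x - y) = (lborel :: 'a::euclidean_space measure)"
  using lborel_affine[of "-1" x] by (simp add: density_1)

lemma integral_lborel_reflect:
  fixes f :: "'a::euclidean_space \<Rightarrow> 'b::{banach, second_countable_topology}"
  assumes [measurable]: "f \<in> borel_measurable borel"
  shows "(LINT y|lborel. f (x - y)) = (LINT y|lborel. f y)"
  using integral_distr[of "\<lambda>y. x - y" lborel borel f] by (simp add: lborel_distr_reflect)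

lemma integrable_lborel_reflect_iff:
  fixes f :: "'a::euclidean_space \<Rightarrow> 'b::{banach, second_countable_topology}"
  assumes [measurable]: "f \<in> borel_measurable borel"
  shows "integrable lborel (\<lambda>y. f (x - y)) \<longleftrightarrow> integrable lborel f"
  using integrable_distr_eq[of "\<lambda>y. x - y" lborel borel f] by (simp add: lborel_distr_reflect)

lemma nn_integral_lborel_reflect:
  fixes f :: "'a::euclidean_space \<Rightarrow> ennreal"
  assumes [measurable]: "f \<in> borel_measurable borel"
  shows "(\<integral>\<^sup>+y. f (x - y) \<partial>lborel) = (\<integral>\<^sup>+y. f y \<partial>lborel)"
  using nn_integral_distr[of "\<lambda>y. x - y" lborel borel f] by (simp add: lborel_distr_reflect)

lemma nn_integral_lborel_shift:
  fixes f :: "'a::euclidean_space \<Rightarrow> ennreal"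
  assumes [measurable]: "f \<in> borel_measurable borel"
  shows "(\<integral>\<^sup>+y. f (x + y) \<partial>lborel) = (\<integral>\<^sup>+y. f y \<partial>lborel)"
  using nn_integral_distr[of "\<lambda>y. x + y" lborel borel f] by (simp add: lborel_distr_plus)

lemma integral_lborel_shift:
  fixes f :: "'a::euclidean_space \<Rightarrow> 'b::{banach, second_countable_topology}"
  assumes [measurable]: "f \<in> borel_measurable borel"
  shows "(LINT y|lborel. f (x + y)) = (LINT y|lborel. f y)"
  using integral_distr[of "\<lambda>y. x + y" lborel borel f] by (simp add: lborel_distr_plus)

section \<open>Matrices and derivatives\<close>

lemma norm_matrix_vector_le:
  fixes A :: "real ^ 'n ^ 'm"
  shows "norm (A *v v) \<le> norm A * norm v"
proof -
  have "norm (A *v v) = L2_set (\<lambda>i. \<bar>(A *v v) $ i\<bar>) UNIV" by (simp add: norm_vec_def)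
  also have "\<dots> \<le> L2_set (\<lambda>i. norm (A $ i) * norm v) UNIV"
    by (intro L2_set_mono) (simp_all add: matrix_vector_mul_component Cauchy_Schwarz_ineq2)
  also have "\<dots> = norm A * norm v" by (simp add: norm_vec_def L2_set_left_distrib[symmetric])
  finally show ?thesis .
qed

lemma matrix_entry_le_norm:
  fixes A :: "real ^ 'n ^ 'm"
  shows "\<bar>A $ i $ j\<bar> \<le> norm A"
  using component_le_norm_cart[of "A $ i" j] Finite_Cartesian_Product.norm_nth_le[of A i] by linarith

lemma trace_bounded_linear: "bounded_linear (trace :: real ^ 'n ^ 'n \<Rightarrow> real)"
  by (rule linear_conv_bounded_linear[THEN iffD1])
     (auto simp: linear_iff trace_def sum.distrib sum_distrib_left)

lemma lipschitz_of_matrix_derivative: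
  fixes f :: "real ^ 'n \<Rightarrow> real ^ 'm"
  assumes "\<And>x. (f has_derivative (\<lambda>v. A x *v v)) (at x)" "\<And>x. norm (A x) \<le> L"
  shows "norm (f x - f y) \<le> L * norm (x - y)"
proof (rule differentiable_bound[of UNIV f "\<lambda>x v. A x *v v"])
  have L: "0 \<le> L" using assms(2)[of undefined] norm_ge_zero[of "A undefined"] by linarith
  show "onorm ((*v) (A x)) \<le> L" for x
    using L norm_matrix_vector_le[of "A x"] assms(2)[of x]
    by (intro onorm_le) (meson mult_right_mono norm_ge_zero order_trans)
qed (use assms(1) in auto)

section \<open>Mollification\<close>

lemma test_function_cmult: "test_function \<phi> \<Longrightarrow> test_function (\<lambda>x. c * \<phi> x)"
  unfolding test_function_def
proof (intro conjI allI)
  assume *: "(\<forall>k. Ck k \<phi>) \<and> compact (closure {x. \<phi> x \<noteq> 0})"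
  show "Ck k (\<lambda>x. c * \<phi> x)" for k using * by (intro Ck_mult Ck_const) auto
  have "bounded (closure {x. \<phi> x \<noteq> 0})" using * compact_imp_bounded by blast
  then have "bounded {x. c * \<phi> x \<noteq> 0}"
    by (rule bounded_subset) (use closure_subset[of "{x. \<phi> x \<noteq> 0}"] in auto)
  then show "compact (closure {x. c * \<phi> x \<noteq> 0})" by simp
qed

text \<open>The normalisation is done for each \<open>\<delta>\<close> separately instead of by scaling one fixed kernel; only
  the upper bound \<open>mollifier_le\<close>, of the order of the inverse volume, depends on \<open>\<delta>\<close>.\<close>

definition mollifier :: "real \<Rightarrow> real ^ 'n \<Rightarrow> real" where
  "mollifier \<delta> z = inverse (LINT z|lborel. box_bump (1 / \<delta>) (\<chi> i. - \<delta>) (\<chi> i. \<delta>) (z :: real ^ 'n))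
      * box_bump (1 / \<delta>) (\<chi> i. - \<delta>) (\<chi> i. \<delta>) z"

lemma test_function_mollifier: "\<delta> > 0 \<Longrightarrow> test_function (mollifier \<delta>)"
  unfolding mollifier_def by (intro test_function_cmult test_function_box_bump) simp

lemma test_function_mollifier_reflect:
  fixes x :: "real ^ 'n"
  assumes "\<delta> > 0" shows "test_function (\<lambda>y. mollifier \<delta> (x - y))"
proof -
  have "box_bump (1 / \<delta>) (\<chi> i. - \<delta>) (\<chi> i. \<delta>) (x - y) = box_bump (1 / \<delta>) (x - (\<chi> i. \<delta>)) (x + (\<chi> i. \<delta>)) y" for y
    unfolding box_bump_def by (simp add: algebra_simps)
  then show ?thesis unfolding mollifier_def using assms
    by (simp add: test_function_cmult test_function_box_bump)
qed

lemma continuous_mollifier: "\<delta> > 0 \<Longrightarrow> continuous_on UNIV (mollifier \<delta>)"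
  by (intro test_function_continuous test_function_mollifier)

lemma mollifier_measurable: "\<delta> > 0 \<Longrightarrow> mollifier \<delta> \<in> borel_measurable borel"
  by (intro borel_measurable_continuous_onI continuous_mollifier)

lemma mollifier_partial_measurable: "\<delta> > 0 \<Longrightarrow> partial_deriv j (mollifier \<delta>) \<in> borel_measurable borel"
  by (intro borel_measurable_continuous_onI test_function_partial_continuous test_function_mollifier)

text \<open>On the half-size cube all factors of the bump are at least \<open>exp (- 2)\<close>.\<close>

lemma box_bump_integral_lower:
  assumes "\<delta> > 0"
  shows "integrable lborel (box_bump (1 / \<delta>) (\<chi> i. - \<delta>) (\<chi> i. \<delta>) :: real ^ 'n \<Rightarrow> real)"
    "(\<delta> / exp 4) ^ CARD('n) \<le> (LINT z|lborel. box_bump (1 / \<delta>) (\<chi> i. - \<delta>) (\<chi> i. \<delta>) (z :: real ^ 'n))"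
proof -
  let ?b = "box_bump (1 / \<delta>) (\<chi> i. - \<delta>) (\<chi> i. \<delta>) :: real ^ 'n \<Rightarrow> real"
  let ?Q = "cbox (\<chi> i. - \<delta> / 2) (\<chi> i. \<delta> / 2) :: (real ^ 'n) set"
  have tf: "test_function ?b" using assms by (intro test_function_box_bump) simp
  have [measurable]: "?b \<in> borel_measurable borel"
    by (intro borel_measurable_continuous_onI test_function_continuous tf)
  obtain R where R: "\<And>x. x \<notin> cball 0 R \<Longrightarrow> ?b x = 0"
    using test_function_support_bounded[OF tf] by metis
  have "integrable lborel (\<lambda>x. ?b x *\<^sub>R (1::real))"
    by (rule loc_integrable_times_bounded[of "\<lambda>_. 1" _ 1 R])
       (auto simp: abs_of_nonneg box_bump_nonneg box_bump_le_1 R intro!: continuous_loc_integrable)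
  then show i: "integrable lborel ?b" by simp
  have Q: "measure lborel ?Q = \<delta> ^ CARD('n)"
  proof -
    have "measure lborel ?Q = (\<Prod>i\<in>UNIV. (\<chi> i. \<delta> / 2) $ i - (\<chi> i. - \<delta> / 2) $ (i::'n))"
      using assms content_cbox_cart[of "\<chi> i. - \<delta> / 2" "\<chi> i. \<delta> / 2 :: real ^ 'n"]
      by (simp add: interval_ne_empty_cart)
    then show ?thesis by simp
  qed
  have le: "indicator ?Q z * exp (- 4) ^ CARD('n) \<le> ?b z" for z
  proof (cases "z \<in> ?Q")
    case True
    have "exp (- 4) \<le> flat ((1 / \<delta>) * (z $ i - - \<delta>)) * flat ((1 / \<delta>) * (\<delta> - z $ i))" for i
    proof -
      have "- \<delta> / 2 \<le> z $ i" "z $ i \<le> \<delta> / 2" using True by (auto simp: mem_box_cart)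
      then have "(1 / \<delta>) * (z $ i - - \<delta>) \<ge> 1 / 2" "(1 / \<delta>) * (\<delta> - z $ i) \<ge> 1 / 2"
        using assms by (auto simp: field_simps)
      then have "exp (- 2) * exp (- 2) \<le> flat ((1 / \<delta>) * (z $ i - - \<delta>)) * flat ((1 / \<delta>) * (\<delta> - z $ i))"
        by (intro mult_mono flat_ge_half flat_nonneg) auto
      then show ?thesis by (simp add: exp_add[symmetric])
    qed
    then have "(\<Prod>i\<in>(UNIV::'n set). exp (- 4)) \<le> ?b z"
      unfolding box_bump_def by (intro prod_mono) auto
    then show ?thesis using True by simp
  qed (simp add: box_bump_nonneg)
  have "(\<delta> / exp 4) ^ CARD('n) = (LINT z|lborel. indicator ?Q z * exp (- 4) ^ CARD('n))"
  proof -
    have "\<delta> / exp 4 = \<delta> * exp (- 4)" by (simp add: exp_minus divide_inverse)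
    then have "(\<delta> / exp 4) ^ CARD('n) = measure lborel ?Q * exp (- 4) ^ CARD('n)"
      unfolding Q by (simp only: power_mult_distrib)
    then show ?thesis by simp
  qed
  also have "\<dots> \<le> integral\<^sup>L lborel ?b"
  proof (rule integral_mono[OF _ i le])
    have "integrable lborel (indicator ?Q :: real ^ 'n \<Rightarrow> real)"
      by (intro integrable_real_indicator emeasure_lborel_cbox_finite) simp
    then show "integrable lborel (\<lambda>z. indicator ?Q z * exp (- 4 :: real) ^ CARD('n))"
      by (rule integrable_mult_left)
  qed
  finally show "(\<delta> / exp 4) ^ CARD('n) \<le> integral\<^sup>L lborel ?b" .
qed

lemma mollifier_nonneg: assumes "\<delta> > 0" shows "0 \<le> mollifier \<delta> (z :: real ^ 'n)"
proof -
  have "0 \<le> (\<delta> / exp 4) ^ CARD('n)" using assms by simp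
  then show ?thesis
    using box_bump_integral_lower(2)[OF assms, where 'n = 'n] unfolding mollifier_def
    by (intro mult_nonneg_nonneg box_bump_nonneg) auto
qed

lemma mollifier_integrable: "\<delta> > 0 \<Longrightarrow> integrable lborel (mollifier \<delta> :: real ^ 'n \<Rightarrow> real)"
  unfolding mollifier_def using box_bump_integral_lower(1) by auto

lemma mollifier_integral: assumes "\<delta> > 0" shows "integral\<^sup>L lborel (mollifier \<delta> :: real ^ 'n \<Rightarrow> real) = 1"
proof -
  have "0 < (\<delta> / exp 4) ^ CARD('n)" using assms by simp
  then have "(LINT z|lborel. box_bump (1 / \<delta>) (\<chi> i. - \<delta>) (\<chi> i. \<delta>) (z :: real ^ 'n)) > 0"
    using box_bump_integral_lower(2)[OF assms, where 'n = 'n] by linarith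
  then show ?thesis unfolding mollifier_def using box_bump_integral_lower(1)[OF assms] by simp
qed

lemma mollifier_le: assumes "\<delta> > 0" shows "mollifier \<delta> (z :: real ^ 'n) \<le> (exp 4 / \<delta>) ^ CARD('n)"
proof -
  have p: "0 < (\<delta> / exp 4) ^ CARD('n)" using assms by simp
  let ?I = "LINT z|lborel. box_bump (1 / \<delta>) (\<chi> i. - \<delta>) (\<chi> i. \<delta>) (z :: real ^ 'n)"
  have "mollifier \<delta> z \<le> inverse ?I * 1"
    unfolding mollifier_def using box_bump_le_1 p box_bump_integral_lower(2)[OF assms, where 'n = 'n]
    by (intro mult_left_mono) auto
  also have "\<dots> \<le> inverse ((\<delta> / exp 4) ^ CARD('n))"
    using p box_bump_integral_lower(2)[OF assms, where 'n = 'n] by (simp add: le_imp_inverse_le)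
  also have "\<dots> = (exp 4 / \<delta>) ^ CARD('n)" by (simp only: power_inverse[symmetric] inverse_divide)
  finally show ?thesis .
qed

lemma mollifier_support:
  fixes z :: "real ^ 'n" and \<delta> :: real
  assumes "\<delta> > 0" "z \<notin> cball 0 (CARD('n) * \<delta>)"
  shows "mollifier \<delta> z = 0"
proof -
  have z: "z \<notin> box (\<chi> i. - \<delta>) (\<chi> i. \<delta>)"
  proof
    assume "z \<in> box (\<chi> i. - \<delta>) (\<chi> i. \<delta>)"
    then have "- \<delta> < z $ i \<and> z $ i < \<delta>" for i by (simp add: mem_box_cart)
    then have "\<bar>z $ i\<bar> \<le> \<delta>" for i by (metis abs_le_iff less_imp_le minus_less_iff)
    then have "(\<Sum>i\<in>UNIV. \<bar>z $ i\<bar>) \<le> (\<Sum>i\<in>(UNIV::'n set). \<delta>)" by (intro sum_mono)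
    then show False using assms(2) norm_le_l1_cart[of z] by simp
  qed
  from this show ?thesis unfolding mollifier_def using box_bump_zero[OF _ z, of "1 / \<delta>"] assms by simp
qed

lemma mollifier_partial_support:
  fixes z :: "real ^ 'n" and \<delta> :: real
  assumes "\<delta> > 0" "z \<notin> cball 0 (CARD('n) * \<delta>)"
  shows "partial_deriv j (mollifier \<delta>) z = 0"
  by (rule partial_deriv_outside_support[of "cball 0 (CARD('n) * \<delta>)"]) (use assms mollifier_support in auto)

lemma mollifier_bound:
  assumes "\<delta> > 0"
  obtains B where "B > 0" "\<And>z::real ^ 'n. \<bar>mollifier \<delta> z\<bar> \<le> B" "\<And>(z::real ^ 'n) j. \<bar>partial_deriv j (mollifier \<delta>) z\<bar> \<le> B"
    "\<And>x y::real ^ 'n. \<bar>mollifier \<delta> x - mollifier \<delta> y\<bar> \<le> B * norm (x - y)"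
proof -
  obtain B where B: "B > 0" "\<And>z::real ^ 'n. \<bar>mollifier \<delta> z\<bar> \<le> B" "\<And>(z::real ^ 'n) j. \<bar>partial_deriv j (mollifier \<delta>) z\<bar> \<le> B"
    using test_function_bounded[OF test_function_mollifier[OF assms]] by metis
  obtain L where L: "L > 0" "\<And>x y::real ^ 'n. \<bar>mollifier \<delta> x - mollifier \<delta> y\<bar> \<le> L * norm (x - y)"
    using test_function_lipschitz[OF test_function_mollifier[OF assms]] by metis
  show ?thesis
  proof (rule that[of "B + L"])
    show "\<bar>mollifier \<delta> x - mollifier \<delta> y\<bar> \<le> (B + L) * norm (x - y)" for x y :: "real ^ 'n"
    proof -
      have "0 \<le> B * norm (x - y)" using B(1) by simp
      then show ?thesis using L(2)[of x y] unfolding distrib_right by linarith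
    qed
    show "\<bar>mollifier \<delta> z\<bar> \<le> B + L" for z :: "real ^ 'n" using B(2)[of z] L(1) by linarith
    show "\<bar>partial_deriv j (mollifier \<delta>) z\<bar> \<le> B + L" for j and z :: "real ^ 'n"
      using B(3)[where z = z and j = j] L(1) by linarith
  qed (use B(1) L(1) in linarith)
qed

definition mollify :: "real \<Rightarrow> (real ^ 'n \<Rightarrow> 'b::{banach, second_countable_topology}) \<Rightarrow> real ^ 'n \<Rightarrow> 'b" where
  "mollify \<delta> f x = (LINT y|lborel. mollifier \<delta> (x - y) *\<^sub>R f y)"

text \<open>The derivative of \<open>mollify \<delta> f\<close>, written in terms of \<open>f\<close> and not of its weak gradient: for a
  field depending on time this makes the joint measurability in time and space evident.\<close>

definition mollify_grad :: "real \<Rightarrow> (real ^ 'n \<Rightarrow> real ^ 'm) \<Rightarrow> real ^ 'n \<Rightarrow> real ^ 'n ^ 'm" where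
  "mollify_grad \<delta> f x = (\<chi> i j. LINT y|lborel. partial_deriv j (mollifier \<delta>) (x - y) * f y $ i)"

lemma mollify_integrable:
  fixes f :: "real ^ 'n \<Rightarrow> 'b::{banach, second_countable_topology}"
  assumes "\<delta> > 0" "loc_integrable f"
  shows "integrable lborel (\<lambda>y. mollifier \<delta> (x - y) *\<^sub>R f y)"
proof -
  obtain B where B: "\<And>z::real ^ 'n. \<bar>mollifier \<delta> z\<bar> \<le> B" using mollifier_bound[OF assms(1)] by metis
  note [measurable] = mollifier_measurable[OF assms(1)]
  show ?thesis
  proof (rule loc_integrable_times_bounded[OF assms(2), of _ B "norm x + CARD('n) * \<delta>"])
    fix y :: "real ^ 'n" assume "y \<notin> cball 0 (norm x + CARD('n) * \<delta>)"
    then have "x - y \<notin> cball 0 (CARD('n) * \<delta>)" using norm_triangle_sub[of y x] by (simp add: norm_minus_commute)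
    then show "mollifier \<delta> (x - y) = 0" by (rule mollifier_support[OF assms(1)])
  qed (use B in auto)
qed

lemma mollify_partial_integrable:
  fixes f :: "real ^ 'n \<Rightarrow> 'b::{banach, second_countable_topology}"
  assumes "\<delta> > 0" "loc_integrable f"
  shows "integrable lborel (\<lambda>y. partial_deriv j (mollifier \<delta>) (x - y) *\<^sub>R f y)"
proof -
  obtain B where B: "\<And>z::real ^ 'n. \<bar>partial_deriv j (mollifier \<delta>) z\<bar> \<le> B" using mollifier_bound[OF assms(1)] by metis
  note [measurable] = mollifier_partial_measurable[OF assms(1)]
  show ?thesis
  proof (rule loc_integrable_times_bounded[OF assms(2), of _ B "norm x + CARD('n) * \<delta>"])
    fix y :: "real ^ 'n" assume "y \<notin> cball 0 (norm x + CARD('n) * \<delta>)"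
    then have "x - y \<notin> cball 0 (CARD('n) * \<delta>)" using norm_triangle_sub[of y x] by (simp add: norm_minus_commute)
    then show "partial_deriv j (mollifier \<delta>) (x - y) = 0" by (rule mollifier_partial_support[OF assms(1)])
  qed (use B in auto)
qed

lemma mollify_reflect:
  fixes f :: "real ^ 'n \<Rightarrow> 'b::{banach, second_countable_topology}"
  assumes "\<delta> > 0" and [measurable]: "f \<in> borel_measurable borel"
  shows "mollify \<delta> f x = (LINT z|lborel. mollifier \<delta> z *\<^sub>R f (x - z))"
proof -
  note [measurable] = mollifier_measurable[OF assms(1)]
  have "(\<lambda>z. mollifier \<delta> z *\<^sub>R f (x - z)) \<in> borel_measurable borel" by measurable
  from integral_lborel_reflect[OF this, of x] show ?thesis by (simp add: mollify_def)
qed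

lemma mollify_reflect_integrable:
  fixes f :: "real ^ 'n \<Rightarrow> 'b::{banach, second_countable_topology}"
  assumes "\<delta> > 0" "loc_integrable f"
  shows "integrable lborel (\<lambda>z. mollifier \<delta> z *\<^sub>R f (x - z))"
proof -
  note [measurable] = mollifier_measurable[OF assms(1)] loc_integrable_measurable[OF assms(2)]
  have "(\<lambda>z. mollifier \<delta> z *\<^sub>R f (x - z)) \<in> borel_measurable borel" by measurable
  from integrable_lborel_reflect_iff[OF this, of x] show ?thesis
    using mollify_integrable[OF assms] by simp
qed

lemma mollify_has_derivative:
  fixes f :: "real ^ 'n \<Rightarrow> real ^ 'm"
  assumes d: "\<delta> > 0" and f: "loc_integrable f"
  shows "(mollify \<delta> f has_derivative (\<lambda>v. mollify_grad \<delta> f x *v v)) (at x)"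
proof -
  note [measurable] = loc_integrable_measurable[OF f]
  obtain B where B: "B > 0" "\<And>(z::real ^ 'n) j. \<bar>partial_deriv j (mollifier \<delta>) z\<bar> \<le> B"
    "\<And>x y::real ^ 'n. \<bar>mollifier \<delta> x - mollifier \<delta> y\<bar> \<le> B * norm (x - y)"
    using mollifier_bound[OF d] by metis
  define R where "R = norm x + 1 + CARD('n) * \<delta>"
  define C where "C = real CARD('n) * B"
  have C: "B \<le> C" unfolding C_def using B(1) by simp
  have out: "x' - y \<notin> cball 0 (CARD('n) * \<delta>)" if "x' \<in> ball x 1" "y \<notin> cball 0 R" for x' y
  proof -
    have "norm y \<le> norm (y - x') + norm (x - x') + norm x"
      by norm
    then show ?thesis using that by (simp add: R_def dist_norm)
  qed
  define D where "D y v = (\<Sum>j\<in>UNIV. partial_deriv j (mollifier \<delta>) (x - y) * v $ j) *\<^sub>R f y" for y and v :: "real ^ 'n"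
  define K where "K y = C * (indicator (cball 0 R) y * norm (f y))" for y
  have sumle: "\<bar>\<Sum>j\<in>UNIV. partial_deriv j (mollifier \<delta>) (x - y) * v $ j\<bar> \<le> C * norm v" for y v
  proof -
    have "norm (\<Sum>j\<in>UNIV. partial_deriv j (mollifier \<delta>) (x - y) * v $ j) \<le> (\<Sum>j\<in>(UNIV::'n set). B * norm v)"
      using B by (intro sum_norm_le) (auto simp: abs_mult intro!: mult_mono component_le_norm_cart)
    then show ?thesis by (simp add: C_def)
  qed
  have "((\<lambda>x. LINT y|lborel. mollifier \<delta> (x - y) *\<^sub>R f y) has_derivative (\<lambda>v. LINT y|lborel. D y v)) (at x)"
  proof (rule has_derivative_integral[of 1 x lborel _ _ K])
    show "integrable lborel (\<lambda>y. mollifier \<delta> (x' - y) *\<^sub>R f y)" for x' by (rule mollify_integrable[OF d f])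
    show "integrable lborel (\<lambda>y. D y v)" for v
    proof -
      have "integrable lborel (\<lambda>y. \<Sum>j\<in>UNIV. v $ j *\<^sub>R (partial_deriv j (mollifier \<delta>) (x - y) *\<^sub>R f y))"
        by (intro Bochner_Integration.integrable_sum integrable_scaleR_right mollify_partial_integrable d f)
      then show ?thesis by (simp add: D_def scaleR_sum_left mult.commute)
    qed
    have "integrable lborel (\<lambda>y. norm (indicator (cball 0 R) y *\<^sub>R f y))"
      using f unfolding loc_integrable_def set_integrable_def by (intro integrable_norm) auto
    then show "integrable lborel K" unfolding K_def by simp
    show "AE y in lborel. ((\<lambda>x. mollifier \<delta> (x - y) *\<^sub>R f y) has_derivative D y) (at x)"
    proof (rule AE_I2)
      fix y
      have "((\<lambda>x. mollifier \<delta> (x - y)) has_derivative (\<lambda>v. \<Sum>j\<in>UNIV. partial_deriv j (mollifier \<delta>) (x - y) * v $ j)) (at x)"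
        by (rule has_derivative_compose[of "\<lambda>x. x - y" "\<lambda>v. v", OF _
             test_function_has_derivative[OF test_function_mollifier[OF d]]])
           (auto intro!: derivative_eq_intros)
      then show "((\<lambda>x. mollifier \<delta> (x - y) *\<^sub>R f y) has_derivative D y) (at x)"
        unfolding D_def by (rule has_derivative_scaleR_left)
    qed
    show "AE y in lborel. norm (mollifier \<delta> (x' - y) *\<^sub>R f y - mollifier \<delta> (x - y) *\<^sub>R f y) \<le> K y * norm (x' - x)"
      if x': "x' \<in> ball x 1" for x'
    proof (rule AE_I2)
      fix y
      show "norm (mollifier \<delta> (x' - y) *\<^sub>R f y - mollifier \<delta> (x - y) *\<^sub>R f y) \<le> K y * norm (x' - x)"
      proof (cases "y \<in> cball 0 R")
        case True
        have "\<bar>mollifier \<delta> (x' - y) - mollifier \<delta> (x - y)\<bar> \<le> C * norm (x' - x)"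
          using B(3)[of "x' - y" "x - y"] C mult_right_mono[OF C norm_ge_zero[of "x' - x"]] by simp
        then have "\<bar>mollifier \<delta> (x' - y) - mollifier \<delta> (x - y)\<bar> * norm (f y) \<le> C * norm (x' - x) * norm (f y)"
          by (intro mult_right_mono) auto
        then show ?thesis using True by (simp add: K_def scaleR_left_diff_distrib[symmetric] mult_ac)
      next
        case False
        have "mollifier \<delta> (x' - y) = 0" "mollifier \<delta> (x - y) = 0"
          using out[OF x' False] out[OF _ False, of x] mollifier_support[OF d] by auto
        then show ?thesis using B C by (simp add: K_def)
      qed
    qed
    show "AE y in lborel. norm (D y v) \<le> K y * norm v" for v
    proof (rule AE_I2)
      fix y
      show "norm (D y v) \<le> K y * norm v"
      proof (cases "y \<in> cball 0 R")
        case True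
        have "\<bar>\<Sum>j\<in>UNIV. partial_deriv j (mollifier \<delta>) (x - y) * v $ j\<bar> * norm (f y) \<le> C * norm v * norm (f y)"
          by (intro mult_right_mono sumle) auto
        then show ?thesis using True by (simp add: K_def D_def mult_ac)
      next
        case False
        have "partial_deriv j (mollifier \<delta>) (x - y) = 0" for j
          using out[OF _ False, of x] mollifier_partial_support[OF d] by auto
        then show ?thesis using False by (simp add: K_def D_def)
      qed
    qed
  qed simp
  moreover have "(LINT y|lborel. D y v) = mollify_grad \<delta> f x *v v" for v
  proof (rule vec_eq_iff[THEN iffD2, rule_format])
    fix i
    have i1: "integrable lborel (\<lambda>y. partial_deriv j (mollifier \<delta>) (x - y) * f y $ i)" for j
      using mollify_partial_integrable[OF d loc_integrable_comp[OF f]] by simp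
    have "integrable lborel (\<lambda>y. D y v)"
    proof -
      have "integrable lborel (\<lambda>y. \<Sum>j\<in>UNIV. v $ j *\<^sub>R (partial_deriv j (mollifier \<delta>) (x - y) *\<^sub>R f y))"
        by (intro Bochner_Integration.integrable_sum integrable_scaleR_right mollify_partial_integrable d f)
      then show ?thesis by (simp add: D_def scaleR_sum_left mult.commute)
    qed
    then have "(LINT y|lborel. D y v) $ i = (LINT y|lborel. D y v $ i)"
      using integral_bounded_linear[OF bounded_linear_vec_nth, of lborel "\<lambda>y. D y v" i] by simp
    also have "\<dots> = (LINT y|lborel. (\<Sum>j\<in>UNIV. (partial_deriv j (mollifier \<delta>) (x - y) * f y $ i) * v $ j))"
      by (simp add: D_def sum_distrib_left sum_distrib_right mult_ac)
    also have "\<dots> = (\<Sum>j\<in>UNIV. (LINT y|lborel. partial_deriv j (mollifier \<delta>) (x - y) * f y $ i) * v $ j)"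
      using i1 by simp
    also have "\<dots> = (mollify_grad \<delta> f x *v v) $ i"
      by (simp add: mollify_grad_def matrix_vector_mult_def)
    finally show "(LINT y|lborel. D y v) $ i = (mollify_grad \<delta> f x *v v) $ i" .
  qed
  ultimately show ?thesis unfolding mollify_def[abs_def] by simp
qed

lemma mollify_continuous:
  fixes f :: "real ^ 'n \<Rightarrow> real ^ 'm"
  assumes "\<delta> > 0" "loc_integrable f" shows "continuous_on UNIV (mollify \<delta> f)"
  using mollify_has_derivative[OF assms] has_derivative_continuous
  by (metis continuous_on_eq_continuous_at open_UNIV)

text \<open>Integration by parts moves the derivative from the kernel onto the weak gradient.\<close>

lemma mollify_grad_eq_mollify:
  fixes f :: "real ^ 'n \<Rightarrow> real ^ 'm" and H :: "real ^ 'n \<Rightarrow> real ^ 'n ^ 'm"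
  assumes d: "\<delta> > 0" and f: "loc_integrable f" and H: "loc_integrable H"
    and weak: "\<And>\<phi> i j. test_function \<phi> \<Longrightarrow>
        (LINT x|lborel. f x $ i * partial_deriv j \<phi> x) = - (LINT x|lborel. H x $ i $ j * \<phi> x)"
  shows "mollify_grad \<delta> f x = mollify \<delta> H x"
proof (intro vec_eq_iff[THEN iffD2, rule_format])
  fix i j
  have pd: "partial_deriv j (\<lambda>y. mollifier \<delta> (x - y)) y = - partial_deriv j (mollifier \<delta>) (x - y)" for y
  proof -
    have "((\<lambda>y. mollifier \<delta> (x - y)) has_derivative (\<lambda>v. \<Sum>j\<in>UNIV. partial_deriv j (mollifier \<delta>) (x - y) * (- v) $ j)) (at y)"
      by (rule has_derivative_compose[of "\<lambda>y. x - y" "\<lambda>v. - v", OF _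
           test_function_has_derivative[OF test_function_mollifier[OF d]]])
         (auto intro!: derivative_eq_intros)
    from partial_deriv_eq[OF this, of j] show ?thesis
      by (simp add: axis_def sum_negf if_distrib if_distribR cong: if_cong)
  qed
  have "integrable lborel (\<lambda>y. mollifier \<delta> (x - y) *\<^sub>R H y)" by (rule mollify_integrable[OF d H])
  then have "(mollify \<delta> H x) $ i $ j = (LINT y|lborel. (mollifier \<delta> (x - y) *\<^sub>R H y) $ i $ j)"
    unfolding mollify_def
    by (rule integral_bounded_linear[OF bounded_linear_compose[OF bounded_linear_vec_nth bounded_linear_vec_nth], symmetric])
  also have "\<dots> = (LINT y|lborel. H y $ i $ j * mollifier \<delta> (x - y))" by (simp add: mult.commute)
  also have "\<dots> = - (LINT y|lborel. f y $ i * partial_deriv j (\<lambda>y. mollifier \<delta> (x - y)) y)"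
    using weak[OF test_function_mollifier_reflect[OF d]] by simp
  also have "\<dots> = mollify_grad \<delta> f x $ i $ j"
    unfolding pd by (simp add: mollify_grad_def mult.commute)
  finally show "mollify_grad \<delta> f x $ i $ j = mollify \<delta> H x $ i $ j" by simp
qed

section \<open>Fields with exponentially integrable gradient\<close>

text \<open>A ball is covered by integer translates of the cell, and their number depends only on the radius:
  shift the centre into the cell first. This replaces integration over the torus.\<close>

lemma nn_integral_ball_le_cells:
  fixes r :: real
  obtains N :: nat where "N > 0"
    "\<And>(g :: real ^ 'n \<Rightarrow> ennreal) C (x :: real ^ 'n). g \<in> borel_measurable borel \<Longrightarrow>
       (\<And>k. (\<forall>i. k $ i \<in> \<int>) \<Longrightarrow> (\<integral>\<^sup>+y\<in>unit_cell. g (y + k) \<partial>lborel) \<le> C) \<Longrightarrow>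
       (\<integral>\<^sup>+y\<in>cball x r. g y \<partial>lborel) \<le> of_nat N * C"
proof -
  define A where "A = {a::real. a \<in> \<int> \<and> \<bar>a\<bar> \<le> \<bar>r\<bar> + 1}"
  define K where "K = {k :: real ^ 'n. \<forall>i. k $ i \<in> A}"
  have finA: "finite A" unfolding A_def by (rule finite_abs_int_segment)
  have "K \<subseteq> (\<lambda>f. \<chi> i. f i) ` (PiE UNIV (\<lambda>_. A))"
  proof
    fix k assume "k \<in> K"
    then have "($) k \<in> PiE UNIV (\<lambda>_. A)" "k = (\<chi> i. ($) k i)" by (auto simp: K_def)
    then show "k \<in> (\<lambda>f. \<chi> i. f i) ` (PiE UNIV (\<lambda>_. A))" by blast
  qed
  then have finK: "finite K" by (rule finite_subset) (intro finite_imageI finite_PiE finA finite)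
  have "0 \<in> K" by (auto simp: K_def A_def)
  then have cardK: "card K > 0" using finK by (auto simp: card_gt_0_iff)
  show ?thesis
  proof (rule that[OF cardK])
    fix g :: "real ^ 'n \<Rightarrow> ennreal" and C and x :: "real ^ 'n"
    assume [measurable]: "g \<in> borel_measurable borel"
      and g: "\<And>k. (\<forall>i. k $ i \<in> \<int>) \<Longrightarrow> (\<integral>\<^sup>+y\<in>unit_cell. g (y + k) \<partial>lborel) \<le> C"
    \<comment> \<open>The integer part of the centre.\<close>
    define m :: "real ^ 'n" where "m = (\<chi> i. of_int \<lfloor>x $ i\<rfloor>)"
    have [measurable]: "(unit_cell :: (real ^ 'n) set) \<in> sets borel" by (simp add: unit_cell_def)
    have cover: "g y * indicator (cball x r) y \<le> (\<Sum>k\<in>K. g y * indicator unit_cell (y - (m + k)))" for y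
    proof (cases "y \<in> cball x r")
      case True
      define k :: "real ^ 'n" where "k = (\<chi> i. of_int \<lfloor>(y - m) $ i\<rfloor>)"
      have "k $ i \<in> A" for i
      proof -
        have "\<bar>(x - y) $ i\<bar> \<le> r" using True component_le_norm_cart[of "x - y" i] by (simp add: dist_norm)
        then have "\<bar>x $ i - y $ i\<bar> \<le> r" by simp
        moreover have "of_int \<lfloor>x $ i\<rfloor> \<le> x $ i" "x $ i < of_int \<lfloor>x $ i\<rfloor> + 1" by linarith+
        ultimately have "- \<bar>r\<bar> \<le> (y - m) $ i" "(y - m) $ i < \<bar>r\<bar> + 1" 
          unfolding m_def vector_minus_component vec_lambda_beta by linarith+
        then have "- \<bar>r\<bar> - 1 \<le> k $ i" "k $ i \<le> \<bar>r\<bar> + 1" unfolding k_def by (simp; linarith)+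
        then show ?thesis unfolding A_def by (auto simp: abs_le_iff k_def)
      qed
      then have kK: "k \<in> K" by (simp add: K_def)
      have "y - (m + k) \<in> unit_cell"
        unfolding unit_cell_def mem_box_cart
      proof
        fix i
        have "(y - (m + k)) $ i = frac ((y - m) $ i)" by (simp add: k_def frac_def)
        then show "0 $ i \<le> (y - (m + k)) $ i \<and> (y - (m + k)) $ i \<le> 1 $ i"
          using frac_lt_1[of "(y - m) $ i"] by simp
      qed
      then have "g y * indicator (cball x r) y = g y * indicator unit_cell (y - (m + k))" using True by simp
      also have "\<dots> \<le> (\<Sum>k\<in>K. g y * indicator unit_cell (y - (m + k)))"
        by (rule member_le_sum[OF kK _ finK]) auto
      finally show ?thesis .
    qed simp
    have "(\<integral>\<^sup>+y\<in>cball x r. g y \<partial>lborel) \<le> (\<integral>\<^sup>+y. (\<Sum>k\<in>K. g y * indicator unit_cell (y - (m + k))) \<partial>lborel)"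
      using cover by (intro nn_integral_mono)
    also have "\<dots> = (\<Sum>k\<in>K. \<integral>\<^sup>+y. g y * indicator unit_cell (y - (m + k)) \<partial>lborel)"
      by (intro nn_integral_sum) measurable
    also have "\<dots> \<le> (\<Sum>k\<in>K. C)"
    proof (rule sum_mono)
      fix k assume k: "k \<in> K"
      have "(\<integral>\<^sup>+y. g y * indicator unit_cell (y - (m + k)) \<partial>lborel) =
         (\<integral>\<^sup>+y. g ((m + k) + y) * indicator unit_cell (((m + k) + y) - (m + k)) \<partial>lborel)"
        by (rule nn_integral_lborel_shift[symmetric]) measurable
      also have "\<dots> = (\<integral>\<^sup>+y\<in>unit_cell. g (y + (m + k)) \<partial>lborel)" by (simp add: add.commute)
      also have "\<dots> \<le> C" using k by (intro g) (auto simp: m_def K_def A_def)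
      finally show "(\<integral>\<^sup>+y. g y * indicator unit_cell (y - (m + k)) \<partial>lborel) \<le> C" .
    qed
    finally show "(\<integral>\<^sup>+y\<in>cball x r. g y \<partial>lborel) \<le> of_nat (card K) * C" by simp
  qed
qed

text \<open>The information on a single time slice that the whole proof rests on. The exponential integrals
  are bounded by the fixed function \<open>M\<close>, so that all estimates are uniform over slices, and on all
  integer translates of the cell. The divergence enters only as the trace of the weak gradient.\<close>

definition good_field :: "real \<Rightarrow> (real \<Rightarrow> real) \<Rightarrow> (real ^ 'n \<Rightarrow> real ^ 'n) \<Rightarrow> bool" where
  "good_field D M f \<longleftrightarrow> periodic f \<and> continuous_on UNIV f \<and>
    (\<exists>H. loc_integrable H \<and>
      (\<forall>\<phi> i j. test_function \<phi> \<longrightarrow>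
        (LINT x|lborel. f x $ i * partial_deriv j \<phi> x) = - (LINT x|lborel. H x $ i $ j * \<phi> x)) \<and>
      (\<forall>\<beta>>0. \<forall>k. (\<forall>i. k $ i \<in> \<int>) \<longrightarrow>
        (\<integral>\<^sup>+x\<in>unit_cell. ennreal (exp (\<beta> * norm (H (x + k)))) \<partial>lborel) \<le> ennreal (M \<beta>)) \<and>
      (AE x in lborel. \<bar>trace (H x)\<bar> \<le> D))"

lemma exp_norm_mollify_le:
  fixes H :: "real ^ 'n \<Rightarrow> 'b::{banach, second_countable_topology}"
  assumes d: "\<delta> > 0" and H: "loc_integrable H" and b: "\<beta> > 0"
  shows "ennreal (exp (\<beta> * norm (mollify \<delta> H x)))
     \<le> (\<integral>\<^sup>+y. ennreal (mollifier \<delta> (x - y)) * ennreal (exp (\<beta> * norm (H y))) \<partial>lborel)"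
proof -
  note [measurable] = loc_integrable_measurable[OF H] mollifier_measurable[OF d]
  have i: "integrable lborel (\<lambda>y. mollifier \<delta> (x - y) *\<^sub>R H y)" by (rule mollify_integrable[OF d H])
  have i': "integrable lborel (\<lambda>y. mollifier \<delta> (x - y) * (\<beta> * norm (H y)))"
    using integrable_mult_right[OF integrable_norm[OF i], of \<beta>]
    by (simp add: abs_of_nonneg[OF mollifier_nonneg[OF d]] mult_ac)
  have "norm (mollify \<delta> H x) \<le> (LINT y|lborel. norm (mollifier \<delta> (x - y) *\<^sub>R H y))"
    unfolding mollify_def by (rule integral_norm_bound)
  also have "\<beta> * \<dots> = (LINT y|lborel. mollifier \<delta> (x - y) * (\<beta> * norm (H y)))"
    by (simp add: abs_of_nonneg[OF mollifier_nonneg[OF d]] mult_ac)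
  finally have "ennreal (exp (\<beta> * norm (mollify \<delta> H x)))
     \<le> ennreal (exp (LINT y|lborel. mollifier \<delta> (x - y) * (\<beta> * norm (H y))))"
    using b by (intro ennreal_leI) simp
  also have "\<dots> \<le> (\<integral>\<^sup>+y. ennreal (mollifier \<delta> (x - y)) * ennreal (exp (\<beta> * norm (H y))) \<partial>lborel)"
  proof (rule exp_weighted_integral_le)
    show "integrable lborel (\<lambda>y. mollifier \<delta> (x - y))"
      by (subst integrable_lborel_reflect_iff) (simp_all add: mollifier_integrable[OF d])
    show "(LINT y|lborel. mollifier \<delta> (x - y)) = 1"
      by (subst integral_lborel_reflect) (simp_all add: mollifier_integral[OF d])
  qed (use i' mollifier_nonneg[OF d] in auto)
  finally show ?thesis .
qed

lemma mollify_dist_le: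
  fixes f :: "real ^ 'n \<Rightarrow> 'b::{banach, second_countable_topology}"
  assumes d: "\<delta> > 0" and f: "loc_integrable f"
    and e: "\<And>z. z \<in> cball 0 (real CARD('n) * \<delta>) \<Longrightarrow> norm (f (x - z) - c) \<le> e"
  shows "norm (mollify \<delta> f x - c) \<le> e"
proof -
  note [measurable] = loc_integrable_measurable[OF f] mollifier_measurable[OF d]
  have i: "integrable lborel (\<lambda>z. mollifier \<delta> z *\<^sub>R f (x - z))" by (rule mollify_reflect_integrable[OF d f])
  have i1: "integrable lborel (\<lambda>z :: real ^ 'n. mollifier \<delta> z *\<^sub>R c)"
    by (rule integrable_scaleR_left) (rule mollifier_integrable[OF d])
  have "mollify \<delta> f x - c = (LINT z|lborel. mollifier \<delta> z *\<^sub>R f (x - z)) - (LINT z|lborel. mollifier \<delta> (z :: real ^ 'n) *\<^sub>R c)"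
    using mollifier_integral[OF d, where 'n = 'n] mollifier_integrable[OF d, where 'n = 'n]
    by (simp add: mollify_reflect[OF d])
  also have "\<dots> = (LINT z|lborel. mollifier \<delta> z *\<^sub>R (f (x - z) - c))"
    using i i1 by (simp add: scaleR_diff_right)
  also have "norm \<dots> \<le> (LINT z|lborel. mollifier \<delta> (z :: real ^ 'n) * e)"
  proof (rule Bochner_Integration.integral_norm_bound_integral)
    show "integrable lborel (\<lambda>z. mollifier \<delta> z *\<^sub>R (f (x - z) - c))"
      using i i1 by (simp add: scaleR_diff_right)
    show "integrable lborel (\<lambda>z :: real ^ 'n. mollifier \<delta> z * e)"
      by (rule integrable_mult_left) (rule mollifier_integrable[OF d])
    show "norm (mollifier \<delta> z *\<^sub>R (f (x - z) - c)) \<le> mollifier \<delta> z * e" for z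
      using e[of z] mollifier_support[OF d, of z] mollifier_nonneg[OF d, of z]
      by (cases "z \<in> cball 0 (real CARD('n) * \<delta>)") (auto intro!: mult_left_mono)
  qed
  also have "\<dots> = e" using mollifier_integral[OF d, where 'n = 'n] by simp
  finally show ?thesis .
qed

text \<open>Both sides average the translates of \<open>f\<close> over the product of the two kernels.\<close>

lemma mollify_commute:
  fixes f :: "real ^ 'n \<Rightarrow> real ^ 'm"
  assumes d: "\<delta> > 0" and k: "\<kappa> > 0" and f: "continuous_on UNIV f"
  shows "mollify \<delta> (mollify \<kappa> f) x = mollify \<kappa> (mollify \<delta> f) x"
proof -
  note fl = continuous_loc_integrable[OF f]
  note [measurable] = loc_integrable_measurable[OF fl] mollifier_measurable[OF d] mollifier_measurable[OF k]
  have cont: "continuous_on UNIV (mollify \<delta> f)" "continuous_on UNIV (mollify \<kappa> f)"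
    by (intro mollify_continuous d k fl)+
  define F where "F w z = (mollifier \<delta> w * mollifier \<kappa> z) *\<^sub>R f (x - w - z)" for w z :: "real ^ 'n"
  obtain B where B: "\<And>z::real ^ 'n. \<bar>mollifier \<delta> z\<bar> \<le> B" "B > 0" using mollifier_bound[OF d] by metis
  obtain B' where B': "\<And>z::real ^ 'n. \<bar>mollifier \<kappa> z\<bar> \<le> B'" "B' > 0" using mollifier_bound[OF k] by metis
  have "integrable (lborel \<Otimes>\<^sub>M lborel) (case_prod F)"
  proof -
    have c: "continuous_on UNIV (\<lambda>p :: (real ^ 'n) \<times> (real ^ 'n). f (x - fst p - snd p))"
      by (intro continuous_on_compose2[OF f] continuous_intros) auto
    have "integrable lborel (\<lambda>p :: (real ^ 'n) \<times> (real ^ 'n). (mollifier \<delta> (fst p) * mollifier \<kappa> (snd p)) *\<^sub>R f (x - fst p - snd p))"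
    proof (rule loc_integrable_times_bounded[OF continuous_loc_integrable[OF c], of _ "B * B'" "real CARD('n) * \<delta> + real CARD('n) * \<kappa>"])
      show "(\<lambda>p. mollifier \<delta> (fst p) * mollifier \<kappa> (snd p)) \<in> borel_measurable (borel :: ((real ^ 'n) \<times> (real ^ 'n)) measure)"
        unfolding borel_prod[symmetric] by measurable
      show "\<bar>mollifier \<delta> (fst p) * mollifier \<kappa> (snd p)\<bar> \<le> B * B'" for p :: "(real ^ 'n) \<times> (real ^ 'n)"
        using B(1)[of "fst p"] B'(1)[of "snd p"] B(2) by (simp add: abs_mult mult_mono)
      fix p :: "(real ^ 'n) \<times> (real ^ 'n)" assume "p \<notin> cball 0 (real CARD('n) * \<delta> + real CARD('n) * \<kappa>)"
      then have "norm (fst p) > real CARD('n) * \<delta> \<or> norm (snd p) > real CARD('n) * \<kappa>"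
        using norm_Pair_le[of "fst p" "snd p"] by auto
      then show "mollifier \<delta> (fst p) * mollifier \<kappa> (snd p) = 0"
        using mollifier_support[OF d, of "fst p"] mollifier_support[OF k, of "snd p"] by auto
    qed
    then show ?thesis unfolding lborel_prod F_def by (simp add: case_prod_beta')
  qed
  from lborel_pair.Fubini_integral[OF this]
  have "(LINT z|lborel. LINT w|lborel. F w z) = (LINT w|lborel. LINT z|lborel. F w z)" .
  moreover have "mollify \<delta> (mollify \<kappa> f) x = (LINT w|lborel. LINT z|lborel. F w z)"
    using loc_integrable_measurable[OF continuous_loc_integrable[OF cont(2)]]
    by (simp add: mollify_reflect[OF d] mollify_reflect[OF k] F_def integral_scaleR_right[symmetric]
        del: integral_scaleR_right)
  moreover have F': "F w z = (mollifier \<delta> w * mollifier \<kappa> z) *\<^sub>R f (x - z - w)" for w z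
    proof -
    have "x - w - z = x - z - w" by (simp add: algebra_simps)
    then show ?thesis by (simp only: F_def)
  qed
  have "mollify \<kappa> (mollify \<delta> f) x = (LINT z|lborel. LINT w|lborel. F w z)"
    using loc_integrable_measurable[OF continuous_loc_integrable[OF cont(1)]]
    by (simp add: mollify_reflect[OF d] mollify_reflect[OF k] F' integral_scaleR_right[symmetric]
        mult.commute del: integral_scaleR_right)
  ultimately show ?thesis by simp
qed

text \<open>Compare both mollifications with the double mollification: averaging a Lipschitz function at
  scale \<open>\<kappa>\<close> moves it by at most the Lipschitz constant times \<open>\<kappa>\<close>.\<close>

lemma mollify_scale_difference:
  fixes f :: "real ^ 'n \<Rightarrow> real ^ 'm"
  assumes d: "\<delta> > 0" and k: "\<kappa> > 0" and f: "continuous_on UNIV f"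
    and L: "\<And>x. norm (mollify_grad \<delta> f x) \<le> L" and L': "\<And>x. norm (mollify_grad \<kappa> f x) \<le> L'"
  shows "norm (mollify \<delta> f x - mollify \<kappa> f x) \<le> L * (real CARD('n) * \<kappa>) + L' * (real CARD('n) * \<delta>)"
proof -
  note fl = continuous_loc_integrable[OF f]
  have pos: "0 \<le> L" "0 \<le> L'" using L[of 0] L'[of 0] norm_ge_zero order_trans by blast+
  have "norm (mollify \<kappa> (mollify \<delta> f) x - mollify \<delta> f x) \<le> L * (real CARD('n) * \<kappa>)"
  proof (rule mollify_dist_le[OF k continuous_loc_integrable[OF mollify_continuous[OF d fl]]])
    fix z :: "real ^ 'n" assume "z \<in> cball 0 (real CARD('n) * \<kappa>)"
    then have "norm ((x - z) - x) \<le> real CARD('n) * \<kappa>" by simp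
    then show "norm (mollify \<delta> f (x - z) - mollify \<delta> f x) \<le> L * (real CARD('n) * \<kappa>)"
      using lipschitz_of_matrix_derivative[OF mollify_has_derivative[OF d fl] L, of "x - z" x] pos
      by (meson mult_left_mono order_trans)
  qed
  moreover have "norm (mollify \<delta> (mollify \<kappa> f) x - mollify \<kappa> f x) \<le> L' * (real CARD('n) * \<delta>)"
  proof (rule mollify_dist_le[OF d continuous_loc_integrable[OF mollify_continuous[OF k fl]]])
    fix z :: "real ^ 'n" assume "z \<in> cball 0 (real CARD('n) * \<delta>)"
    then have "norm ((x - z) - x) \<le> real CARD('n) * \<delta>" by simp
    then show "norm (mollify \<kappa> f (x - z) - mollify \<kappa> f x) \<le> L' * (real CARD('n) * \<delta>)"
      using lipschitz_of_matrix_derivative[OF mollify_has_derivative[OF k fl] L', of "x - z" x] pos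
      by (meson mult_left_mono order_trans)
  qed
  ultimately show ?thesis
    using norm_triangle_ineq4[of "mollify \<delta> (mollify \<kappa> f) x - mollify \<kappa> f x" "mollify \<delta> (mollify \<kappa> f) x - mollify \<delta> f x"]
    unfolding mollify_commute[OF d k f] by simp
qed

lemma mollify_tendsto:
  fixes f :: "real ^ 'n \<Rightarrow> real ^ 'm"
  assumes f: "continuous_on UNIV f" and d: "\<And>k. \<delta> k > 0" and lim: "\<delta> \<longlonglongrightarrow> 0"
  shows "(\<lambda>k. mollify (\<delta> k) f x) \<longlonglongrightarrow> f x"
proof (rule LIMSEQ_I)
  fix e :: real assume e: "e > 0"
  have "isCont f x" using f continuous_on_eq_continuous_at[of UNIV f] by auto
  then obtain r where r: "r > 0" "\<And>y. dist y x < r \<Longrightarrow> dist (f y) (f x) < e / 2"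
    unfolding continuous_at_eps_delta using e by (metis half_gt_zero)
  have "(\<lambda>k. real CARD('n) * \<delta> k) \<longlonglongrightarrow> real CARD('n) * 0" by (intro tendsto_intros lim)
  then have "\<forall>\<^sub>F k in sequentially. real CARD('n) * \<delta> k < r"
    using r(1) by (intro order_tendstoD(2)) auto
  then obtain N where N: "\<And>k. k \<ge> N \<Longrightarrow> real CARD('n) * \<delta> k < r" unfolding eventually_sequentially by auto
  have "norm (mollify (\<delta> k) f x - f x) < e" if "k \<ge> N" for k
  proof -
    have "norm (mollify (\<delta> k) f x - f x) \<le> e / 2"
    proof (rule mollify_dist_le[OF d continuous_loc_integrable[OF f]])
      fix z :: "real ^ 'n" assume "z \<in> cball 0 (real CARD('n) * \<delta> k)"
      then have "dist (x - z) x < r" using N[OF that] by (simp add: dist_norm)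
      from r(2)[OF this] show "norm (f (x - z) - f x) \<le> e / 2" by (simp add: dist_norm)
    qed
    then show ?thesis using e by linarith
  qed
  then show "\<exists>N. \<forall>k\<ge>N. norm (mollify (\<delta> k) f x - f x) < e" by blast
qed

text \<open>Scale \<open>1 / 16 ^ k\<close> makes all rates below powers with natural exponents.\<close>

abbreviation mscale :: "nat \<Rightarrow> real" where "mscale k \<equiv> 1 / 16 ^ k"

text \<open>By Jensen's inequality \<open>exp (\<beta> * norm (mollify_grad \<delta> f x))\<close> is at most the kernel average of
  \<open>exp (\<beta> * norm H)\<close>, hence of order \<open>M \<beta>\<close> times \<open>(1 / \<delta>) ^ CARD('n)\<close>. As \<open>\<beta>\<close> is free, a large
  multiple of \<open>q\<close> turns this into an arbitrarily small power of \<open>1 / \<delta>\<close> for the exponent \<open>q\<close>. So the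
  Lipschitz constant of the mollified field grows at most logarithmically, with any small factor.\<close>

lemma mollify_grad_exp_bound:
  fixes D q :: real and M :: "real \<Rightarrow> real"
  assumes q: "q \<ge> 1"
  obtains C where "C > 0" "\<And>(f :: real ^ 'n \<Rightarrow> real ^ 'n) k x. good_field D M f \<Longrightarrow> exp (q * norm (mollify_grad (mscale k) f x)) \<le> C * 2 ^ k"
proof -
  let ?n = "CARD('n)"
  obtain N :: nat where N: "N > 0"
    "\<And>(g :: real ^ 'n \<Rightarrow> ennreal) C (x :: real ^ 'n). g \<in> borel_measurable borel \<Longrightarrow>
       (\<And>k. (\<forall>i. k $ i \<in> \<int>) \<Longrightarrow> (\<integral>\<^sup>+y\<in>unit_cell. g (y + k) \<partial>lborel) \<le> C) \<Longrightarrow>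
       (\<integral>\<^sup>+y\<in>cball x (real ?n). g y \<partial>lborel) \<le> of_nat N * C"
    using nn_integral_ball_le_cells by blast
  \<comment> \<open>With this exponent the factor 16 ^ (k * n) becomes (2 ^ k) ^ (4 * n).\<close>
  define \<beta> where "\<beta> = real (4 * ?n) * q"
  have b: "\<beta> > 0" using q by (simp add: \<beta>_def)
  define C where "C = max 1 (exp 4 ^ ?n * (real N * \<bar>M \<beta>\<bar>))"
  show ?thesis
  proof (rule that[of C])
    show "C > 0" by (simp add: C_def)
    fix f :: "real ^ 'n \<Rightarrow> real ^ 'n" and k and x :: "real ^ 'n"
    assume gf: "good_field D M f"
    have d: "mscale k > 0" by simp
    obtain H where H: "loc_integrable H"
      "\<And>\<phi> i j. test_function \<phi> \<Longrightarrow>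
        (LINT x|lborel. f x $ i * partial_deriv j \<phi> x) = - (LINT x|lborel. H x $ i $ j * \<phi> x)"
      "\<And>\<beta> k. \<beta> > 0 \<Longrightarrow> (\<forall>i. k $ i \<in> \<int>) \<Longrightarrow>
        (\<integral>\<^sup>+x\<in>unit_cell. ennreal (exp (\<beta> * norm (H (x + k)))) \<partial>lborel) \<le> ennreal (M \<beta>)"
      and f: "continuous_on UNIV f"
      using gf unfolding good_field_def by blast
    note [measurable] = loc_integrable_measurable[OF H(1)]
    have [measurable]: "cball x (real ?n) \<in> sets borel" by simp
    have eq: "mollify_grad (mscale k) f x = mollify (mscale k) H x"
      by (rule mollify_grad_eq_mollify[OF d continuous_loc_integrable[OF f] H(1,2)])
    have "ennreal (exp (\<beta> * norm (mollify_grad (mscale k) f x)))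
      \<le> (\<integral>\<^sup>+y. ennreal (mollifier (mscale k) (x - y)) * ennreal (exp (\<beta> * norm (H y))) \<partial>lborel)"
      unfolding eq by (rule exp_norm_mollify_le[OF d H(1) b])
    also have "\<dots> \<le> (\<integral>\<^sup>+y. ennreal ((exp 4 / mscale k) ^ ?n) * (ennreal (exp (\<beta> * norm (H y))) * indicator (cball x (real ?n)) y) \<partial>lborel)"
    proof (rule nn_integral_mono)
      fix y
      show "ennreal (mollifier (mscale k) (x - y)) * ennreal (exp (\<beta> * norm (H y)))
        \<le> ennreal ((exp 4 / mscale k) ^ ?n) * (ennreal (exp (\<beta> * norm (H y))) * indicator (cball x (real ?n)) y)"
      proof (cases "y \<in> cball x (real ?n)")
        case True
        then have "indicator (cball x (real ?n)) y = (1 :: ennreal)" by simp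
        then show ?thesis unfolding mult_1_right
          by (simp only: mult_1_right) (rule mult_right_mono[OF ennreal_leI[OF mollifier_le[OF d]]], simp)
      next
        case False
        have "real ?n * mscale k \<le> real ?n" by (simp add: divide_le_eq)
        moreover have "norm (x - y) > real ?n" using False by (simp add: dist_norm)
        ultimately have "x - y \<notin> cball 0 (real ?n * mscale k)" by simp
        then show ?thesis by (simp add: mollifier_support[OF d])
      qed
    qed
    also have "\<dots> = ennreal ((exp 4 / mscale k) ^ ?n) * (\<integral>\<^sup>+y\<in>cball x (real ?n). ennreal (exp (\<beta> * norm (H y))) \<partial>lborel)"
      by (intro nn_integral_cmult) measurable
    also have "\<dots> \<le> ennreal ((exp 4 / mscale k) ^ ?n) * (of_nat N * ennreal (M \<beta>))"
      by (intro mult_left_mono N(2) H(3) b) auto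
    also have "\<dots> \<le> ennreal ((exp 4 / mscale k) ^ ?n) * (of_nat N * ennreal \<bar>M \<beta>\<bar>)"
      by (intro mult_left_mono ennreal_leI) auto
    also have "\<dots> = ennreal ((exp 4 / mscale k) ^ ?n * (real N * \<bar>M \<beta>\<bar>))"
      by (simp add: ennreal_mult ennreal_of_nat_eq_real_of_nat)
    finally have *: "exp (\<beta> * norm (mollify_grad (mscale k) f x)) \<le> (exp 4 / mscale k) ^ ?n * (real N * \<bar>M \<beta>\<bar>)"
      by (subst (asm) ennreal_le_iff) auto
    have "exp (q * norm (mollify_grad (mscale k) f x)) ^ (4 * ?n) = exp (\<beta> * norm (mollify_grad (mscale k) f x))"
      unfolding \<beta>_def exp_of_nat_mult[symmetric] by (simp add: mult.assoc)
    also have "\<dots> \<le> (2 ^ k) ^ (4 * ?n) * (exp 4 ^ ?n * (real N * \<bar>M \<beta>\<bar>))"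
    proof -
      have "((2::real) ^ k) ^ (4 * ?n) = (((2 ^ 4) ^ k) ^ ?n)"
        by (simp only: power_mult[symmetric] mult_ac)
      then have "(exp 4 / mscale k) ^ ?n = (2 ^ k) ^ (4 * ?n) * exp 4 ^ ?n"
        by (simp add: power_mult_distrib mult.commute)
      then show ?thesis using * by (simp add: mult.assoc)
    qed
    also have "\<dots> \<le> (2 ^ k) ^ (4 * ?n) * C ^ (4 * ?n)"
    proof (rule mult_left_mono)
      have "exp 4 ^ ?n * (real N * \<bar>M \<beta>\<bar>) \<le> C" by (simp add: C_def)
      also have "C = C ^ 1" by simp
      also have "C ^ 1 \<le> C ^ (4 * ?n)" by (rule power_increasing) (auto simp: C_def Suc_leI)
      finally show "exp 4 ^ ?n * (real N * \<bar>M \<beta>\<bar>) \<le> C ^ (4 * ?n)" .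
    qed simp
    also have "\<dots> = (C * 2 ^ k) ^ (4 * ?n)" by (simp add: power_mult_distrib mult.commute)
    finally show "exp (q * norm (mollify_grad (mscale k) f x)) \<le> C * 2 ^ k"
      by (subst (asm) power_mono_iff) (auto simp: C_def)
  qed
qed

text \<open>Consecutive scales differ by \<open>C * 2 ^ k / 16 ^ k\<close> up to constants; summing from \<open>k\<close> on gives
  the distance to \<open>f\<close> itself. The oscillation of \<open>f\<close> is then bounded through the scale \<open>k = 0\<close>: a
  periodic Lipschitz function has bounded oscillation.\<close>

lemma mollify_error_bound:
  fixes D :: real and M :: "real \<Rightarrow> real"
  obtains C where "C > 0"
    "\<And>(f :: real ^ 'n \<Rightarrow> real ^ 'n) k x. good_field D M f \<Longrightarrow> norm (mollify (mscale k) f x - f x) \<le> C / 8 ^ k"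
    "\<And>(f :: real ^ 'n \<Rightarrow> real ^ 'n) x y. good_field D M f \<Longrightarrow> norm (f x - f y) \<le> C"
proof -
  let ?n = "real CARD('n)"
  obtain C where C: "C > 0" "\<And>(f :: real ^ 'n \<Rightarrow> real ^ 'n) k x. good_field D M f \<Longrightarrow> exp (1 * norm (mollify_grad (mscale k) f x)) \<le> C * 2 ^ k"
    using mollify_grad_exp_bound[of 1 D M] by (metis order_refl)
  have grad: "norm (mollify_grad (mscale k) f x) \<le> C * 2 ^ k"
    if "good_field D M f" for f :: "real ^ 'n \<Rightarrow> real ^ 'n" and k x
    using C(2)[OF that, of k x] exp_ge_add_one_self[of "norm (mollify_grad (mscale k) f x)"]
    by (simp only: mult_1)
  have err: "norm (mollify (mscale k) f x - f x) \<le> 4 * ?n * C / 8 ^ k"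
    if gf: "good_field D M f" for f :: "real ^ 'n \<Rightarrow> real ^ 'n" and k x
  proof -
    have f: "continuous_on UNIV f" using gf by (simp add: good_field_def)
    \<comment> \<open>The bound is written as a telescoping difference; 7 / 2 = 4 * (1 - 1 / 8).\<close>
    have step: "norm (mollify (mscale (Suc j)) f x - mollify (mscale j) f x) \<le> 4 * ?n * C * (1 / 8 ^ j - 1 / 8 ^ Suc j)" for j
    proof -
      have "norm (mollify (mscale (Suc j)) f x - mollify (mscale j) f x)
        \<le> (C * 2 ^ Suc j) * (?n * mscale j) + (C * 2 ^ j) * (?n * mscale (Suc j))"
        by (rule mollify_scale_difference[OF _ _ f grad[OF gf] grad[OF gf]]) auto
      also have "\<dots> = ?n * C * (2 ^ j / 16 ^ j) * (2 + 1 / 16)" by (simp add: field_simps)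
      also have "(2::real) ^ j / 16 ^ j = 1 / 8 ^ j" by (simp add: power_divide[symmetric] power_one_over[symmetric])
      also have "?n * C * (1 / 8 ^ j) * (2 + 1 / 16) \<le> ?n * C * (1 / 8 ^ j) * (7 / 2)"
        using C by (intro mult_left_mono) auto
      also have "\<dots> = 4 * ?n * C * (1 / 8 ^ j - 1 / 8 ^ Suc j)" by (simp add: field_simps)
      finally show ?thesis .
    qed
    have sum: "norm (mollify (mscale (k + m)) f x - mollify (mscale k) f x) \<le> 4 * ?n * C * (1 / 8 ^ k - 1 / 8 ^ (k + m))" for m
    proof (induction m)
      case (Suc m)
      then show ?case using step[of "k + m"]
          norm_triangle_ineq[of "mollify (mscale (Suc (k + m))) f x - mollify (mscale (k + m)) f x" "mollify (mscale (k + m)) f x - mollify (mscale k) f x"]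
        by (simp add: algebra_simps)
    qed simp
    have "(\<lambda>m. mollify (mscale (m + k)) f x) \<longlonglongrightarrow> f x"
    proof (rule LIMSEQ_ignore_initial_segment, rule mollify_tendsto[OF f])
      have "(\<lambda>k. (1 / 16 :: real) ^ k) \<longlonglongrightarrow> 0" by (intro LIMSEQ_power_zero) simp
      then show "mscale \<longlonglongrightarrow> 0" by (simp add: power_one_over)
    qed simp
    then have "(\<lambda>m. norm (mollify (mscale (m + k)) f x - mollify (mscale k) f x)) \<longlonglongrightarrow> norm (f x - mollify (mscale k) f x)"
      by (intro tendsto_intros)
    then have "norm (f x - mollify (mscale k) f x) \<le> 4 * ?n * C * (1 / 8 ^ k)"
    proof (rule LIMSEQ_le_const2, intro exI allI impI)
      fix m
      have "4 * ?n * C * (1 / 8 ^ k - 1 / 8 ^ (k + m)) \<le> 4 * ?n * C * (1 / 8 ^ k)"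
        using C by (intro mult_left_mono) auto
      then show "norm (mollify (mscale (m + k)) f x - mollify (mscale k) f x) \<le> 4 * ?n * C * (1 / 8 ^ k)"
        using sum[of m] by (simp add: add.commute)
    qed
    then show ?thesis by (simp add: norm_minus_commute)
  qed
  have osc: "norm (f x - f y) \<le> 9 * ?n * C" if gf: "good_field D M f" for f :: "real ^ 'n \<Rightarrow> real ^ 'n" and x y
  proof -
    have f: "continuous_on UNIV f" using gf by (simp add: good_field_def)
    define k :: "real ^ 'n" where "k = (\<chi> i. of_int \<lfloor>(x - y) $ i\<rfloor>)"
    have fy: "f (y + k) = f y" using gf unfolding good_field_def periodic_def by (simp add: k_def)
    have "\<bar>(x - (y + k)) $ i\<bar> \<le> 1" for i
    proof -
      have "(x - (y + k)) $ i = frac ((x - y) $ i)" by (simp add: k_def frac_def)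
      then show ?thesis using frac_lt_1[of "(x - y) $ i"] frac_ge_0[of "(x - y) $ i"] by linarith
    qed
    then have "(\<Sum>i\<in>UNIV. \<bar>(x - (y + k)) $ i\<bar>) \<le> (\<Sum>i\<in>(UNIV::'n set). 1)" by (intro sum_mono)
    then have nk: "norm (x - (y + k)) \<le> ?n" using norm_le_l1_cart[of "x - (y + k)"] by simp
    have "norm (mollify (mscale 0) f x - mollify (mscale 0) f (y + k)) \<le> C * norm (x - (y + k))"
      using grad[OF gf, of 0]
      by (intro lipschitz_of_matrix_derivative[OF mollify_has_derivative[OF _ continuous_loc_integrable[OF f]]]) auto
    also have "\<dots> \<le> C * ?n" using nk C by (intro mult_left_mono) auto
    finally have "norm (mollify (mscale 0) f x - mollify (mscale 0) f (y + k)) \<le> C * ?n" .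
    then have "norm (f x - f (y + k)) \<le> 9 * ?n * C"
    proof -
      have "norm (f x - f (y + k)) \<le> norm (mollify (mscale 0) f x - mollify (mscale 0) f (y + k))
         + norm (mollify (mscale 0) f x - f x) + norm (mollify (mscale 0) f (y + k) - f (y + k))"
        by norm
      moreover have "norm (mollify (mscale 0) f x - f x) \<le> 4 * ?n * C"
        "norm (mollify (mscale 0) f (y + k) - f (y + k)) \<le> 4 * ?n * C"
        using err[OF gf, of 0 x] err[OF gf, of 0 "y + k"] by simp_all
      ultimately show ?thesis
        using \<open>norm (mollify (mscale 0) f x - mollify (mscale 0) f (y + k)) \<le> C * ?n\<close> by (simp add: mult_ac)
    qed
    then show ?thesis by (simp add: fy)
  qed
  show ?thesis
  proof (rule that[of "9 * ?n * C"])
    show "9 * ?n * C > 0" using C by simp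
    show "norm (mollify (mscale k) f x - f x) \<le> 9 * ?n * C / 8 ^ k" if "good_field D M f"
      for f :: "real ^ 'n \<Rightarrow> real ^ 'n" and k x
    proof -
      have "4 * ?n * C / 8 ^ k \<le> 9 * ?n * C / 8 ^ k" using C by (intro divide_right_mono) auto
      then show ?thesis using err[OF that, of k x] by linarith
    qed
  qed (rule osc)
qed

text \<open>Jensen's inequality again, now integrated in \<open>x\<close>: mollification does not increase exponential
  integrals, apart from the translation by the kernel variable.\<close>

lemma mollify_grad_exp_integral_bound:
  fixes D \<beta> R :: real and M :: "real \<Rightarrow> real"
  assumes b: "\<beta> > 0"
  obtains C where "C > 0" "\<And>(f :: real ^ 'n \<Rightarrow> real ^ 'n) k. good_field D M f \<Longrightarrow>
     (\<integral>\<^sup>+x\<in>cball 0 R. ennreal (exp (\<beta> * norm (mollify_grad (mscale k) f x))) \<partial>lborel) \<le> ennreal C"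
proof -
  let ?n = "CARD('n)"
  obtain N :: nat where N: "N > 0"
    "\<And>(g :: real ^ 'n \<Rightarrow> ennreal) C (x :: real ^ 'n). g \<in> borel_measurable borel \<Longrightarrow>
       (\<And>k. (\<forall>i. k $ i \<in> \<int>) \<Longrightarrow> (\<integral>\<^sup>+y\<in>unit_cell. g (y + k) \<partial>lborel) \<le> C) \<Longrightarrow>
       (\<integral>\<^sup>+y\<in>cball x R. g y \<partial>lborel) \<le> of_nat N * C"
    using nn_integral_ball_le_cells by blast
  define C where "C = 1 + real N * \<bar>M \<beta>\<bar>"
  show ?thesis
  proof (rule that[of C])
    show "C > 0" by (simp add: C_def add_pos_nonneg)
    fix f :: "real ^ 'n \<Rightarrow> real ^ 'n" and k
    assume gf: "good_field D M f"
    have d: "mscale k > 0" by simp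
    obtain H where H: "loc_integrable H"
      "\<And>\<phi> i j. test_function \<phi> \<Longrightarrow>
        (LINT x|lborel. f x $ i * partial_deriv j \<phi> x) = - (LINT x|lborel. H x $ i $ j * \<phi> x)"
      "\<And>\<beta> k. \<beta> > 0 \<Longrightarrow> (\<forall>i. k $ i \<in> \<int>) \<Longrightarrow>
        (\<integral>\<^sup>+x\<in>unit_cell. ennreal (exp (\<beta> * norm (H (x + k)))) \<partial>lborel) \<le> ennreal (M \<beta>)"
      and f: "continuous_on UNIV f"
      using gf unfolding good_field_def by blast
    note [measurable] = loc_integrable_measurable[OF H(1)] mollifier_measurable[OF d]
    have [measurable]: "cball (0 :: real ^ 'n) R \<in> sets borel" by simp
    have eq: "mollify_grad (mscale k) f x = mollify (mscale k) H x" for x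
      by (rule mollify_grad_eq_mollify[OF d continuous_loc_integrable[OF f] H(1,2)])
    have "(\<integral>\<^sup>+x\<in>cball 0 R. ennreal (exp (\<beta> * norm (mollify_grad (mscale k) f x))) \<partial>lborel)
      \<le> (\<integral>\<^sup>+x. (\<integral>\<^sup>+z. ennreal (mollifier (mscale k) z) * ennreal (exp (\<beta> * norm (H (x - z)))) \<partial>lborel) * indicator (cball 0 R) x \<partial>lborel)"
    proof (intro nn_integral_mono mult_right_mono)
      fix x
      have "(\<lambda>z. ennreal (mollifier (mscale k) z) * ennreal (exp (\<beta> * norm (H (x - z))))) \<in> borel_measurable borel"
        by measurable
      from nn_integral_lborel_reflect[OF this, of x]
      show "ennreal (exp (\<beta> * norm (mollify_grad (mscale k) f x)))
        \<le> (\<integral>\<^sup>+z. ennreal (mollifier (mscale k) z) * ennreal (exp (\<beta> * norm (H (x - z)))) \<partial>lborel)"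
        using exp_norm_mollify_le[OF d H(1) b, of x] by (simp add: eq)
    qed simp
    also have "\<dots> = (\<integral>\<^sup>+x. (\<integral>\<^sup>+z. ennreal (mollifier (mscale k) z) * (ennreal (exp (\<beta> * norm (H (x - z)))) * indicator (cball 0 R) x) \<partial>lborel) \<partial>lborel)"
      by (subst nn_integral_multc[symmetric]) (auto simp: mult.assoc)
    also have "\<dots> = (\<integral>\<^sup>+z. (\<integral>\<^sup>+x. ennreal (mollifier (mscale k) z) * (ennreal (exp (\<beta> * norm (H (x - z)))) * indicator (cball 0 R) x) \<partial>lborel) \<partial>lborel)"
      by (rule lborel_pair.Fubini') measurable
    also have "\<dots> = (\<integral>\<^sup>+z. ennreal (mollifier (mscale k) z) * (\<integral>\<^sup>+x. ennreal (exp (\<beta> * norm (H (x - z)))) * indicator (cball 0 R) x \<partial>lborel) \<partial>lborel)"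
      by (intro nn_integral_cong nn_integral_cmult) measurable
    also have "\<dots> \<le> (\<integral>\<^sup>+z. ennreal (mollifier (mscale k) (z :: real ^ 'n)) * (of_nat N * ennreal (M \<beta>)) \<partial>lborel)"
    proof (rule nn_integral_mono, rule mult_left_mono)
      fix z :: "real ^ 'n"
      have "(\<integral>\<^sup>+x. ennreal (exp (\<beta> * norm (H (x - z)))) * indicator (cball 0 R) x \<partial>lborel)
        = (\<integral>\<^sup>+x. ennreal (exp (\<beta> * norm (H ((z + x) - z)))) * indicator (cball 0 R) (z + x) \<partial>lborel)"
        by (rule nn_integral_lborel_shift[symmetric]) measurable
      also have "\<dots> = (\<integral>\<^sup>+x\<in>cball (- z) R. ennreal (exp (\<beta> * norm (H x))) \<partial>lborel)"
        by (intro nn_integral_cong) (auto simp: indicator_def dist_norm norm_minus_commute add.commute)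
      also have "\<dots> \<le> of_nat N * ennreal (M \<beta>)"
        by (intro N(2) H(3) b) auto
      finally show "(\<integral>\<^sup>+x. ennreal (exp (\<beta> * norm (H (x - z)))) * indicator (cball 0 R) x \<partial>lborel) \<le> of_nat N * ennreal (M \<beta>)" .
    qed simp
    also have "\<dots> = (\<integral>\<^sup>+z. ennreal (mollifier (mscale k) (z :: real ^ 'n)) \<partial>lborel) * (of_nat N * ennreal (M \<beta>))"
      by (intro nn_integral_multc) measurable
    also have "(\<integral>\<^sup>+z. ennreal (mollifier (mscale k) (z :: real ^ 'n)) \<partial>lborel) = 1"
      using nn_integral_eq_integral[OF mollifier_integrable[OF d, where 'n = 'n]]
        mollifier_nonneg[OF d, where 'n = 'n] mollifier_integral[OF d, where 'n = 'n] by simp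
    also have "1 * (of_nat N * ennreal (M \<beta>)) \<le> of_nat N * ennreal \<bar>M \<beta>\<bar>"
      by (auto intro!: mult_left_mono ennreal_leI)
    also have "\<dots> = ennreal (real N * \<bar>M \<beta>\<bar>)" by (simp add: ennreal_mult ennreal_of_nat_eq_real_of_nat)
    also have "\<dots> \<le> ennreal C" by (intro ennreal_leI) (simp add: C_def)
    finally show "(\<integral>\<^sup>+x\<in>cball 0 R. ennreal (exp (\<beta> * norm (mollify_grad (mscale k) f x))) \<partial>lborel) \<le> ennreal C" .
  qed
qed

lemma trace_mollify_grad_le:
  fixes f :: "real ^ 'n \<Rightarrow> real ^ 'n"
  assumes d: "\<delta> > 0" and gf: "good_field D M f"
  shows "\<bar>trace (mollify_grad \<delta> f x)\<bar> \<le> D"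
proof -
  obtain H where H: "loc_integrable H"
    "\<And>\<phi> i j. test_function \<phi> \<Longrightarrow>
      (LINT x|lborel. f x $ i * partial_deriv j \<phi> x) = - (LINT x|lborel. H x $ i $ j * \<phi> x)"
    "AE x in lborel. \<bar>trace (H x)\<bar> \<le> D"
    and f: "continuous_on UNIV f"
    using gf unfolding good_field_def by blast
  have i: "integrable lborel (\<lambda>y. mollifier \<delta> (x - y) *\<^sub>R H y)" by (rule mollify_integrable[OF d H(1)])
  have m: "mollifier \<delta> \<in> borel_measurable borel" by (rule mollifier_measurable[OF d])
  note [measurable] = m
  have im: "integrable lborel (\<lambda>y. mollifier \<delta> (x - y))" "(LINT y|lborel. mollifier \<delta> (x - y)) = 1"
    using integrable_lborel_reflect_iff[OF m, of x] integral_lborel_reflect[OF m, of x]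
    by (simp_all add: mollifier_integrable[OF d] mollifier_integral[OF d])
  have "trace (mollify_grad \<delta> f x) = trace (mollify \<delta> H x)"
    using mollify_grad_eq_mollify[OF d continuous_loc_integrable[OF f] H(1,2)] by simp
  also have "\<dots> = (LINT y|lborel. trace (mollifier \<delta> (x - y) *\<^sub>R H y))"
    unfolding mollify_def by (rule integral_bounded_linear[OF trace_bounded_linear i, symmetric])
  also have "\<bar>\<dots>\<bar> \<le> (LINT y|lborel. \<bar>trace (mollifier \<delta> (x - y) *\<^sub>R H y)\<bar>)" by (rule integral_abs_bound)
  also have "\<dots> \<le> (LINT y|lborel. mollifier \<delta> (x - y) * D)"
  proof (rule integral_mono_AE)
    show "integrable lborel (\<lambda>y. \<bar>trace (mollifier \<delta> (x - y) *\<^sub>R H y)\<bar>)"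
      by (intro integrable_abs integrable_bounded_linear[OF trace_bounded_linear i])
    show "integrable lborel (\<lambda>y. mollifier \<delta> (x - y) * D)" using im by simp
    show "AE y in lborel. \<bar>trace (mollifier \<delta> (x - y) *\<^sub>R H y)\<bar> \<le> mollifier \<delta> (x - y) * D"
      using H(3)
    proof eventually_elim
      case (elim y)
      have "trace (mollifier \<delta> (x - y) *\<^sub>R H y) = mollifier \<delta> (x - y) * trace (H y)"
        by (simp add: trace_def sum_distrib_left)
      then show ?case using elim mollifier_nonneg[OF d, of "x - y"] by (simp add: abs_mult mult_left_mono)
    qed
  qed
  also have "\<dots> = D" using im by simp
  finally show ?thesis .
qed

section \<open>Compression of volume by maps close to the identity\<close>

lemma prod_one_plus_expansion:
  fixes x :: "'a \<Rightarrow> real"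
  assumes "finite S" "\<And>i. i \<in> S \<Longrightarrow> \<bar>x i\<bar> \<le> a" "a \<le> 1"
  shows "\<bar>(\<Prod>i\<in>S. 1 + x i) - 1 - (\<Sum>i\<in>S. x i)\<bar> \<le> 4 ^ card S * a\<^sup>2"
  using assms(1,2)
proof (induction S rule: finite_induct)
  case (insert j S)
  define s where "s = (\<Sum>i\<in>S. x i)"
  define e where "e = (\<Prod>i\<in>S. 1 + x i) - 1 - s"
  have xj: "\<bar>x j\<bar> \<le> a" and a0: "0 \<le> a" using insert.prems[of j] by auto
  have e: "\<bar>e\<bar> \<le> 4 ^ card S * a\<^sup>2" using insert unfolding e_def s_def by auto
  have "\<bar>s\<bar> \<le> (\<Sum>i\<in>S. a)" unfolding s_def using insert.prems by (intro order_trans[OF sum_abs] sum_mono) auto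
  then have "\<bar>s\<bar> \<le> real (card S) * a" by simp
  also have "\<dots> \<le> 4 ^ card S * a"
  proof (rule mult_right_mono[OF _ a0])
    have "card S \<le> 4 ^ card S" using less_exp[of "card S"] power_mono[of "2::nat" 4 "card S"] by simp
    then show "real (card S) \<le> 4 ^ card S" by (metis of_nat_le_iff of_nat_numeral of_nat_power)
  qed
  finally have s: "\<bar>s\<bar> \<le> 4 ^ card S * a" .
  have "\<bar>x j * s\<bar> \<le> a * (4 ^ card S * a)" unfolding abs_mult using xj s a0 by (intro mult_mono) auto
  moreover have "\<bar>x j * e\<bar> \<le> 1 * (4 ^ card S * a\<^sup>2)"
    unfolding abs_mult using xj e assms(3) by (intro mult_mono) auto
  ultimately have "\<bar>x j * s + e + x j * e\<bar> \<le> 3 * (4 ^ card S * a\<^sup>2)"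
    using e by (simp add: power2_eq_square mult_ac)
  also have "\<dots> \<le> 4 ^ card (insert j S) * a\<^sup>2" using insert.hyps by simp
  also have "x j * s + e + x j * e = (\<Prod>i\<in>insert j S. 1 + x i) - 1 - (\<Sum>i\<in>insert j S. x i)"
    using insert.hyps unfolding e_def s_def by (simp add: algebra_simps)
  finally show ?case .
qed simp

definition det_remainder :: "nat \<Rightarrow> real" where
  "det_remainder n = 4 ^ n + fact n * 2 ^ n"

lemma det_remainder_pos: "det_remainder n > 0"
  by (simp add: det_remainder_def add_pos_pos)

text \<open>The identity permutation contributes \<open>1 + trace A\<close> up to second order. Every other permutation
  moves at least two indices and thus picks two off-diagonal entries, each of size at most \<open>a\<close>.\<close>

lemma det_near_identity:
  fixes A :: "real ^ 'n ^ 'n"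
  assumes a: "\<And>i j. \<bar>A $ i $ j\<bar> \<le> a" "a \<le> 1"
  shows "det (mat 1 + A) \<ge> 1 + trace A - det_remainder CARD('n) * a\<^sup>2"
proof -
  let ?n = "CARD('n)"
  let ?P = "{p. p permutes (UNIV :: 'n set)}"
  have a0: "0 \<le> a" using a(1)[of undefined undefined] by linarith
  define t where "t p = of_int (sign p) * (\<Prod>i\<in>UNIV. (mat 1 + A) $ i $ p i)" for p
  have fin: "finite ?P" by (simp add: finite_permutations)
  have idP: "id \<in> ?P" by (simp add: permutes_id)
  have "det (mat 1 + A) = t id + (\<Sum>p\<in>?P - {id}. t p)"
    unfolding det_def t_def[symmetric] by (rule sum.remove[OF fin idP])
  moreover have "t id \<ge> 1 + trace A - 4 ^ ?n * a\<^sup>2"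
  proof -
    have "t id = (\<Prod>i\<in>UNIV. 1 + A $ i $ i)" by (simp add: t_def sign_id mat_def)
    then show ?thesis
      using prod_one_plus_expansion[of "UNIV :: 'n set" "\<lambda>i. A $ i $ i" a] a
      by (auto simp: trace_def abs_le_iff)
  qed
  moreover have "\<bar>\<Sum>p\<in>?P - {id}. t p\<bar> \<le> fact ?n * 2 ^ ?n * a\<^sup>2"
  proof -
    have tp: "\<bar>t p\<bar> \<le> 2 ^ ?n * a\<^sup>2" if p: "p \<in> ?P - {id}" for p
    proof -
      have perm: "p permutes UNIV" and "p \<noteq> id" using p by auto
      then obtain i where i: "p i \<noteq> i" by (auto simp: fun_eq_iff)
      define j where "j = p i"
      have j: "p j \<noteq> j" using i permutes_inj[OF perm] unfolding j_def by (auto dest: injD)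
      have ij: "i \<noteq> j" using i j_def by auto
      define m where "m k = (mat 1 + A) $ k $ p k" for k
      have m1: "\<bar>m k\<bar> \<le> 2" for k using a(1)[of k "p k"] a(2) by (auto simp: m_def mat_def)
      have m2: "\<bar>m i\<bar> \<le> a" "\<bar>m j\<bar> \<le> a" using a(1) i j by (auto simp: m_def mat_def)
      have "\<bar>t p\<bar> = (\<Prod>k\<in>UNIV. \<bar>m k\<bar>)"
        by (simp add: t_def m_def abs_mult sign_def abs_prod)
      also have "\<dots> = \<bar>m i\<bar> * (\<bar>m j\<bar> * (\<Prod>k\<in>UNIV - {i} - {j}. \<bar>m k\<bar>))"
        using ij by (simp add: prod.remove[of UNIV i] prod.remove[of "UNIV - {i}" j])
      also have "\<dots> \<le> a * (a * (\<Prod>k\<in>UNIV - {i} - {j}. 2))"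
        using m1 m2 a0 by (intro mult_mono prod_mono mult_nonneg_nonneg prod_nonneg) auto
      also have "\<dots> \<le> a * (a * 2 ^ ?n)"
        using a0 card_mono[of "UNIV :: 'n set" "UNIV - {i} - {j}"]
        by (intro mult_left_mono) (auto intro!: power_increasing)
      finally show ?thesis by (simp add: power2_eq_square mult_ac)
    qed
    have "\<bar>\<Sum>p\<in>?P - {id}. t p\<bar> \<le> (\<Sum>p\<in>?P - {id}. 2 ^ ?n * a\<^sup>2)"
      by (intro order_trans[OF sum_abs] sum_mono tp)
    also have "\<dots> \<le> (\<Sum>p\<in>?P. 2 ^ ?n * a\<^sup>2)"
      by (intro sum_mono2 fin) auto
    also have "\<dots> = fact ?n * 2 ^ ?n * a\<^sup>2" using card_permutations[of "UNIV :: 'n set" ?n] by simp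
    finally show ?thesis .
  qed
  ultimately show ?thesis unfolding det_remainder_def by (simp add: algebra_simps abs_le_iff)
qed

lemma nn_integral_mono_measure':
  assumes sets: "sets M = sets N"
    and le: "\<And>E. E \<in> sets N \<Longrightarrow> emeasure M E \<le> emeasure N E"
  shows "integral\<^sup>N M g \<le> integral\<^sup>N N g"
  unfolding nn_integral_def
proof (rule SUP_mono)
  fix s assume "s \<in> {s. simple_function M s \<and> s \<le> g}"
  then have s: "simple_function N s" "s \<le> g"
    using sets sets_eq_imp_space_eq[OF sets] by (auto simp: simple_function_def)
  have "integral\<^sup>S M s \<le> integral\<^sup>S N s"
    unfolding simple_integral_def sets_eq_imp_space_eq[OF sets]
    using s(1) by (intro sum_mono mult_left_mono le) (auto simp: simple_function_def)
  then show "\<exists>s'\<in>{s. simple_function N s \<and> s \<le> g}. integral\<^sup>S M s \<le> integral\<^sup>S N s'" using s by blast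
qed

text \<open>The perturbation of the identity is injective, and its Jacobian determinant is at least \<open>c\<close>. So
  the image of any bounded piece of the preimage of \<open>E\<close>, which lies in \<open>E\<close>, has at least \<open>c\<close> times
  the volume of that piece.\<close>

lemma emeasure_vimage_near_identity:
  fixes V :: "real ^ 'n::{finite,wellorder} \<Rightarrow> real ^ 'n::_" and A :: "real ^ 'n::_ \<Rightarrow> real ^ 'n::_ ^ 'n::_"
  assumes V: "\<And>x. (V has_derivative (\<lambda>v. A x *v v)) (at x)"
    and lip: "\<And>x y. norm (V x - V y) \<le> l * norm (x - y)" "l < 1"
    and a: "\<And>x i j. \<bar>A x $ i $ j\<bar> \<le> a" "a \<le> 1"
    and tr: "\<And>x. \<bar>trace (A x)\<bar> \<le> \<tau>"
    and c: "c > 0" "c \<le> 1 - \<tau> - det_remainder CARD('n) * a\<^sup>2"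
    and E: "E \<in> sets borel"
  shows "emeasure lborel ((\<lambda>x. x + V x) -` E) \<le> ennreal (1 / c) * emeasure lborel E"
proof (cases "emeasure lborel E = \<infinity>")
  case True
  then show ?thesis using c by (simp add: ennreal_mult_top)
next
  case False
  define \<Phi> where "\<Phi> x = x + V x" for x
  have der: "(\<Phi> has_derivative (\<lambda>v. (mat 1 + A x) *v v)) (at x)" for x
    unfolding \<Phi>_def
    by (auto intro!: derivative_eq_intros V simp: matrix_vector_mult_add_rdistrib)
  have cont: "continuous_on UNIV \<Phi>"
    using der has_derivative_continuous continuous_on_eq_continuous_at by (metis open_UNIV)
  have inj: "inj \<Phi>"
  proof (rule injI)
    fix x y assume "\<Phi> x = \<Phi> y"
    then have "V x - V y = y - x" by (simp add: \<Phi>_def algebra_simps)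
    then have "norm (x - y) \<le> l * norm (x - y)" using lip(1)[of x y] by (simp add: norm_minus_commute)
    then have "(1 - l) * norm (x - y) \<le> 0" by (simp add: algebra_simps)
    then show "x = y" using lip(2) by (simp add: mult_le_0_iff)
  qed
  have det: "det (matrix (\<lambda>v. (mat 1 + A x) *v v)) \<ge> c" for x
    using det_near_identity[OF a, of x] tr[of x] c(2) by (simp add: abs_le_iff)
  define S where "S k = \<Phi> -` E \<inter> cball 0 (real k)" for k :: nat
  have vim: "\<Phi> -` E \<in> sets borel"
    using measurable_sets[OF borel_measurable_continuous_onI[OF cont] E] by simp
  have S: "S k \<in> sets borel" for k unfolding S_def using vim by auto
  have SL: "S k \<in> lmeasurable" for k
    using S unfolding S_def by (intro bounded_set_imp_lmeasurable) (auto intro: bounded_subset[OF bounded_cball])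
  have EL: "E \<in> lmeasurable" using E False by (intro fmeasurableI) (auto simp: less_top)
  have bnd: "emeasure lborel (S k) \<le> ennreal (1 / c) * emeasure lborel E" for k
  proof -
    have d: "(\<Phi> has_derivative (\<lambda>v. (mat 1 + A x) *v v)) (at x within S k)" for x
      using der has_derivative_at_withinI by blast
    have "\<Phi> differentiable_on S k" using d unfolding differentiable_on_def differentiable_def by blast
    then have "\<Phi> ` S k \<in> sets lebesgue"
      using S[of k] by (intro differentiable_image_in_sets_lebesgue) auto
    moreover have sub: "\<Phi> ` S k \<subseteq> E" by (auto simp: S_def)
    ultimately have im: "\<Phi> ` S k \<in> lmeasurable" using EL fmeasurableI2 by blast
    have h1: "((\<lambda>x. \<bar>det (matrix (\<lambda>v. (mat 1 + A x) *v v))\<bar>) has_integral measure lebesgue (\<Phi> ` S k)) (S k)"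
      using has_measure_differentiable_image[of "S k" \<Phi> "\<lambda>x v. (mat 1 + A x) *v v" "measure lebesgue (\<Phi> ` S k)"]
        SL[of k] d inj im by (auto intro: inj_on_subset)
    have h2: "((\<lambda>x. c) has_integral measure lebesgue (S k) * c) (S k)"
    proof -
      have "((\<lambda>x. 1 :: real) has_integral measure lebesgue (S k)) (S k)"
        using SL[of k] by (simp add: lmeasurable_iff_integrable_on lmeasure_integral has_integral_integral)
      from has_integral_mult_left[OF this, of c] show ?thesis by simp
    qed
    have "measure lebesgue (S k) * c \<le> measure lebesgue (\<Phi> ` S k)"
      by (rule has_integral_le[OF h2 h1 order_trans[OF det abs_ge_self]])
    also have "\<dots> \<le> measure lebesgue E" using im EL sub by (intro measure_mono_fmeasurable) auto
    finally have "measure lebesgue (S k) \<le> (1 / c) * measure lebesgue E"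
      using c(1) by (simp add: field_simps)
    then have "ennreal (measure lebesgue (S k)) \<le> ennreal (1 / c) * ennreal (measure lebesgue E)"
      using c(1) by (simp add: ennreal_mult[symmetric] ennreal_leI)
    then show ?thesis
      using S[of k] E emeasure_eq_ennreal_measure[of lborel "S k"] emeasure_eq_ennreal_measure[of lborel E]
        False emeasure_bounded_finite[of "S k"] bounded_subset[OF bounded_cball, of "S k" 0 "real k"]
      by (simp add: S_def less_top)
  qed
  have "emeasure lborel (\<Union>k. S k) = (SUP k. emeasure lborel (S k))"
    using S by (intro SUP_emeasure_incseq[symmetric]) (auto simp: incseq_def S_def)
  also have "\<dots> \<le> ennreal (1 / c) * emeasure lborel E" by (intro SUP_least bnd)
  also have "(\<Union>k. S k) = \<Phi> -` E" unfolding S_def using real_arch_simple by (auto simp: ) 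
  finally show ?thesis unfolding \<Phi>_def[abs_def] .
qed

lemma nn_integral_le_of_vimage:
  fixes \<Phi> :: "'a::euclidean_space \<Rightarrow> 'a"
  assumes [measurable]: "\<Phi> \<in> borel_measurable borel" "g \<in> borel_measurable borel"
    and le: "\<And>E. E \<in> sets borel \<Longrightarrow> emeasure lborel (\<Phi> -` E) \<le> K * emeasure lborel E"
  shows "(\<integral>\<^sup>+x. g (\<Phi> x) \<partial>lborel) \<le> K * (\<integral>\<^sup>+x. g x \<partial>lborel)"
proof -
  have "(\<integral>\<^sup>+x. g (\<Phi> x) \<partial>lborel) = (\<integral>\<^sup>+x. g x \<partial>distr lborel borel \<Phi>)"
    by (simp add: nn_integral_distr)
  also have "\<dots> \<le> (\<integral>\<^sup>+x. g x \<partial>density lborel (\<lambda>_. K))"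
  proof (rule nn_integral_mono_measure')
    show "sets (distr lborel borel \<Phi>) = sets (density lborel (\<lambda>_. K))" by simp
    show "emeasure (distr lborel borel \<Phi>) E \<le> emeasure (density lborel (\<lambda>_. K)) E" if "E \<in> sets (density lborel (\<lambda>_. K))" for E
      using le[of E] that by (simp add: emeasure_distr emeasure_density nn_integral_cmult_indicator)
  qed
  also have "\<dots> = K * (\<integral>\<^sup>+x. g x \<partial>lborel)"
    by (simp add: nn_integral_density nn_integral_cmult)
  finally show ?thesis .
qed

text \<open>The change of variables formula used above lives on well-ordered index types. An arbitrary
  finite index type is given the order of some enumeration; the induced permutation of coordinates
  preserves norms, traces and Lebesgue measure.\<close>

typedef 'a ranked = "UNIV :: 'a set" by simp

lemma bij_Rep_ranked: "bij Rep_ranked"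
  by (rule bijI) (auto simp: inj_on_def Rep_ranked_inject intro: Abs_ranked_inverse[symmetric])

instance ranked :: (finite) finite
proof
  have "finite (range (Abs_ranked :: 'a \<Rightarrow> 'a ranked))" by simp
  moreover have "range (Abs_ranked :: 'a \<Rightarrow> 'a ranked) = UNIV"
    by (metis UNIV_eq_I Rep_ranked_inverse rangeI)
  ultimately show "finite (UNIV :: 'a ranked set)" by simp
qed

definition rank :: "'a::finite \<Rightarrow> nat" where "rank = (SOME f. inj f)"

lemma inj_rank: "inj rank"
  unfolding rank_def using finite_imp_inj_to_nat_seg[OF finite, of UNIV] by (metis someI)

instantiation ranked :: (finite) wellorder
begin

definition less_eq_ranked :: "'a ranked \<Rightarrow> 'a ranked \<Rightarrow> bool" where
  "less_eq_ranked x y \<longleftrightarrow> rank (Rep_ranked x) \<le> rank (Rep_ranked y)"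

definition less_ranked :: "'a ranked \<Rightarrow> 'a ranked \<Rightarrow> bool" where
  "less_ranked x y \<longleftrightarrow> rank (Rep_ranked x) < rank (Rep_ranked y)"

instance
proof
  fix x y z :: "'a ranked" and P
  show "x \<le> y \<Longrightarrow> y \<le> x \<Longrightarrow> x = y"
    unfolding less_eq_ranked_def by (metis inj_rank injD Rep_ranked_inject le_antisym)
  show "P x" if "\<And>x. (\<And>y. y < x \<Longrightarrow> P y) \<Longrightarrow> P x"
    by (rule measure_induct_rule[of "\<lambda>x. rank (Rep_ranked x)"]) (use that in \<open>auto simp: less_ranked_def\<close>)
qed (auto simp: less_eq_ranked_def less_ranked_def)

end

definition reindex :: "real ^ 'n \<Rightarrow> real ^ 'n ranked" where
  "reindex x = (\<chi> i. x $ Rep_ranked i)"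

definition unindex :: "real ^ 'n ranked \<Rightarrow> real ^ 'n" where
  "unindex y = (\<chi> i. y $ Abs_ranked i)"

lemma unindex_reindex [simp]: "unindex (reindex x) = x"
  by (simp add: reindex_def unindex_def vec_eq_iff Abs_ranked_inverse)

lemma bounded_linear_reindex: "bounded_linear reindex"
  by (rule linear_conv_bounded_linear[THEN iffD1]) (auto simp: linear_iff reindex_def vec_eq_iff)

lemma bounded_linear_unindex: "bounded_linear unindex"
  by (rule linear_conv_bounded_linear[THEN iffD1]) (auto simp: linear_iff unindex_def vec_eq_iff)

lemma sum_ranked: "(\<Sum>i\<in>UNIV. f (Rep_ranked i)) = (\<Sum>i\<in>UNIV. f i)"
  using sum.reindex_bij_betw[OF bij_Rep_ranked] by auto

lemma norm_reindex: "norm (reindex x) = norm x"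
  using sum_ranked[of "\<lambda>i. (x $ i)\<^sup>2"] by (simp add: norm_vec_def L2_set_def reindex_def)

lemma norm_unindex: "norm (unindex y) = norm y"
proof -
  have "reindex (unindex y) = y" by (simp add: reindex_def unindex_def vec_eq_iff Rep_ranked_inverse)
  then show ?thesis by (metis norm_reindex)
qed

lemma emeasure_box_cart:
  fixes l u :: "real ^ 'n"
  assumes "\<And>i. l $ i \<le> u $ i"
  shows "emeasure lborel (box l u) = ennreal (\<Prod>i\<in>UNIV. u $ i - l $ i)"
proof -
  have "l \<bullet> b \<le> u \<bullet> b" if "b \<in> Basis" for b
    using that assms by (auto simp: Basis_vec_def inner_axis)
  moreover have "(\<Prod>b\<in>(Basis :: (real ^ 'n) set). (u - l) \<bullet> b) = (\<Prod>i\<in>UNIV. (u - l) \<bullet> axis i 1)"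
    unfolding Basis_vec_def by (simp add: UNION_singleton_eq_range) (subst prod.reindex; simp add: inj_on_def axis_eq_axis)
  ultimately show ?thesis by (simp add: emeasure_lborel_box_eq inner_axis)
qed

lemma lborel_distr_unindex: "distr lborel borel unindex = (lborel :: (real ^ 'n) measure)"
proof (rule lborel_eqI[symmetric])
  fix l u :: "real ^ 'n" assume lu: "\<And>b. b \<in> Basis \<Longrightarrow> l \<bullet> b \<le> u \<bullet> b"
  have le: "l $ i \<le> u $ i" for i using lu[of "axis i 1"] by (simp add: inner_axis axis_in_Basis_iff)
  have [measurable]: "unindex \<in> borel_measurable borel"
    by (intro borel_measurable_continuous_onI linear_continuous_on bounded_linear_unindex)
  have "unindex -` box l u = box (reindex l) (reindex u)"
  proof (intro set_eqI iffI)
    fix y assume y: "y \<in> unindex -` box l u"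
    show "y \<in> box (reindex l) (reindex u)"
      unfolding mem_box_cart
    proof
      fix i show "reindex l $ i < y $ i \<and> y $ i < reindex u $ i"
        using y[unfolded vimage_eq mem_box_cart, rule_format, of "Rep_ranked i"]
        by (simp add: reindex_def unindex_def Rep_ranked_inverse)
    qed
  next
    fix y assume y: "y \<in> box (reindex l) (reindex u)"
    show "y \<in> unindex -` box l u"
      unfolding mem_box_cart vimage_eq
    proof
      fix i show "l $ i < unindex y $ i \<and> unindex y $ i < u $ i"
        using y[unfolded mem_box_cart, rule_format, of "Abs_ranked i"]
        by (simp add: reindex_def unindex_def Abs_ranked_inverse)
    qed
  qed
  then have "emeasure (distr lborel borel unindex) (box l u) = emeasure lborel (box (reindex l) (reindex u))"
    by (simp add: emeasure_distr)
  also have "\<dots> = ennreal (\<Prod>i\<in>UNIV. reindex u $ i - reindex l $ i)"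
    by (rule emeasure_box_cart) (simp add: reindex_def le)
  also have "(\<Prod>i\<in>UNIV. reindex u $ i - reindex l $ i) = (\<Prod>i\<in>UNIV. u $ i - l $ i)"
    unfolding reindex_def using prod.reindex_bij_betw[OF bij_Rep_ranked, of "\<lambda>i. u $ i - l $ i"] by simp
  also have "ennreal \<dots> = emeasure lborel (box l u)"
    by (rule emeasure_box_cart[symmetric]) (rule le)
  also have "\<dots> = (\<Prod>b\<in>Basis. (u - l) \<bullet> b)"
    using lu by (simp add: emeasure_lborel_box_eq)
  finally show "emeasure (distr lborel borel unindex) (box l u) = (\<Prod>b\<in>Basis. (u - l) \<bullet> b)" .
qed simp

text \<open>The bound \<open>c\<close> on the determinant contains \<open>\<tau>\<close> only to first order and \<open>a\<close> to second order: in a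
  time step of length \<open>h\<close> these are \<open>h\<close> times the divergence and \<open>h\<^sup>2\<close> times the squared gradient,
  and only the first survives the composition of many steps.\<close>

lemma nn_integral_near_identity:
  fixes V :: "real ^ 'n \<Rightarrow> real ^ 'n" and A :: "real ^ 'n \<Rightarrow> real ^ 'n ^ 'n"
  assumes V: "\<And>x. (V has_derivative (\<lambda>v. A x *v v)) (at x)"
    and lip: "\<And>x y. norm (V x - V y) \<le> l * norm (x - y)" "l < 1"
    and a: "\<And>x i j. \<bar>A x $ i $ j\<bar> \<le> a" "a \<le> 1"
    and tr: "\<And>x. \<bar>trace (A x)\<bar> \<le> \<tau>"
    and c: "c > 0" "c \<le> 1 - \<tau> - det_remainder CARD('n) * a\<^sup>2"
    and [measurable]: "g \<in> borel_measurable borel"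
  shows "(\<integral>\<^sup>+x. g (x + V x) \<partial>lborel) \<le> ennreal (1 / c) * (\<integral>\<^sup>+x. g x \<partial>lborel)"
proof -
  define V' where "V' y = reindex (V (unindex y))" for y
  define A' where "A' y = (\<chi> i j. A (unindex y) $ Rep_ranked i $ Rep_ranked j)" for y
  have lin: "reindex (x + y) = reindex x + reindex y" "reindex (x - y) = reindex x - reindex y"
    "unindex (u + w) = unindex u + unindex w" "unindex (u - w) = unindex u - unindex w" for x y :: "real ^ 'n" and u w
    by (simp_all add: reindex_def unindex_def vec_eq_iff)
  have card: "CARD('n ranked) = CARD('n)"
    using bij_betw_same_card[OF bij_Rep_ranked] .
  have V'der: "(V' has_derivative (\<lambda>v. A' y *v v)) (at y)" for y
  proof -
    have "((\<lambda>y. reindex (V (unindex y))) has_derivative (\<lambda>v. reindex (A (unindex y) *v unindex v))) (at y)"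
      by (intro bounded_linear.has_derivative[OF bounded_linear_reindex]
          has_derivative_compose[OF bounded_linear_imp_has_derivative[OF bounded_linear_unindex] V])
    moreover have "reindex (A (unindex y) *v unindex v) = A' y *v v" for v
    proof (rule vec_eq_iff[THEN iffD2, rule_format])
      fix i
      have "(A' y *v v) $ i = (\<Sum>j\<in>UNIV. A (unindex y) $ Rep_ranked i $ Rep_ranked j * unindex v $ Rep_ranked j)"
        by (simp add: A'_def matrix_vector_mult_def unindex_def Rep_ranked_inverse)
      then show "reindex (A (unindex y) *v unindex v) $ i = (A' y *v v) $ i"
        using sum_ranked[of "\<lambda>j. A (unindex y) $ Rep_ranked i $ j * unindex v $ j"]
        by (simp add: reindex_def matrix_vector_mult_def)
    qed
    ultimately show ?thesis by (simp add: V'_def[abs_def])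
  qed
  have lip': "norm (V' x - V' y) \<le> l * norm (x - y)" for x y
    using lip(1)[of "unindex x" "unindex y"] unfolding V'_def
    by (simp add: lin[symmetric] norm_reindex norm_unindex)
  have tr': "\<bar>trace (A' y)\<bar> \<le> \<tau>" for y
    using tr[of "unindex y"] sum_ranked[of "\<lambda>i. A (unindex y) $ i $ i"] by (simp add: trace_def A'_def)
  have cV': "continuous_on UNIV V'"
    using V'der has_derivative_continuous continuous_on_eq_continuous_at by (metis open_UNIV)
  have [measurable]: "V' \<in> borel_measurable borel" by (rule borel_measurable_continuous_onI[OF cV'])
  have [measurable]: "unindex \<in> borel_measurable borel"
    by (intro borel_measurable_continuous_onI linear_continuous_on bounded_linear_unindex)
  have "continuous_on UNIV V"
    using V has_derivative_continuous continuous_on_eq_continuous_at by (metis open_UNIV)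
  then have [measurable]: "V \<in> borel_measurable borel" by (rule borel_measurable_continuous_onI)
  have tr_nn: "(\<integral>\<^sup>+x. h x \<partial>lborel) = (\<integral>\<^sup>+y. h (unindex y) \<partial>lborel)" if [measurable]: "h \<in> borel_measurable borel" for h :: "real ^ 'n \<Rightarrow> ennreal"
    using nn_integral_distr[of unindex lborel borel h] by (simp add: lborel_distr_unindex)
  have "(\<integral>\<^sup>+x. g (x + V x) \<partial>lborel) = (\<integral>\<^sup>+y. g (unindex y + V (unindex y)) \<partial>lborel)"
    by (rule tr_nn) measurable
  also have "\<dots> = (\<integral>\<^sup>+y. g (unindex (y + V' y)) \<partial>lborel)"
    by (simp add: lin V'_def)
  also have "\<dots> \<le> ennreal (1 / c) * (\<integral>\<^sup>+y. g (unindex y) \<partial>lborel)"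
  proof (rule nn_integral_le_of_vimage[where g = "\<lambda>y. g (unindex y)" and \<Phi> = "\<lambda>y. y + V' y"])
    show "emeasure lborel ((\<lambda>y. y + V' y) -` E) \<le> ennreal (1 / c) * emeasure lborel E" if "E \<in> sets borel" for E
      by (rule emeasure_vimage_near_identity[OF V'der lip' lip(2) _ a(2) tr' c(1) _ that])
         (use a(1) c(2) card in \<open>auto simp: A'_def\<close>)
  qed measurable
  also have "(\<integral>\<^sup>+y. g (unindex y) \<partial>lborel) = (\<integral>\<^sup>+x. g x \<partial>lborel)"
    by (rule tr_nn[symmetric]) measurable
  finally show ?thesis .
qed

section \<open>The Euler scheme of a field that is Lipschitz in space\<close>

text \<open>Jensen's inequality for the arithmetic mean of \<open>N * a 0, N * a 1, ...\<close>.\<close>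

lemma exp_mean_le:
  fixes a :: "nat \<Rightarrow> real"
  assumes "N > 0"
  shows "exp (\<Sum>i<N. a i) \<le> (\<Sum>i<N. exp (real N * a i)) / real N"
proof -
  define s where "s = (\<Sum>i<N. a i)"
  have "real N * exp s = (\<Sum>i<N. exp s * (1 + (real N * a i - s)))"
  proof -
    have "(\<Sum>i<N. exp s * (1 + (real N * a i - s))) = exp s * (real N + (real N * s - real N * s))"
      by (simp add: sum_distrib_left[symmetric] sum.distrib sum_subtractf s_def)
    then show ?thesis by simp
  qed
  also have "\<dots> \<le> (\<Sum>i<N. exp (real N * a i))"
  proof (rule sum_mono)
    fix i
    have "exp s * (1 + (real N * a i - s)) \<le> exp s * exp (real N * a i - s)"
      using exp_ge_add_one_self by (intro mult_left_mono) auto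
    then show "exp s * (1 + (real N * a i - s)) \<le> exp (real N * a i)" by (simp add: exp_diff)
  qed
  finally show ?thesis using assms unfolding s_def by (simp add: field_simps)
qed

lemma integral_norm_bound_integral_AE':
  fixes f :: "'a \<Rightarrow> 'b::{banach, second_countable_topology}"
  assumes "integrable M f" "integrable M g" "AE x in M. norm (f x) \<le> g x"
  shows "norm (integral\<^sup>L M f) \<le> integral\<^sup>L M g"
  using integral_norm_bound[of M f] integral_mono_AE[OF integrable_norm[OF assms(1)] assms(2,3)] by linarith

text \<open>Solutions in the sense of Caratheodory; the integral is over \<open>lebesgue\<close>, since the integrand is
  merely Lebesgue measurable in time.\<close>

definition trajectory :: "real \<Rightarrow> (real \<Rightarrow> real ^ 'n \<Rightarrow> real ^ 'n) \<Rightarrow> (real \<Rightarrow> real ^ 'n) \<Rightarrow> bool" where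
  "trajectory T b \<gamma> \<longleftrightarrow> set_integrable lebesgue {0..T} (\<lambda>s. b s (\<gamma> s)) \<and>
     (\<forall>t\<in>{0..T}. \<gamma> t = \<gamma> 0 + (LINT s:{0..t}|lebesgue. b s (\<gamma> s)))"

text \<open>One approximation: \<open>c\<close> is a field with spatial derivative \<open>A\<close>, bounded by \<open>L\<close>, and divergence
  bounded by \<open>D\<close>. The integrable \<open>m\<close> dominates the
  field at each time and so controls how far a step can move a point. The last line
  makes the step \<open>T / N\<close> so small that each step is injective and that the quadratic remainder of
  its Jacobian determinant is dominated by the step.\<close>

locale euler_scheme =
  fixes T :: real and c :: "real \<Rightarrow> real ^ 'n \<Rightarrow> real ^ 'n" and A :: "real \<Rightarrow> real ^ 'n \<Rightarrow> real ^ 'n ^ 'n"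
    and m :: "real \<Rightarrow> real" and L D :: real and N :: nat
  assumes T: "T > 0" and N: "N > 0"
    and c_meas: "(\<lambda>(s, x). c s x) \<in> borel_measurable (borel \<Otimes>\<^sub>M borel)"
    and A_meas: "(\<lambda>(s, x). A s x) \<in> borel_measurable (borel \<Otimes>\<^sub>M borel)"
    and m: "integrable lborel m"
    and c_le: "\<And>s x. norm (c s x) \<le> m s"
    and c_deriv: "\<And>s x. (c s has_derivative (\<lambda>v. A s x *v v)) (at x)"
    and A_le: "\<And>s x. norm (A s x) \<le> L"
    and trace_le: "\<And>s x. \<bar>trace (A s x)\<bar> \<le> D"
    and small: "T / N * L \<le> 1 / 2" "T / N * (D + 1) \<le> 1 / 2" "det_remainder CARD('n) * (T / N) * L\<^sup>2 \<le> 1"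
begin

definition h :: real where "h = T / N"
definition I :: "nat \<Rightarrow> real set" where "I i = {real i * h<..real (Suc i) * h}"
definition M1 :: real where "M1 = (LINT s|lborel. m s)"

text \<open>The field is integrated over a time step, not sampled, because it is only measurable in
  time. Iterating the maps \<open>x + V i x\<close> gives \<open>Y\<close>, whose derivative \<open>G\<close> is a product of
  matrices; \<open>W\<close> bounds the norm of that product.\<close>

definition V :: "nat \<Rightarrow> real ^ 'n \<Rightarrow> real ^ 'n" where
  "V i x = (LINT s:I i|lborel. c s x)"
definition B :: "nat \<Rightarrow> real ^ 'n \<Rightarrow> real ^ 'n ^ 'n" where
  "B i x = (LINT s:I i|lborel. A s x)"

primrec Y :: "nat \<Rightarrow> real ^ 'n \<Rightarrow> real ^ 'n" where
  "Y 0 x = x"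
| "Y (Suc i) x = Y i x + V i (Y i x)"

primrec G :: "nat \<Rightarrow> real ^ 'n \<Rightarrow> real ^ 'n ^ 'n" where
  "G 0 x = mat 1"
| "G (Suc i) x = (mat 1 + B i (Y i x)) ** G i x"

definition W :: "real ^ 'n \<Rightarrow> real" where
  "W x = exp (\<Sum>i<N. norm (B i (Y i x)))"

lemma h_pos: "h > 0" and Nh: "real N * h = T"
  using T N by (auto simp: h_def)

lemma L_nonneg: "0 \<le> L" using A_le[of 0 0] norm_ge_zero order_trans by blast
lemma D_nonneg: "0 \<le> D" using trace_le[of 0 0] abs_ge_zero order_trans by blast
lemma m_nonneg: "0 \<le> m s" using c_le[of s 0] norm_ge_zero order_trans by blast

lemma measure_I: "measure lborel (I i) = h" and emeasure_I: "emeasure lborel (I i) = ennreal h"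
  and sets_I [measurable]: "I i \<in> sets borel"
  using h_pos by (auto simp: I_def algebra_simps)

lemma sum_indicator_I: "(\<Sum>j<k. indicator (I j) s) = (indicator {0<..real k * h} s :: real)"
proof (induction k)
  case (Suc k)
  have k0: "0 \<le> real k * h" using h_pos by simp
  have "{0<..real (Suc k) * h} = {0<..real k * h} \<union> I k" "{0<..real k * h} \<inter> I k = {}"
    using h_pos k0 by (auto simp: I_def distrib_right intro: order.strict_trans1[OF k0])
  then show ?case unfolding sum.lessThan_Suc Suc by (simp only: indicator_add)
qed simp

lemma sum_integral_I_le: "(\<Sum>j<k. LINT s:I j|lborel. m s) \<le> M1"
proof -
  have int: "integrable lborel (\<lambda>s. indicator (I j) s *\<^sub>R m s)" for j
    using integrable_mult_indicator[OF _ m, of "I j"] by simp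
  have "(\<Sum>j<k. LINT s:I j|lborel. m s) = (LINT s|lborel. (\<Sum>j<k. indicator (I j) s *\<^sub>R m s))"
    unfolding set_lebesgue_integral_def by (rule Bochner_Integration.integral_sum[symmetric]) (rule int)
  also have "\<dots> \<le> M1" unfolding M1_def
  proof (rule integral_mono)
    show "integrable lborel (\<lambda>s. \<Sum>j<k. indicator (I j) s *\<^sub>R m s)"
      by (rule Bochner_Integration.integrable_sum) (rule int)
    show "(\<Sum>j<k. indicator (I j) s *\<^sub>R m s) \<le> m s" for s
    proof -
      have e: "(\<Sum>j<k. indicator (I j) s *\<^sub>R m s) = indicator {0<..real k * h} s * m s"
        by (simp only: real_scaleR_def sum_distrib_right[symmetric] sum_indicator_I)
      show ?thesis unfolding e using m_nonneg[of s] by (simp add: indicator_def)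
    qed
  qed (rule m)
  finally show ?thesis .
qed

lemma c_meas1 [measurable]: "(\<lambda>s. c s x) \<in> borel_measurable borel"
  using measurable_compose[OF _ c_meas, of "\<lambda>s. (s, x)" borel] by simp

lemma A_meas1 [measurable]: "(\<lambda>s. A s x) \<in> borel_measurable borel"
  using measurable_compose[OF _ A_meas, of "\<lambda>s. (s, x)" borel] by simp

lemma c_integrable: "integrable lborel (\<lambda>s. indicator (I i) s *\<^sub>R c s x)"
proof (rule Bochner_Integration.integrable_bound[OF m])
  show "AE s in lborel. norm (indicator (I i) s *\<^sub>R c s x) \<le> norm (m s)"
    using c_le m_nonneg by (auto simp: indicator_def intro: order_trans[OF _ abs_ge_self])
qed simp

lemma indicator_integrable: "integrable lborel (\<lambda>s. indicator (I i) s * a)" for a :: real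
  using emeasure_I by (intro integrable_mult_left integrable_real_indicator) auto

lemma integral_indicator_I: "(LINT s|lborel. indicator (I i) s * a) = h * a" for a :: real
  using measure_I by simp

lemma A_integrable: "integrable lborel (\<lambda>s. indicator (I i) s *\<^sub>R A s x)"
proof (rule Bochner_Integration.integrable_bound[OF indicator_integrable[of i L]])
  show "AE s in lborel. norm (indicator (I i) s *\<^sub>R A s x) \<le> norm (indicator (I i) s * L)"
    using A_le L_nonneg by (auto simp: indicator_def)
qed simp

lemma V_deriv: "(V i has_derivative (\<lambda>v. B i x *v v)) (at x)"
proof -
  have lin: "bounded_linear (\<lambda>M :: real ^ 'n ^ 'n. M *v v)" for v :: "real ^ 'n"
    by (rule linear_conv_bounded_linear[THEN iffD1])
       (auto simp: linear_iff matrix_vector_mult_add_rdistrib scaleR_matrix_vector_assoc)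
  have "((\<lambda>x. LINT s|lborel. indicator (I i) s *\<^sub>R c s x) has_derivative
      (\<lambda>v. LINT s|lborel. indicator (I i) s *\<^sub>R (A s x *v v))) (at x)"
  proof (rule has_derivative_integral[of 1 x lborel _ _ "\<lambda>s. indicator (I i) s * L"])
    show "integrable lborel (\<lambda>s. indicator (I i) s *\<^sub>R c s y)" for y by (rule c_integrable)
    show "integrable lborel (\<lambda>s. indicator (I i) s *\<^sub>R (A s x *v v))" for v
      using integrable_bounded_linear[OF lin[of v] A_integrable[of i x]] by (simp add: scaleR_matrix_vector_assoc)
    show "AE s in lborel. ((\<lambda>x. indicator (I i) s *\<^sub>R c s x) has_derivative (\<lambda>v. indicator (I i) s *\<^sub>R (A s x *v v))) (at x)"
      by (intro AE_I2 has_derivative_scaleR_right c_deriv)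
    show "AE s in lborel. norm (indicator (I i) s *\<^sub>R c s y - indicator (I i) s *\<^sub>R c s x) \<le> indicator (I i) s * L * norm (y - x)" for y
      using lipschitz_of_matrix_derivative[OF c_deriv A_le]
      by (intro AE_I2) (simp add: scaleR_diff_right[symmetric] mult_left_mono mult.assoc)
    show "AE s in lborel. norm (indicator (I i) s *\<^sub>R (A s x *v v)) \<le> indicator (I i) s * L * norm v" for v
      using order_trans[OF norm_matrix_vector_le mult_right_mono[OF A_le norm_ge_zero]]
      by (intro AE_I2) (simp add: mult_left_mono mult.assoc)
    show "integrable lborel (\<lambda>s. indicator (I i) s * L)" by (rule indicator_integrable)
  qed simp
  moreover have "(LINT s|lborel. indicator (I i) s *\<^sub>R (A s x *v v)) = B i x *v v" for v
    using integral_bounded_linear[OF lin[of v] A_integrable[of i x]]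
    by (simp add: B_def set_lebesgue_integral_def scaleR_matrix_vector_assoc)
  ultimately show ?thesis unfolding V_def[abs_def] set_lebesgue_integral_def by simp
qed

lemma B_le: "norm (B i x) \<le> h * L"
proof -
  have "norm (B i x) \<le> (LINT s|lborel. indicator (I i) s * L)"
    unfolding B_def set_lebesgue_integral_def
    by (rule Bochner_Integration.integral_norm_bound_integral[OF A_integrable indicator_integrable])
       (auto simp: indicator_def A_le)
  then show ?thesis by (simp only: integral_indicator_I)
qed

lemma trace_B_le: "\<bar>trace (B i x)\<bar> \<le> h * D"
proof -
  have "trace (B i x) = (LINT s|lborel. trace (indicator (I i) s *\<^sub>R A s x))"
    unfolding B_def set_lebesgue_integral_def by (rule integral_bounded_linear[OF trace_bounded_linear A_integrable, symmetric])
  also have "norm \<dots> \<le> (LINT s|lborel. indicator (I i) s * D)"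
    by (rule Bochner_Integration.integral_norm_bound_integral[OF integrable_bounded_linear[OF trace_bounded_linear A_integrable] indicator_integrable])
       (use trace_le D_nonneg in \<open>auto simp: indicator_def trace_def\<close>)
  finally show ?thesis by (simp add: integral_indicator_I del: Bochner_Integration.integral_mult_left_zero)
qed

lemma V_lipschitz: "norm (V i x - V i y) \<le> h * L * norm (x - y)"
  by (rule lipschitz_of_matrix_derivative[OF V_deriv B_le])

lemma V_le: "norm (V i x) \<le> (LINT s:I i|lborel. m s)"
  unfolding V_def set_lebesgue_integral_def
  using integrable_mult_indicator[OF _ m, of "I i"] c_le
  by (intro Bochner_Integration.integral_norm_bound_integral[OF c_integrable]) (auto simp: indicator_def)

lemma Y_deriv: "(Y i has_derivative (\<lambda>v. G i x *v v)) (at x)"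
proof (induction i)
  case (Suc i)
  have "((\<lambda>x. V i (Y i x)) has_derivative (\<lambda>v. B i (Y i x) *v (G i x *v v))) (at x)"
    by (rule has_derivative_compose[OF Suc V_deriv])
  from has_derivative_add[OF Suc this] show ?case
    by (simp add: matrix_vector_mul_assoc[symmetric] matrix_vector_mult_add_rdistrib)
qed simp

lemma Y_continuous: "continuous_on UNIV (Y i)"
  using Y_deriv has_derivative_continuous continuous_on_eq_continuous_at by (metis open_UNIV)

lemma Y_measurable [measurable]: "Y i \<in> borel_measurable borel"
  by (rule borel_measurable_continuous_onI[OF Y_continuous])

lemma Y_displacement: "norm (Y i x - x) \<le> M1"
proof -
  have "norm (Y i x - x) \<le> (\<Sum>j<i. LINT s:I j|lborel. m s)"
  proof (induction i)
    case (Suc i)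
    then show ?case using V_le[of i "Y i x"] norm_triangle_ineq[of "Y i x - x" "V i (Y i x)"]
      by (simp add: algebra_simps)
  qed simp
  then show ?thesis using sum_integral_I_le[of i] by linarith
qed

lemma B_measurable [measurable]: "B i \<in> borel_measurable borel"
proof -
  have "(\<lambda>(x, s). indicator (I i) s *\<^sub>R A s x) \<in> borel_measurable (borel \<Otimes>\<^sub>M lborel)"
    using measurable_compose[OF _ A_meas, of "\<lambda>p. (snd p, fst p)" "borel \<Otimes>\<^sub>M lborel"]
    by (simp add: case_prod_beta')
  from lborel.borel_measurable_lebesgue_integral[OF this] show ?thesis
    unfolding B_def[abs_def] set_lebesgue_integral_def by simp
qed

text \<open>Each step compresses volume at most by the factor \<open>1 / (1 - u)\<close> with \<open>u = h * (D + 1)\<close>, and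
  \<open>1 / (1 - u) \<le> exp (2 * u)\<close> for \<open>u \<le> 1 / 2\<close>. Here the bound on the divergence is used.\<close>

lemma Y_push:
  assumes [measurable]: "g \<in> borel_measurable borel"
  shows "(\<integral>\<^sup>+x. g (Y i x) \<partial>lborel) \<le> ennreal (exp (2 * h * (D + 1)) ^ i) * (\<integral>\<^sup>+x. g x \<partial>lborel)"
  using assms
proof (induction i arbitrary: g)
  case (Suc i)
  note [measurable] = Suc.prems
  define u where "u = h * (D + 1)"
  have u: "0 \<le> u" "u \<le> 1 / 2"
    using small(2) less_imp_le[OF h_pos] D_nonneg unfolding u_def by (simp_all add: h_def[symmetric])
  have "continuous_on UNIV (V i)"
    using V_deriv has_derivative_continuous continuous_on_eq_continuous_at by (metis open_UNIV)
  then have [measurable]: "V i \<in> borel_measurable borel" by (rule borel_measurable_continuous_onI)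
  have "(\<integral>\<^sup>+x. g (Y (Suc i) x) \<partial>lborel) = (\<integral>\<^sup>+x. (\<lambda>y. g (y + V i y)) (Y i x) \<partial>lborel)" by simp
  also have "\<dots> \<le> ennreal (exp (2 * h * (D + 1)) ^ i) * (\<integral>\<^sup>+x. g (x + V i x) \<partial>lborel)"
    by (rule Suc.IH) measurable
  also have "(\<integral>\<^sup>+x. g (x + V i x) \<partial>lborel) \<le> ennreal (1 / (1 - u)) * (\<integral>\<^sup>+x. g x \<partial>lborel)"
  proof (rule nn_integral_near_identity[OF V_deriv V_lipschitz _ _ _ trace_B_le])
    show "h * L < 1" "h * L \<le> 1" unfolding h_def using small(1) by linarith+
    show "\<bar>B i x $ k $ j\<bar> \<le> h * L" for x k j
      using matrix_entry_le_norm[of "B i x" k j] B_le[of i x] by linarith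
    show "1 - u > 0" using u by simp
    have "det_remainder CARD('n) * (h * L)\<^sup>2 = h * (det_remainder CARD('n) * h * L\<^sup>2)"
      by (simp add: power2_eq_square)
    also have "\<dots> \<le> h * 1" using small(3) h_pos by (intro mult_left_mono) (auto simp: h_def)
    finally show "1 - u \<le> 1 - h * D - det_remainder CARD('n) * (h * L)\<^sup>2"
      by (simp add: u_def algebra_simps)
  qed fact
  also have "ennreal (1 / (1 - u)) \<le> ennreal (exp (2 * h * (D + 1)))"
  proof (rule ennreal_leI)
    have "1 * 1 \<le> (1 + 2 * u) * (1 - u)"
    proof -
      have "0 \<le> u * (1 - 2 * u)" using u by (intro mult_nonneg_nonneg) auto
      then show ?thesis by (simp add: algebra_simps)
    qed
    then have "1 / (1 - u) \<le> 1 + 2 * u" using u by (simp add: divide_le_eq)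
    also have "\<dots> \<le> exp (2 * u)" by (rule exp_ge_add_one_self)
    finally show "1 / (1 - u) \<le> exp (2 * h * (D + 1))" by (simp add: u_def mult.assoc)
  qed
  finally have "(\<integral>\<^sup>+x. g (Y (Suc i) x) \<partial>lborel) \<le> ennreal (exp (2 * h * (D + 1)) ^ i) *
     (ennreal (exp (2 * h * (D + 1))) * (\<integral>\<^sup>+x. g x \<partial>lborel))"
    by (simp add: mult_left_mono mult_right_mono)
  moreover have "ennreal (exp (2 * h * (D + 1)) ^ i) * ennreal (exp (2 * h * (D + 1)))
      = ennreal (exp (2 * h * (D + 1)) ^ Suc i)"
    by (subst ennreal_mult[symmetric]) (auto simp: mult.commute)
  ultimately show ?case by (simp only: mult.assoc[symmetric])
qed simp

text \<open>The compression after all steps does not depend on the Lipschitz constant \<open>L\<close>.\<close>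

lemma Y_push_uniform:
  assumes "g \<in> borel_measurable borel" "i \<le> N"
  shows "(\<integral>\<^sup>+x. g (Y i x) \<partial>lborel) \<le> ennreal (exp (2 * T * (D + 1))) * (\<integral>\<^sup>+x. g x \<partial>lborel)"
proof -
  have "exp (2 * h * (D + 1)) ^ i \<le> exp (2 * h * (D + 1)) ^ N"
    using assms(2) h_pos D_nonneg by (intro power_increasing) auto
  also have "\<dots> = exp (2 * T * (D + 1))"
  proof -
    have "real N * (2 * h * (D + 1)) = 2 * (real N * h) * (D + 1)" by simp
    then show ?thesis unfolding Nh by (simp only: exp_of_nat_mult[symmetric])
  qed
  finally show ?thesis
    using order_trans[OF Y_push[OF assms(1), of i] mult_right_mono[OF ennreal_leI]] by auto
qed

lemma G_vector_le: "norm (G N x *v v) \<le> W x * norm v"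
proof -
  have "norm (G k x *v v) \<le> exp (\<Sum>i<k. norm (B i (Y i x))) * norm v" for k
  proof (induction k)
    case (Suc k)
    have "norm (G (Suc k) x *v v) = norm (G k x *v v + B k (Y k x) *v (G k x *v v))"
      by (simp add: matrix_vector_mul_assoc[symmetric] matrix_vector_mult_add_rdistrib)
    also have "\<dots> \<le> (1 + norm (B k (Y k x))) * norm (G k x *v v)"
      using norm_triangle_ineq[of "G k x *v v" "B k (Y k x) *v (G k x *v v)"]
        norm_matrix_vector_le[of "B k (Y k x)" "G k x *v v"] by (simp add: distrib_right)
    also have "\<dots> \<le> exp (norm (B k (Y k x))) * (exp (\<Sum>i<k. norm (B i (Y i x))) * norm v)"
      using Suc exp_ge_add_one_self by (intro mult_mono) auto
    finally show ?case by (simp add: exp_add mult_ac)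
  qed simp
  then show ?thesis by (simp add: W_def)
qed

lemma G_entry_le: "\<bar>G N x $ i $ j\<bar> \<le> W x"
proof -
  have "G N x $ i $ j = (G N x *v axis j 1) $ i"
    by (simp add: matrix_vector_mult_basis column_def)
  then have "\<bar>G N x $ i $ j\<bar> \<le> norm (G N x *v axis j 1)"
    by (simp add: component_le_norm_cart)
  then show ?thesis using G_vector_le[of x "axis j 1"] by simp
qed

lemma W_pos: "0 < W x" by (simp add: W_def)

lemma W_bound: "W x \<le> exp (T * L)"
proof -
  have "(\<Sum>i<N. norm (B i (Y i x))) \<le> (\<Sum>i<N. h * L)" by (intro sum_mono B_le)
  also have "\<dots> = T * L" using Nh by simp
  finally show ?thesis by (simp add: W_def)
qed

lemma W_measurable [measurable]: "W \<in> borel_measurable borel"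
  unfolding W_def[abs_def] by measurable

lemma G_entry_measurable [measurable]: "(\<lambda>x. G i x $ k $ j) \<in> borel_measurable borel"
proof (induction i arbitrary: k j)
  case (Suc i)
  note [measurable] = Suc
  have [measurable]: "(\<lambda>x. B i (Y i x) $ k $ l) \<in> borel_measurable borel" for l
    using measurable_compose[OF measurable_compose[OF Y_measurable B_measurable]
        borel_measurable_continuous_onI[OF linear_continuous_on[OF
          bounded_linear_compose[OF bounded_linear_vec_nth[of l] bounded_linear_vec_nth[of k]]]]]
    by simp
  show ?case by (simp add: matrix_matrix_mult_def) measurable
qed simp

text \<open>Jensen's inequality for the average over one time step.\<close>

lemma B_exp_le:
  assumes q: "q \<ge> 0"
  shows "ennreal (exp (q * (real N * norm (B i y)))) \<le> ennreal (1 / h) * (\<integral>\<^sup>+s. ennreal (exp (q * T * norm (A s y))) * indicator (I i) s \<partial>lborel)"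
proof -
  define w where "w s = indicator (I i) s * (1 / h)" for s
  define u where "u s = q * T * norm (A s y)" for s
  have wu: "w s * u s = q * real N * norm (indicator (I i) s *\<^sub>R A s y)" for s
  proof -
    have "T / h = real N" using h_pos Nh by (simp add: field_simps)
    then have "(1 / h) * (q * T * norm (A s y)) = q * real N * norm (A s y)" by (metis (no_types, lifting) mult.assoc mult.commute times_divide_eq_left mult_1)
    then show ?thesis by (simp add: w_def u_def indicator_def)
  qed
  have "norm (B i y) \<le> (LINT s|lborel. norm (indicator (I i) s *\<^sub>R A s y))"
    unfolding B_def set_lebesgue_integral_def by (rule integral_norm_bound)
  then have "q * (real N * norm (B i y)) \<le> q * real N * (LINT s|lborel. norm (indicator (I i) s *\<^sub>R A s y))"
    using q by (simp add: mult.assoc mult_left_mono)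
  also have "\<dots> = (LINT s|lborel. w s * u s)" unfolding wu by simp
  finally have "ennreal (exp (q * (real N * norm (B i y)))) \<le> ennreal (exp (LINT s|lborel. w s * u s))"
    by (simp add: ennreal_leI)
  also have "\<dots> \<le> (\<integral>\<^sup>+s. ennreal (w s) * ennreal (exp (u s)) \<partial>lborel)"
  proof (rule exp_weighted_integral_le)
    show "integrable lborel w" unfolding w_def by (rule indicator_integrable)
    show "integral\<^sup>L lborel w = 1" unfolding w_def integral_indicator_I using h_pos by simp
    show "integrable lborel (\<lambda>s. w s * u s)" unfolding wu using A_integrable by (intro integrable_mult_right integrable_norm)
  qed (use h_pos in \<open>auto simp: w_def u_def\<close>)
  also have "\<dots> = (\<integral>\<^sup>+s. ennreal (1 / h) * (ennreal (exp (q * T * norm (A s y))) * indicator (I i) s) \<partial>lborel)"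
    by (intro nn_integral_cong) (auto simp: w_def u_def indicator_def)
  also have "\<dots> = ennreal (1 / h) * (\<integral>\<^sup>+s. ennreal (exp (q * T * norm (A s y))) * indicator (I i) s \<partial>lborel)"
    by (intro nn_integral_cmult) measurable
  finally show ?thesis .
qed

text \<open>This is the Sobolev estimate: \<open>W powr q\<close> is the exponential of a sum along the polygonal
  trajectory, which Jensen's inequality turns into a mean, over time steps, of exponentials of
  \<open>q * T * norm A\<close> at \<open>Y i x\<close>. The maps \<open>Y i\<close> have bounded compression and move points by at most
  \<open>M1\<close>, so each term is controlled by an integral over a fixed larger ball.\<close>

lemma W_powr_integral:
  assumes q: "q \<ge> 0"
    and C: "\<And>s. (\<integral>\<^sup>+y\<in>cball 0 (R + M1). ennreal (exp (q * T * norm (A s y))) \<partial>lborel) \<le> C"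
  shows "(\<integral>\<^sup>+x\<in>cball 0 R. ennreal (W x powr q) \<partial>lborel) \<le> ennreal (exp (2 * T * (D + 1))) * C"
proof -
  let ?S = "cball (0 :: real ^ 'n) (R + M1)"
  have [measurable]: "?S \<in> sets borel" "cball (0 :: real ^ 'n) R \<in> sets borel" by simp_all
  have [measurable]: "(\<lambda>p. A (fst p) (snd p)) \<in> borel_measurable (borel \<Otimes>\<^sub>M borel)"
    using A_meas by (simp add: case_prod_beta')
  have [measurable]: "(\<lambda>p. A (snd p) (fst p)) \<in> borel_measurable (borel \<Otimes>\<^sub>M borel)"
    using measurable_compose[OF _ A_meas, of "\<lambda>p. (snd p, fst p)" "borel \<Otimes>\<^sub>M borel"] by simp
  have step: "(\<integral>\<^sup>+x\<in>cball 0 R. ennreal (exp (q * (real N * norm (B i (Y i x))))) \<partial>lborel) \<le> ennreal (exp (2 * T * (D + 1))) * C"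
    if i: "i < N" for i
  proof -
    define g where "g y = ennreal (exp (q * (real N * norm (B i y)))) * indicator ?S y" for y
    have [measurable]: "g \<in> borel_measurable borel" unfolding g_def by measurable
    have "(\<integral>\<^sup>+x\<in>cball 0 R. ennreal (exp (q * (real N * norm (B i (Y i x))))) \<partial>lborel) \<le> (\<integral>\<^sup>+x. g (Y i x) \<partial>lborel)"
    proof (rule nn_integral_mono)
      fix x
      show "ennreal (exp (q * (real N * norm (B i (Y i x))))) * indicator (cball 0 R) x \<le> g (Y i x)"
      proof (cases "x \<in> cball 0 R")
        case True
        then have "norm (Y i x) \<le> R + M1"
          using Y_displacement[of i x] norm_triangle_ineq[of "Y i x - x" x] by simp
        then show ?thesis using True by (simp add: g_def)
      qed simp
    qed
    also have "\<dots> \<le> ennreal (exp (2 * T * (D + 1))) * (\<integral>\<^sup>+y. g y \<partial>lborel)"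
      using i by (intro Y_push_uniform) auto
    also have "(\<integral>\<^sup>+y. g y \<partial>lborel) \<le> (\<integral>\<^sup>+y. ennreal (1 / h) * (\<integral>\<^sup>+s. ennreal (exp (q * T * norm (A s y))) * indicator (I i) s * indicator ?S y \<partial>lborel) \<partial>lborel)"
    proof (rule nn_integral_mono)
      fix y
      have [measurable]: "(\<lambda>s. A s y) \<in> borel_measurable borel" by (rule A_meas1)
      have "(\<integral>\<^sup>+s. ennreal (exp (q * T * norm (A s y))) * indicator (I i) s * indicator ?S y \<partial>lborel)
        = (\<integral>\<^sup>+s. ennreal (exp (q * T * norm (A s y))) * indicator (I i) s \<partial>lborel) * indicator ?S y"
        by (rule nn_integral_multc) measurable
      then show "g y \<le> ennreal (1 / h) * (\<integral>\<^sup>+s. ennreal (exp (q * T * norm (A s y))) * indicator (I i) s * indicator ?S y \<partial>lborel)"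
        using mult_right_mono[OF B_exp_le[OF q, of i y], of "indicator ?S y"]
        unfolding g_def by (simp only: mult.assoc zero_le)
    qed
    also have "\<dots> = ennreal (1 / h) * (\<integral>\<^sup>+y. (\<integral>\<^sup>+s. ennreal (exp (q * T * norm (A s y))) * indicator (I i) s * indicator ?S y \<partial>lborel) \<partial>lborel)"
      by (intro nn_integral_cmult) measurable
    also have "(\<integral>\<^sup>+y. (\<integral>\<^sup>+s. ennreal (exp (q * T * norm (A s y))) * indicator (I i) s * indicator ?S y \<partial>lborel) \<partial>lborel)
       = (\<integral>\<^sup>+s. (\<integral>\<^sup>+y. ennreal (exp (q * T * norm (A s y))) * indicator (I i) s * indicator ?S y \<partial>lborel) \<partial>lborel)"
      by (rule lborel_pair.Fubini') measurable
    also have "\<dots> = (\<integral>\<^sup>+s. indicator (I i) s * (\<integral>\<^sup>+y\<in>?S. ennreal (exp (q * T * norm (A s y))) \<partial>lborel) \<partial>lborel)"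
    proof (rule nn_integral_cong)
      fix s
      have [measurable]: "A s \<in> borel_measurable borel"
        using measurable_compose[OF _ A_meas, of "\<lambda>x. (s, x)" borel] by simp
      show "(\<integral>\<^sup>+y. ennreal (exp (q * T * norm (A s y))) * indicator (I i) s * indicator ?S y \<partial>lborel)
        = indicator (I i) s * (\<integral>\<^sup>+y\<in>?S. ennreal (exp (q * T * norm (A s y))) \<partial>lborel)"
        by (subst nn_integral_cmult[symmetric]) (auto simp: mult_ac)
    qed
    also have "\<dots> \<le> (\<integral>\<^sup>+s. indicator (I i) s * C \<partial>lborel)"
      by (intro nn_integral_mono mult_left_mono C) auto
    also have "\<dots> = ennreal h * C" by (simp add: nn_integral_multc emeasure_I)
    also have "ennreal (1 / h) * (ennreal h * C) = C"
      using h_pos by (simp add: mult.assoc[symmetric] ennreal_mult[symmetric])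
    finally show ?thesis by (simp add: mult_left_mono)
  qed
  have "(\<integral>\<^sup>+x\<in>cball 0 R. ennreal (W x powr q) \<partial>lborel)
    \<le> (\<integral>\<^sup>+x. (\<Sum>i<N. ennreal (1 / real N) * (ennreal (exp (q * (real N * norm (B i (Y i x))))) * indicator (cball 0 R) x)) \<partial>lborel)"
  proof (rule nn_integral_mono)
    fix x
    have "W x powr q = exp (\<Sum>i<N. q * norm (B i (Y i x)))"
      by (simp add: W_def powr_def sum_distrib_left)
    also have "\<dots> \<le> (\<Sum>i<N. exp (real N * (q * norm (B i (Y i x))))) / real N"
      by (rule exp_mean_le[OF N])
    also have "\<dots> = (\<Sum>i<N. (1 / real N) * exp (q * (real N * norm (B i (Y i x)))))"
      by (simp add: sum_divide_distrib mult_ac)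
    finally have "ennreal (W x powr q) \<le> (\<Sum>i<N. ennreal (1 / real N) * ennreal (exp (q * (real N * norm (B i (Y i x))))))"
      by (simp add: ennreal_mult[symmetric] sum_ennreal ennreal_leI)
    from mult_right_mono[OF this, of "indicator (cball 0 R) x"]
    show "ennreal (W x powr q) * indicator (cball 0 R) x \<le> (\<Sum>i<N. ennreal (1 / real N) * (ennreal (exp (q * (real N * norm (B i (Y i x))))) * indicator (cball 0 R) x))"
      by (simp add: sum_distrib_right mult.assoc)
  qed
  also have "\<dots> = (\<Sum>i<N. \<integral>\<^sup>+x. ennreal (1 / real N) * (ennreal (exp (q * (real N * norm (B i (Y i x))))) * indicator (cball 0 R) x) \<partial>lborel)"
    by (intro nn_integral_sum) measurable
  also have "\<dots> = (\<Sum>i<N. ennreal (1 / real N) * (\<integral>\<^sup>+x\<in>cball 0 R. ennreal (exp (q * (real N * norm (B i (Y i x))))) \<partial>lborel))"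
    by (intro sum.cong refl nn_integral_cmult) measurable
  also have "\<dots> \<le> (\<Sum>i<N. ennreal (1 / real N) * (ennreal (exp (2 * T * (D + 1))) * C))"
    by (intro sum_mono mult_left_mono step) auto
  also have "\<dots> = (of_nat N * ennreal (1 / real N)) * (ennreal (exp (2 * T * (D + 1))) * C)"
    by (simp add: mult.assoc)
  also have "of_nat N * ennreal (1 / real N) = 1"
    using N by (simp add: ennreal_of_nat_eq_real_of_nat ennreal_mult[symmetric])
  finally show ?thesis by simp
qed

text \<open>Between the grid times the trajectory moves by the integral of \<open>m\<close> over the step, so the error
  satisfies \<open>e (Suc i) \<le> (1 + h * L) * e i + h * (\<eta> + L * \<mu> i)\<close>; only the sum of the \<open>\<mu> i\<close> matters in
  the end. The discrete Gronwall inequality follows by induction. The trajectory belongs to another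
  field \<open>b\<close>, which is \<open>\<eta>\<close>-close to \<open>c\<close> along it.\<close>

lemma euler_error:
  assumes \<gamma>: "trajectory T b \<gamma>"
    and \<eta>: "AE s in lebesgue. s \<in> {0..T} \<longrightarrow> norm (b s (\<gamma> s) - c s (\<gamma> s)) \<le> \<eta>"
    and bm: "AE s in lebesgue. s \<in> {0..T} \<longrightarrow> norm (b s (\<gamma> s)) \<le> m s"
  shows "norm (\<gamma> T - Y N (\<gamma> 0)) \<le> exp (T * L) * (T * \<eta> + h * L * M1)"
proof -
  define t where "t i = real i * h" for i :: nat
  define f where "f = (\<lambda>s. b s (\<gamma> s))"
  define \<mu> where "\<mu> i = (LINT s:I i|lborel. m s)" for i
  define e where "e i = norm (\<gamma> (t i) - Y i (\<gamma> 0))" for i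
  have tin: "t i \<in> {0..T}" if "i \<le> N" for i
    using that h_pos Nh mult_right_mono[of "real i" "real N" h] by (auto simp: t_def)
  have fint: "set_integrable lebesgue {0..T} f" using \<gamma> by (simp add: trajectory_def f_def)
  have fint': "set_integrable lebesgue S f" if "S \<subseteq> {0..T}" "S \<in> sets borel" for S
    using fint that(2) by (intro set_integrable_subset[OF fint _ that(1)]) simp
  have diff: "\<gamma> r - \<gamma> r' = (LINT s:{r'<..r}|lebesgue. f s)" if "0 \<le> r'" "r' \<le> r" "r \<le> T" for r r'
  proof -
    have un: "{0..r} = {0..r'} \<union> {r'<..r}" using that by auto
    have s1: "{0..r'} \<subseteq> {0..T}" and s2: "{r'<..r} \<subseteq> {0..T}" and dis: "{0..r'} \<inter> {r'<..r} = {}"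
      using that by auto
    have i1: "set_integrable lebesgue {0..r'} f" by (rule fint'[OF s1]) simp
    have i2: "set_integrable lebesgue {r'<..r} f" by (rule fint'[OF s2]) simp
    have "(LINT s:{0..r}|lebesgue. f s) = (LINT s:{0..r'}|lebesgue. f s) + (LINT s:{r'<..r}|lebesgue. f s)"
      unfolding un by (rule set_integral_Un[OF dis i1 i2])
    moreover have "\<gamma> r = \<gamma> 0 + (LINT s:{0..r}|lebesgue. f s)" "\<gamma> r' = \<gamma> 0 + (LINT s:{0..r'}|lebesgue. f s)"
      unfolding f_def using that
      by (intro conjunct2[OF \<gamma>[unfolded trajectory_def], THEN bspec]; simp)+
    ultimately show ?thesis by simp
  qed
  have mI: "integrable lborel (\<lambda>s. indicator (I i) s *\<^sub>R m s)" for i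
    using integrable_mult_indicator[OF _ m, of "I i"] by simp
  have mIL: "integrable lebesgue (\<lambda>s. indicator (I i) s *\<^sub>R m s)" "(LINT s|lebesgue. indicator (I i) s *\<^sub>R m s) = \<mu> i" for i
    using mI[of i] integrable_completion[of "\<lambda>s. indicator (I i) s *\<^sub>R m s" lborel]
      integral_completion[of "\<lambda>s. indicator (I i) s *\<^sub>R m s" lborel]
    by (auto simp: \<mu>_def set_lebesgue_integral_def)
  have \<mu>0: "0 \<le> \<mu> i" for i
    unfolding \<mu>_def set_lebesgue_integral_def using m_nonneg by (intro Bochner_Integration.integral_nonneg) auto
  have Isub: "I i \<subseteq> {0..T}" if "i < N" for i
    using tin[of i] tin[of "Suc i"] that by (auto simp: I_def t_def)
  have osc: "norm (\<gamma> s - \<gamma> (t i)) \<le> \<mu> i" if i: "i < N" and s: "s \<in> I i" for i s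
  proof -
    have st: "t i < s" "s \<le> t (Suc i)" using s by (auto simp: I_def t_def)
    have sub: "{t i<..s} \<subseteq> I i" using st by (auto simp: I_def t_def)
    have "norm (\<gamma> s - \<gamma> (t i)) = norm (LINT s:{t i<..s}|lebesgue. f s)"
      using diff[of "t i" s] tin[of i] tin[of "Suc i"] st i by auto
    also have "\<dots> \<le> (LINT s|lebesgue. indicator (I i) s *\<^sub>R m s)"
      unfolding set_lebesgue_integral_def
    proof (rule integral_norm_bound_integral_AE')
      show "integrable lebesgue (\<lambda>r. indicator {t i<..s} r *\<^sub>R f r)"
        using fint'[of "{t i<..s}"] sub Isub[OF i] unfolding set_integrable_def by auto
      show "AE r in lebesgue. norm (indicator {t i<..s} r *\<^sub>R f r) \<le> indicator (I i) r *\<^sub>R m r"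
        using bm
      proof eventually_elim
        case (elim r)
        then show ?case using sub Isub[OF i] m_nonneg[of r] by (auto simp: indicator_def f_def)
      qed
    qed (rule mIL)
    finally show ?thesis unfolding mIL .
  qed
  have step: "e (Suc i) \<le> (1 + h * L) * e i + h * (\<eta> + L * \<mu> i)" if i: "i < N" for i
  proof -
    let ?y = "Y i (\<gamma> 0)"
    have cL: "integrable lebesgue (\<lambda>s. indicator (I i) s *\<^sub>R c s ?y)" "(LINT s|lebesgue. indicator (I i) s *\<^sub>R c s ?y) = V i ?y"
      using c_integrable[of i ?y] integrable_completion[of "\<lambda>s. indicator (I i) s *\<^sub>R c s ?y" lborel]
        integral_completion[of "\<lambda>s. indicator (I i) s *\<^sub>R c s ?y" lborel]
      by (auto simp: V_def set_lebesgue_integral_def)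
    have fI: "integrable lebesgue (\<lambda>s. indicator (I i) s *\<^sub>R f s)"
      using fint'[OF Isub[OF i]] unfolding set_integrable_def by simp
    have "\<gamma> (t (Suc i)) - \<gamma> (t i) = (LINT s|lebesgue. indicator (I i) s *\<^sub>R f s)"
    proof -
      have "t i \<in> {0..T}" "t (Suc i) \<in> {0..T}" "t i \<le> t (Suc i)"
        using tin[of i] tin[of "Suc i"] i h_pos by (auto simp: t_def distrib_right)
      then show ?thesis using diff[of "t i" "t (Suc i)"]
        by (simp add: I_def t_def set_lebesgue_integral_def)
    qed
    then have "\<gamma> (t (Suc i)) - Y (Suc i) (\<gamma> 0) = (\<gamma> (t i) - ?y) + (LINT s|lebesgue. indicator (I i) s *\<^sub>R f s - indicator (I i) s *\<^sub>R c s ?y)"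
      unfolding Bochner_Integration.integral_diff[OF fI cL(1)] cL(2) Y.simps by (simp only: algebra_simps)
    then have "e (Suc i) \<le> e i + norm (LINT s|lebesgue. indicator (I i) s *\<^sub>R f s - indicator (I i) s *\<^sub>R c s ?y)"
      by (simp only: e_def norm_triangle_ineq)
    also have "norm (LINT s|lebesgue. indicator (I i) s *\<^sub>R f s - indicator (I i) s *\<^sub>R c s ?y)
      \<le> (LINT s|lebesgue. indicator (I i) s * (\<eta> + L * (e i + \<mu> i)))"
    proof (rule integral_norm_bound_integral_AE')
      show "integrable lebesgue (\<lambda>s. indicator (I i) s *\<^sub>R f s - indicator (I i) s *\<^sub>R c s ?y)" using fI cL by simp
      show "integrable lebesgue (\<lambda>s. indicator (I i) s * (\<eta> + L * (e i + \<mu> i)))"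
        using indicator_integrable integrable_completion[of "\<lambda>s. indicator (I i) s * (\<eta> + L * (e i + \<mu> i))" lborel] by auto
      show "AE s in lebesgue. norm (indicator (I i) s *\<^sub>R f s - indicator (I i) s *\<^sub>R c s ?y) \<le> indicator (I i) s * (\<eta> + L * (e i + \<mu> i))"
        using \<eta>
      proof eventually_elim
        case (elim s)
        show ?case
        proof (cases "s \<in> I i")
          case True
          have "norm (c s (\<gamma> s) - c s ?y) \<le> L * norm (\<gamma> s - ?y)"
            by (rule lipschitz_of_matrix_derivative[OF c_deriv A_le])
          also have "\<dots> \<le> L * (e i + \<mu> i)"
            using osc[OF i True] norm_triangle_ineq[of "\<gamma> s - \<gamma> (t i)" "\<gamma> (t i) - ?y"] L_nonneg
            by (intro mult_left_mono) (auto simp: e_def)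
          finally have "norm (f s - c s ?y) \<le> \<eta> + L * (e i + \<mu> i)"
            using elim Isub[OF i] True norm_triangle_ineq[of "f s - c s (\<gamma> s)" "c s (\<gamma> s) - c s ?y"]
            by (auto simp: f_def)
          then show ?thesis using True by simp
        qed simp
      qed
    qed
    also have "(LINT s|lebesgue. indicator (I i) s * (\<eta> + L * (e i + \<mu> i))) = h * (\<eta> + L * (e i + \<mu> i))"
      using integral_completion[of "\<lambda>s. indicator (I i) s * (\<eta> + L * (e i + \<mu> i))" lborel]
        integral_indicator_I[of i "\<eta> + L * (e i + \<mu> i)"] by simp
    finally show ?thesis by (simp add: algebra_simps)
  qed
  have \<eta>0: "0 \<le> \<eta>"
  proof (rule ccontr)
    assume "\<not> 0 \<le> \<eta>"
    then have "AE s in lebesgue. s \<notin> {0..T}"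
      using \<eta> by (auto elim!: eventually_mono dest: order_trans[OF norm_ge_zero])
    then have "AE s in lborel. s \<notin> {0..T}" by (simp add: AE_completion_iff)
    then have "emeasure lborel {0..T} = 0" by (subst (asm) AE_iff_measurable[of "{0..T}"]) auto
    then show False using T by simp
  qed
  have g1: "1 \<le> 1 + h * L" using h_pos L_nonneg by simp
  have acc: "e i \<le> (1 + h * L) ^ i * (\<Sum>j<i. h * (\<eta> + L * \<mu> j))" if "i \<le> N" for i
    using that
  proof (induction i)
    case 0
    then show ?case by (simp add: e_def t_def)
  next
    case (Suc i)
    have "e (Suc i) \<le> (1 + h * L) * e i + h * (\<eta> + L * \<mu> i)" using step Suc.prems by simp
    also have "\<dots> \<le> (1 + h * L) * ((1 + h * L) ^ i * (\<Sum>j<i. h * (\<eta> + L * \<mu> j))) + (1 + h * L) ^ Suc i * (h * (\<eta> + L * \<mu> i))"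
    proof (rule add_mono)
      show "(1 + h * L) * e i \<le> (1 + h * L) * ((1 + h * L) ^ i * (\<Sum>j<i. h * (\<eta> + L * \<mu> j)))"
        using Suc g1 by (intro mult_left_mono) auto
      have "1 \<le> (1 + h * L) ^ Suc i" using g1 by (rule one_le_power)
      moreover have "0 \<le> h * (\<eta> + L * \<mu> i)" using h_pos \<eta>0 L_nonneg \<mu>0 by simp
      ultimately show "h * (\<eta> + L * \<mu> i) \<le> (1 + h * L) ^ Suc i * (h * (\<eta> + L * \<mu> i))"
        using mult_right_mono by fastforce
    qed
    also have "\<dots> = (1 + h * L) ^ Suc i * (\<Sum>j<Suc i. h * (\<eta> + L * \<mu> j))" by (simp add: distrib_left mult.assoc)
    finally show ?case .
  qed
  have "norm (\<gamma> T - Y N (\<gamma> 0)) = e N" by (simp add: e_def t_def Nh)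
  also have "\<dots> \<le> (1 + h * L) ^ N * (\<Sum>j<N. h * (\<eta> + L * \<mu> j))" by (rule acc) simp
  also have "\<dots> \<le> exp (T * L) * (T * \<eta> + h * L * M1)"
  proof (rule mult_mono)
    have "(1 + h * L) ^ N \<le> exp (h * L) ^ N" using g1 exp_ge_add_one_self by (intro power_mono) auto
    also have "\<dots> = exp (T * L)"
      using Nh by (simp only: exp_of_nat_mult[symmetric] mult.assoc[symmetric])
    finally show "(1 + h * L) ^ N \<le> exp (T * L)" .
    have "(\<Sum>j<N. h * (\<eta> + L * \<mu> j)) = real N * h * \<eta> + h * L * (\<Sum>j<N. \<mu> j)"
      by (simp add: distrib_left sum.distrib sum_distrib_left mult.assoc)
    also have "\<dots> \<le> T * \<eta> + h * L * M1"
      using sum_integral_I_le[of N] h_pos L_nonneg by (simp add: Nh \<mu>_def mult_left_mono)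
    finally show "(\<Sum>j<N. h * (\<eta> + L * \<mu> j)) \<le> T * \<eta> + h * L * M1" .
    show "0 \<le> (\<Sum>j<N. h * (\<eta> + L * \<mu> j))"
      using h_pos \<eta>0 L_nonneg \<mu>0 by (intro sum_nonneg) simp
  qed simp
  finally show ?thesis .
qed

text \<open>A summary without reference to the scheme, in the form in which it is used for a sequence of
  schemes: a map, its derivative and a bound for the derivative.\<close>

lemma approximation:
  obtains \<Psi> :: "real ^ 'n \<Rightarrow> real ^ 'n" and J :: "real ^ 'n \<Rightarrow> real ^ 'n ^ 'n" and w :: "real ^ 'n \<Rightarrow> real" where
    "\<And>x. (\<Psi> has_derivative (\<lambda>v. J x *v v)) (at x)"
    "\<And>i j. (\<lambda>x. J x $ i $ j) \<in> borel_measurable borel"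
    "\<And>x i j. \<bar>J x $ i $ j\<bar> \<le> w x"
    "\<And>x. 0 < w x"
    "\<And>x. w x \<le> exp (T * L)"
    "w \<in> borel_measurable borel"
    "\<And>R q C. q \<ge> 0 \<Longrightarrow>
       (\<And>s. (\<integral>\<^sup>+y\<in>cball 0 (R + (LINT s|lborel. m s)). ennreal (exp (q * T * norm (A s y))) \<partial>lborel) \<le> C) \<Longrightarrow>
       (\<integral>\<^sup>+x\<in>cball 0 R. ennreal (w x powr q) \<partial>lborel) \<le> ennreal (exp (2 * T * (D + 1))) * C"
    "\<And>b \<gamma> \<eta>. trajectory T b \<gamma> \<Longrightarrow>
       AE s in lebesgue. s \<in> {0..T} \<longrightarrow> norm (b s (\<gamma> s) - c s (\<gamma> s)) \<le> \<eta> \<Longrightarrow>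
       AE s in lebesgue. s \<in> {0..T} \<longrightarrow> norm (b s (\<gamma> s)) \<le> m s \<Longrightarrow>
       norm (\<gamma> T - \<Psi> (\<gamma> 0)) \<le> exp (T * L) * (T * \<eta> + T / N * L * (LINT s|lborel. m s))"
proof (rule that[of "Y N" "G N" W])
  show "(\<integral>\<^sup>+x\<in>cball 0 R. ennreal (W x powr q) \<partial>lborel) \<le> ennreal (exp (2 * T * (D + 1))) * C"
    if "q \<ge> 0" "\<And>s. (\<integral>\<^sup>+y\<in>cball 0 (R + (LINT s|lborel. m s)). ennreal (exp (q * T * norm (A s y))) \<partial>lborel) \<le> C"
    for R q C
    using that by (intro W_powr_integral) (auto simp: M1_def)
  show "norm (\<gamma> T - Y N (\<gamma> 0)) \<le> exp (T * L) * (T * \<eta> + T / N * L * (LINT s|lborel. m s))"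
    if "trajectory T b \<gamma>" "AE s in lebesgue. s \<in> {0..T} \<longrightarrow> norm (b s (\<gamma> s) - c s (\<gamma> s)) \<le> \<eta>"
      "AE s in lebesgue. s \<in> {0..T} \<longrightarrow> norm (b s (\<gamma> s)) \<le> m s" for b \<gamma> \<eta>
    using euler_error[OF that] by (simp add: M1_def h_def)
qed (rule Y_deriv G_entry_measurable G_entry_le W_pos W_bound W_measurable)+

end

section \<open>Strongly convergent convex combinations\<close>

text \<open>Elements of the convex hull of the \<open>n\<close>-th tail of a sequence are represented by their
  weights, so that one and the same combination can be applied to maps and to their derivatives.\<close>

definition tail_weights :: "nat \<Rightarrow> (nat \<Rightarrow> real) set" where
  "tail_weights n = {c. finite {k. c k \<noteq> 0} \<and> (\<forall>k. 0 \<le> c k) \<and> (\<forall>k<n. c k = 0) \<and> (\<Sum>k | c k \<noteq> 0. c k) = 1}"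

definition combination :: "(nat \<Rightarrow> real) \<Rightarrow> (nat \<Rightarrow> 'a \<Rightarrow> 'b::real_vector) \<Rightarrow> 'a \<Rightarrow> 'b" where
  "combination c f x = (\<Sum>k | c k \<noteq> 0. c k *\<^sub>R f k x)"

lemma tail_weights_mono: "m \<le> n \<Longrightarrow> tail_weights n \<subseteq> tail_weights m"
  by (auto simp: tail_weights_def)

lemma combination_superset:
  assumes "finite F" "{k. c k \<noteq> 0} \<subseteq> F"
  shows "combination c f x = (\<Sum>k\<in>F. c k *\<^sub>R f k x)"
  unfolding combination_def using assms by (intro sum.mono_neutral_left) auto

lemma tail_weights_sum_superset:
  assumes "c \<in> tail_weights n" "finite F" "{k. c k \<noteq> 0} \<subseteq> F"
  shows "(\<Sum>k\<in>F. c k) = 1"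
proof -
  have "(\<Sum>k | c k \<noteq> 0. c k) = (\<Sum>k\<in>F. c k)" using assms by (intro sum.mono_neutral_left) auto
  then show ?thesis using assms(1) by (simp add: tail_weights_def)
qed

lemma tail_weights_midpoint:
  assumes c: "c \<in> tail_weights n" "c' \<in> tail_weights n"
  defines "d \<equiv> \<lambda>k. (c k + c' k) / 2"
  shows "d \<in> tail_weights n" "combination d f x = (1 / 2) *\<^sub>R (combination c f x + combination c' f x)"
proof -
  let ?F = "{k. c k \<noteq> 0} \<union> {k. c' k \<noteq> 0}"
  have F: "finite ?F" using c by (auto simp: tail_weights_def)
  have dF: "{k. d k \<noteq> 0} \<subseteq> ?F" by (auto simp: d_def)
  have "(\<Sum>k | d k \<noteq> 0. d k) = (\<Sum>k\<in>?F. d k)" using F dF by (intro sum.mono_neutral_left) auto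
  also have "\<dots> = ((\<Sum>k\<in>?F. c k) + (\<Sum>k\<in>?F. c' k)) / 2"
    by (simp add: d_def sum_divide_distrib[symmetric] sum.distrib)
  also have "\<dots> = 1" using tail_weights_sum_superset[OF c(1) F] tail_weights_sum_superset[OF c(2) F] by simp
  finally show "d \<in> tail_weights n"
    using c finite_subset[OF dF F] by (auto simp: tail_weights_def d_def)
  have "combination d f x = (\<Sum>k\<in>?F. d k *\<^sub>R f k x)" by (rule combination_superset[OF F dF])
  also have "\<dots> = (\<Sum>k\<in>?F. (1 / 2) *\<^sub>R (c k *\<^sub>R f k x + c' k *\<^sub>R f k x))"
    by (intro sum.cong refl) (simp add: d_def scaleR_add_left[symmetric])
  also have "\<dots> = (1 / 2) *\<^sub>R ((\<Sum>k\<in>?F. c k *\<^sub>R f k x) + (\<Sum>k\<in>?F. c' k *\<^sub>R f k x))"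
    by (simp add: scaleR_sum_right[symmetric] sum.distrib[symmetric])
  finally show "combination d f x = (1 / 2) *\<^sub>R (combination c f x + combination c' f x)"
    using combination_superset[OF F, of c f x] combination_superset[OF F, of c' f x] by auto
qed

lemma tail_weights_single: "(\<lambda>k. if k = n then 1 else 0) \<in> tail_weights n"
  by (simp add: tail_weights_def)

lemma combination_single: "combination (\<lambda>k. if k = n then 1 else 0) f x = f n x"
  by (simp add: combination_def)

lemma combination_dist_le:
  fixes f :: "nat \<Rightarrow> 'a \<Rightarrow> 'b::real_normed_vector"
  assumes c: "c \<in> tail_weights n" and e: "\<And>k. k \<ge> n \<Longrightarrow> norm (f k x - y) \<le> e"
  shows "norm (combination c f x - y) \<le> e"
proof -
  have c': "(\<Sum>k | c k \<noteq> 0. c k) = 1" "\<And>k. 0 \<le> c k" "\<And>k. c k \<noteq> 0 \<Longrightarrow> k \<ge> n"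
    using c by (auto simp: tail_weights_def not_less[symmetric])
  have "combination c f x - y = (\<Sum>k | c k \<noteq> 0. c k *\<^sub>R f k x) - (\<Sum>k | c k \<noteq> 0. c k) *\<^sub>R y"
    using c' by (simp add: combination_def)
  also have "\<dots> = (\<Sum>k | c k \<noteq> 0. c k *\<^sub>R (f k x - y))"
    by (simp add: scaleR_diff_right sum_subtractf scaleR_sum_left)
  also have "norm \<dots> \<le> (\<Sum>k | c k \<noteq> 0. c k * e)"
    using c' e by (intro sum_norm_le) (auto intro!: mult_left_mono)
  also have "\<dots> = e" using c' by (simp add: sum_distrib_right[symmetric])
  finally show ?thesis .
qed

lemma tendsto_0_if_eventually_le:
  fixes a :: "nat \<Rightarrow> ennreal"
  assumes "\<And>e. e > 0 \<Longrightarrow> \<forall>\<^sub>F n in sequentially. a n \<le> ennreal e"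
  shows "a \<longlonglongrightarrow> 0"
proof (rule order_tendstoI)
  fix y :: ennreal assume "0 < y"
  then obtain z where z: "0 < z" "z < y" using dense by blast
  then obtain e where e: "z = ennreal e" "e > 0" by (cases z) auto
  show "\<forall>\<^sub>F n in sequentially. a n < y"
    using assms[OF e(2)] by eventually_elim (use z e in auto)
qed simp

text \<open>A bounded sequence in \<open>L2\<close> has strongly convergent convex combinations of its tails, which
  replaces weak compactness. Let \<open>d n\<close> be the infimum of the squared norm over the hull of the
  \<open>n\<close>-th tail. The sequence \<open>d\<close> is increasing and bounded, and midpoints of near minimisers stay in the hull, so the
  parallelogram identity makes near minimisers a Cauchy sequence.\<close>

lemma Mazur_L2:
  fixes f :: "nat \<Rightarrow> 'a \<Rightarrow> 'b::euclidean_space"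
  assumes fin: "emeasure M (space M) \<noteq> \<infinity>"
    and [measurable]: "\<And>k. f k \<in> borel_measurable M"
    and sq: "\<And>k. integrable M (\<lambda>x. (norm (f k x))\<^sup>2)"
    and bound: "\<And>k. (LINT x|M. (norm (f k x))\<^sup>2) \<le> K"
  obtains c g where "\<And>n. c n \<in> tail_weights n" "g \<in> borel_measurable M"
    "AE x in M. (\<lambda>n. combination (c n) f x) \<longlonglongrightarrow> g x"
    "(\<lambda>n. \<integral>\<^sup>+x. ennreal (norm (combination (c n) f x - g x)) \<partial>M) \<longlonglongrightarrow> 0"
proof -
  interpret finite_measure M by (rule finite_measureI) (rule fin)
  define Q where "Q c = (LINT x|M. (norm (combination c f x))\<^sup>2)" for c
  have [measurable]: "combination c f \<in> borel_measurable M" for c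
    unfolding combination_def[abs_def] by measurable
  have sqc: "integrable M (\<lambda>x. (norm (combination c f x))\<^sup>2)" for c
  proof (rule Bochner_Integration.integrable_bound)
    let ?S = "{k. c k \<noteq> 0}"
    show "integrable M (\<lambda>x. real (card ?S) * (\<Sum>k\<in>?S. (c k)\<^sup>2 * (norm (f k x))\<^sup>2))"
      using sq by (intro integrable_mult_right Bochner_Integration.integrable_sum)
    show "AE x in M. norm ((norm (combination c f x))\<^sup>2) \<le> norm (real (card ?S) * (\<Sum>k\<in>?S. (c k)\<^sup>2 * (norm (f k x))\<^sup>2))"
    proof (rule AE_I2)
      fix x
      have "norm (combination c f x) \<le> (\<Sum>k\<in>?S. \<bar>c k\<bar> * norm (f k x))"
        unfolding combination_def by (rule sum_norm_le) simp
      then have "(norm (combination c f x))\<^sup>2 \<le> (\<Sum>k\<in>?S. \<bar>c k\<bar> * norm (f k x))\<^sup>2" by (intro power_mono) auto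
      also have "\<dots> \<le> real (card ?S) * (\<Sum>k\<in>?S. (\<bar>c k\<bar> * norm (f k x))\<^sup>2)"
        using sum_squared_le_sum_of_squares[of "\<lambda>k. \<bar>c k\<bar> * norm (f k x)" ?S] by (simp add: mult.commute)
      finally show "norm ((norm (combination c f x))\<^sup>2) \<le> norm (real (card ?S) * (\<Sum>k\<in>?S. (c k)\<^sup>2 * (norm (f k x))\<^sup>2))"
        by (simp add: power_mult_distrib abs_of_nonneg sum_nonneg)
    qed
  qed measurable
  have Q0: "0 \<le> Q c" for c unfolding Q_def by (intro Bochner_Integration.integral_nonneg) auto
  define d where "d n = Inf (Q ` tail_weights n)" for n
  have bdd: "bdd_below (Q ` tail_weights n)" for n using Q0 by (intro bdd_belowI[of _ 0]) auto
  have ne: "tail_weights n \<noteq> {}" for n using tail_weights_single by blast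
  have dle: "d n \<le> Q c" if "c \<in> tail_weights n" for n c
    unfolding d_def using that by (intro cInf_lower bdd) auto
  have "incseq d"
    unfolding incseq_def d_def using ne bdd tail_weights_mono
    by (intro allI impI cInf_superset_mono image_mono) auto
  moreover have "d n \<le> K" for n
    using dle[OF tail_weights_single[of n]] bound[of n] by (simp add: Q_def combination_single)
  ultimately have "convergent d"
    by (metis convergentI incseq_convergent)
  then have Cd: "Cauchy d" by (rule convergent_Cauchy)
  have "\<exists>c. c \<in> tail_weights n \<and> Q c < d n + 1 / Suc n" for n
    using cInf_lessD[of "Q ` tail_weights n" "d n + 1 / Suc n"] ne unfolding d_def by fastforce
  then obtain c where c: "\<And>n. c n \<in> tail_weights n" "\<And>n. Q (c n) < d n + 1 / Suc n" by metis
  have diff: "(LINT x|M. (norm (combination (c n) f x - combination (c m) f x))\<^sup>2) \<le> 2 * (d m - d n) + 4 / Suc n"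
    and sqd: "integrable M (\<lambda>x. (norm (combination (c n) f x - combination (c m) f x))\<^sup>2)" if nm: "n \<le> m" for n m
  proof -
    define e where "e k = (c n k + c m k) / 2" for k
    have cm: "c m \<in> tail_weights n" using c(1) tail_weights_mono[OF nm] by blast
    have e: "e \<in> tail_weights n" "\<And>x. combination e f x = (1 / 2) *\<^sub>R (combination (c n) f x + combination (c m) f x)"
      unfolding e_def by (rule tail_weights_midpoint[OF c(1) cm])+
    have par: "(norm (combination (c n) f x - combination (c m) f x))\<^sup>2 = 2 * (norm (combination (c n) f x))\<^sup>2 + 2 * (norm (combination (c m) f x))\<^sup>2 - 4 * (norm (combination e f x))\<^sup>2" for x
      unfolding e(2) by (simp add: power2_norm_eq_inner inner_diff inner_add inner_commute algebra_simps)
    show "integrable M (\<lambda>x. (norm (combination (c n) f x - combination (c m) f x))\<^sup>2)"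
      unfolding par using sqc by simp
    have "(LINT x|M. (norm (combination (c n) f x - combination (c m) f x))\<^sup>2) = 2 * Q (c n) + 2 * Q (c m) - 4 * Q e"
      unfolding par Q_def using sqc by simp
    also have "\<dots> \<le> 2 * (d n + 1 / Suc n) + 2 * (d m + 1 / Suc m) - 4 * d n"
    proof -
      have "a + b - 4 * z \<le> a' + b' - 4 * z'" if "a < a'" "b < b'" "z' \<le> z" for a b z a' b' z' :: real
        using that by linarith
      from this[of "2 * Q (c n)" "2 * (d n + 1 / Suc n)" "2 * Q (c m)" "2 * (d m + 1 / Suc m)", OF _ _ dle[OF e(1)]]
      show ?thesis using c(2)[of n] c(2)[of m] by simp
    qed
    also have "\<dots> \<le> 2 * (d m - d n) + 4 / Suc n"
    proof -
      have "1 / real (Suc m) \<le> 1 / real (Suc n)" using nm by (intro divide_left_mono) auto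
      then show ?thesis by simp
    qed
    finally show "(LINT x|M. (norm (combination (c n) f x - combination (c m) f x))\<^sup>2) \<le> 2 * (d m - d n) + 4 / Suc n" .
  qed
  have intc: "integrable M (combination c f)" for c
  proof (rule Bochner_Integration.integrable_bound)
    show "integrable M (\<lambda>x. 1 + (norm (combination c f x))\<^sup>2)" using sqc by simp
    show "AE x in M. norm (combination c f x) \<le> norm (1 + (norm (combination c f x))\<^sup>2)"
    proof (rule AE_I2)
      fix x
      have "0 \<le> (norm (combination c f x) - 1)\<^sup>2" by simp
      then have "2 * norm (combination c f x) \<le> 1 + (norm (combination c f x))\<^sup>2"
        by (simp add: power2_eq_square algebra_simps)
      then have "norm (combination c f x) \<le> 1 + (norm (combination c f x))\<^sup>2"
        using norm_ge_zero[of "combination c f x"] by linarith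
      then show "norm (combination c f x) \<le> norm (1 + (norm (combination c f x))\<^sup>2)" by simp
    qed
  qed measurable
  define \<mu> where "\<mu> = measure M (space M) + 1"
  have \<mu>: "\<mu> > 0" by (simp add: \<mu>_def add_nonneg_pos)
  have L1: "\<exists>N. \<forall>i\<ge>N. \<forall>j\<ge>N. (LINT x|M. norm (combination (c i) f x - combination (c j) f x)) < e" if e: "e > 0" for e
  proof -
    define a where "a = e / (2 * \<mu>)"
    have a: "a > 0" using e \<mu> by (simp add: a_def)
    have "e * a > 0" using e a by simp
    then obtain N1 where N1: "\<And>m n. m \<ge> N1 \<Longrightarrow> n \<ge> N1 \<Longrightarrow> \<bar>d m - d n\<bar> < e * a / 8"
      using Cd unfolding Cauchy_def dist_real_def by (metis divide_pos_pos zero_less_numeral)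
    obtain N2 :: nat where "4 / (e * a / 4) < N2" using reals_Archimedean2 by blast
    then have N2: "4 / real (Suc N2) < e * a / 4"
      using \<open>e * a > 0\<close> by (simp add: field_simps)
    have main: "(LINT x|M. norm (combination (c i) f x - combination (c j) f x)) < e"
      if ij: "max N1 N2 \<le> i" "i \<le> j" for i j
    proof -
      have "4 / real (Suc i) \<le> 4 / real (Suc N2)" using ij by (intro divide_left_mono) auto
      then have D: "(LINT x|M. (norm (combination (c i) f x - combination (c j) f x))\<^sup>2) < e * a / 2"
      proof -
        have "\<bar>d j - d i\<bar> < e * a / 8" using ij by (intro N1) auto
        then have "d j - d i < e * a / 8" by linarith
        moreover have "2 * u + p < z / 2" if "u < z / 8" "p \<le> y" "y < z / 4" for u p y z :: real
          using that by linarith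
        ultimately have "2 * (d j - d i) + 4 / real (Suc i) < e * a / 2"
          using \<open>4 / real (Suc i) \<le> 4 / real (Suc N2)\<close> N2 by blast
        then show ?thesis using diff[OF ij(2)] by (rule order_le_less_trans[rotated])
      qed
      have "(LINT x|M. norm (combination (c i) f x - combination (c j) f x))
        \<le> (LINT x|M. a / 2 + (norm (combination (c i) f x - combination (c j) f x))\<^sup>2 / (2 * a))"
      proof (rule integral_mono)
        show "integrable M (\<lambda>x. norm (combination (c i) f x - combination (c j) f x))"
          using intc by simp
        show "integrable M (\<lambda>x. a / 2 + (norm (combination (c i) f x - combination (c j) f x))\<^sup>2 / (2 * a))"
          using sqd[OF ij(2)] by simp
        fix x
        define u where "u = norm (combination (c i) f x - combination (c j) f x)"
        have "0 \<le> (u - a)\<^sup>2" by simp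
        then have "2 * a * u \<le> a * a + u\<^sup>2" by (simp add: power2_eq_square algebra_simps)
        then have "u \<le> a / 2 + u\<^sup>2 / (2 * a)" using a by (simp add: field_simps power2_eq_square)
        then show "norm (combination (c i) f x - combination (c j) f x) \<le> a / 2 + (norm (combination (c i) f x - combination (c j) f x))\<^sup>2 / (2 * a)"
          by (simp add: u_def)
      qed
      also have "\<dots> = a / 2 * measure M (space M) + (LINT x|M. (norm (combination (c i) f x - combination (c j) f x))\<^sup>2) / (2 * a)"
        using sqd[OF ij(2)] by (simp add: mult.commute)
      also have "\<dots> \<le> a / 2 * \<mu> + (e * a / 2) / (2 * a)"
        using a D by (intro add_mono mult_left_mono divide_right_mono) (auto simp: \<mu>_def)
      also have "\<dots> = e / 4 + e / 4" using a \<mu> by (simp add: a_def field_simps)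
      also have "\<dots> < e" using e by simp
      finally show ?thesis .
    qed
    show ?thesis
    proof (intro exI allI impI)
      fix i j assume "max N1 N2 \<le> i" "max N1 N2 \<le> j"
      then show "(LINT x|M. norm (combination (c i) f x - combination (c j) f x)) < e"
        using main[of i j] main[of j i] by (cases "i \<le> j") (auto simp: norm_minus_commute)
    qed
  qed
  obtain r where r: "strict_mono r" "AE x in M. Cauchy (\<lambda>i. combination (c (r i)) f x)"
    using cauchy_L1_AE_cauchy_subseq[of M "\<lambda>n. combination (c n) f", OF intc L1] by blast
  define g where "g x = lim (\<lambda>i. combination (c (r i)) f x)" for x
  have [measurable]: "g \<in> borel_measurable M" unfolding g_def[abs_def] by measurable
  have lim: "AE x in M. (\<lambda>n. combination (c (r n)) f x) \<longlonglongrightarrow> g x"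
    using r(2) by eventually_elim (simp add: g_def convergent_LIMSEQ_iff[symmetric] Cauchy_convergent)
  have "(\<lambda>n. \<integral>\<^sup>+x. ennreal (norm (combination (c (r n)) f x - g x)) \<partial>M) \<longlonglongrightarrow> 0"
  proof (rule tendsto_0_if_eventually_le)
    fix e :: real assume e: "e > 0"
    obtain N where N: "\<And>i j. i \<ge> N \<Longrightarrow> j \<ge> N \<Longrightarrow> (LINT x|M. norm (combination (c i) f x - combination (c j) f x)) < e"
      using L1[OF e] by blast
    have "(\<integral>\<^sup>+x. ennreal (norm (combination (c (r n)) f x - g x)) \<partial>M) \<le> ennreal e" if n: "n \<ge> N" for n
    proof -
      have rN: "r k \<ge> N" if "k \<ge> N" for k using seq_suble[OF r(1), of k] that by simp
      have "(\<integral>\<^sup>+x. ennreal (norm (combination (c (r n)) f x - g x)) \<partial>M)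
        = (\<integral>\<^sup>+x. liminf (\<lambda>k. ennreal (norm (combination (c (r n)) f x - combination (c (r k)) f x))) \<partial>M)"
      proof (rule nn_integral_cong_AE)
        show "AE x in M. ennreal (norm (combination (c (r n)) f x - g x)) = liminf (\<lambda>k. ennreal (norm (combination (c (r n)) f x - combination (c (r k)) f x)))"
          using lim
        proof eventually_elim
          case (elim x)
          have "(\<lambda>k. ennreal (norm (combination (c (r n)) f x - combination (c (r k)) f x))) \<longlonglongrightarrow> ennreal (norm (combination (c (r n)) f x - g x))"
            by (intro tendsto_ennrealI tendsto_intros elim)
          then show ?case by (rule lim_imp_Liminf[OF sequentially_bot, symmetric])
        qed
      qed
      also have "\<dots> \<le> liminf (\<lambda>k. \<integral>\<^sup>+x. ennreal (norm (combination (c (r n)) f x - combination (c (r k)) f x)) \<partial>M)"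
        by (rule nn_integral_liminf) measurable
      also have "\<dots> \<le> ennreal e"
      proof (rule Liminf_le)
        show "\<forall>\<^sub>F k in sequentially. (\<integral>\<^sup>+x. ennreal (norm (combination (c (r n)) f x - combination (c (r k)) f x)) \<partial>M) \<le> ennreal e"
          unfolding eventually_sequentially
        proof (intro exI allI impI)
          fix k assume k: "N \<le> k"
          show "(\<integral>\<^sup>+x. ennreal (norm (combination (c (r n)) f x - combination (c (r k)) f x)) \<partial>M) \<le> ennreal e"
            using less_imp_le[OF N[OF rN[OF n] rN[OF k]]] intc
            by (subst nn_integral_eq_integral) (auto intro!: ennreal_leI)
        qed
      qed simp
      finally show ?thesis .
    qed
    then show "\<forall>\<^sub>F n in sequentially. (\<integral>\<^sup>+x. ennreal (norm (combination (c (r n)) f x - g x)) \<partial>M) \<le> ennreal e"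
      unfolding eventually_sequentially by blast
  qed
  moreover have "c (r n) \<in> tail_weights n" for n
    using c(1) tail_weights_mono[OF seq_suble[OF r(1), of n]] by blast
  ultimately show ?thesis using lim by (intro that[of "\<lambda>n. c (r n)" g]) auto
qed

section \<open>Integration by parts against test functions\<close>

text \<open>The integral of the product \<open>u\<close> does not change when \<open>u\<close> is translated in direction \<open>j\<close>; the
  derivative of this constant at \<open>0\<close> is the integral of the partial derivative of \<open>u\<close>.\<close>

lemma integration_by_parts_test:
  fixes \<Psi> :: "real ^ 'n \<Rightarrow> real ^ 'n" and J :: "real ^ 'n \<Rightarrow> real ^ 'n ^ 'n"
  assumes der: "\<And>x. (\<Psi> has_derivative (\<lambda>v. J x *v v)) (at x)"
    and [measurable]: "\<And>i j. (\<lambda>x. J x $ i $ j) \<in> borel_measurable borel"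
    and J: "\<And>x. \<bar>J x $ i $ j\<bar> \<le> K"
    and phi: "test_function \<phi>"
  shows "(LINT x|lborel. \<Psi> x $ i * partial_deriv j \<phi> x) = - (LINT x|lborel. J x $ i $ j * \<phi> x)"
proof -
  have ball_fin: "emeasure lborel (cball (0 :: real ^ 'n) r) < top" for r
    using emeasure_bounded_finite[OF bounded_cball] by simp
  obtain R where R: "R > 0" "\<And>x. x \<notin> cball 0 R \<Longrightarrow> \<phi> x = 0" "\<And>x j. x \<notin> cball 0 R \<Longrightarrow> partial_deriv j \<phi> x = 0"
    using test_function_support_bounded[OF phi] by metis
  obtain B where B: "B > 0" "\<And>x. \<bar>\<phi> x\<bar> \<le> B" "\<And>x j. \<bar>partial_deriv j \<phi> x\<bar> \<le> B"
    using test_function_bounded[OF phi] by metis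
  have cont: "continuous_on UNIV \<Psi>"
    using der has_derivative_continuous continuous_on_eq_continuous_at by (metis open_UNIV)
  have [measurable]: "\<phi> \<in> borel_measurable borel" "partial_deriv j \<phi> \<in> borel_measurable borel"
    by (intro borel_measurable_continuous_onI test_function_continuous test_function_partial_continuous phi)+
  have conti: "continuous_on UNIV (\<lambda>x. \<Psi> x $ i)" using cont by (intro continuous_intros)
  then have [measurable]: "(\<lambda>x. \<Psi> x $ i) \<in> borel_measurable borel" by (rule borel_measurable_continuous_onI)
  define u where "u x = \<Psi> x $ i * \<phi> x" for x
  define u' where "u' x = J x $ i $ j * \<phi> x + \<Psi> x $ i * partial_deriv j \<phi> x" for x
  have int1: "integrable lborel (\<lambda>x. \<Psi> x $ i * partial_deriv j \<phi> x)"
    using loc_integrable_times_bounded[OF continuous_loc_integrable[OF conti], of "partial_deriv j \<phi>" B R] B R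
    by (simp add: mult.commute)
  have int2: "integrable lborel (\<lambda>x. J x $ i $ j * \<phi> x)"
  proof (rule Bochner_Integration.integrable_bound)
    show "integrable lborel (\<lambda>x :: real ^ 'n. K * B * indicator (cball 0 R) x :: real)"
      by (intro integrable_mult_right integrable_real_indicator) (auto simp: ball_fin)
    show "AE x in lborel. norm (J x $ i $ j * \<phi> x) \<le> norm (K * B * indicator (cball 0 R) x)"
    proof (rule AE_I2)
      fix x
      have K: "0 \<le> K" using J[of 0] abs_ge_zero order_trans by blast
      show "norm (J x $ i $ j * \<phi> x) \<le> norm (K * B * indicator (cball 0 R) x)"
        using J[of x] B(1) B(2)[of x] R(2)[of x] K by (cases "x \<in> cball 0 R") (auto simp: abs_mult intro!: mult_mono)
    qed
  qed simp
  obtain P where P: "\<And>x. x \<in> cball 0 R \<Longrightarrow> \<bar>\<Psi> x $ i\<bar> \<le> P" "P \<ge> 0"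
  proof -
    have "compact ((\<lambda>x. \<Psi> x $ i) ` cball 0 R)"
      by (intro compact_continuous_image continuous_on_subset[OF conti]) auto
    then have "bounded ((\<lambda>x. \<Psi> x $ i) ` cball 0 R)" by (rule compact_imp_bounded)
    then obtain P where P: "P > 0" "\<forall>y\<in>(\<lambda>x. \<Psi> x $ i) ` cball 0 R. norm y \<le> P"
      unfolding bounded_pos by blast
    have "\<bar>\<Psi> x $ i\<bar> \<le> P" if "x \<in> cball 0 R" for x
      using P(2)[rule_format, OF imageI[OF that]] by simp
    with P(1) show ?thesis by (intro that[of P]) auto
  qed
  define C where "C = K * B + P * B"
  have K0: "0 \<le> K" using J[of 0] abs_ge_zero order_trans by blast
  have u'_le: "\<bar>u' x\<bar> \<le> C" for x
  proof (cases "x \<in> cball 0 R")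
    case True
    have "\<bar>u' x\<bar> \<le> \<bar>J x $ i $ j\<bar> * \<bar>\<phi> x\<bar> + \<bar>\<Psi> x $ i\<bar> * \<bar>partial_deriv j \<phi> x\<bar>"
      unfolding u'_def by (metis abs_mult abs_triangle_ineq)
    also have "\<dots> \<le> C" unfolding C_def
      using J[of x] B(2)[of x] B(3)[of j x] P(1)[OF True] P(2) K0 by (intro add_mono mult_mono) auto
    finally show ?thesis .
  next
    case False
    then have "u' x = 0" using R by (simp add: u'_def)
    then show ?thesis using K0 B(1) P(2) by (simp add: C_def)
  qed
  have line: "((\<lambda>\<tau>. u (x + \<tau> *\<^sub>R axis j 1)) has_derivative (\<lambda>v. v * u' (x + \<tau> *\<^sub>R axis j 1))) (at \<tau>)" for x \<tau>
  proof -
    let ?y = "x + \<tau> *\<^sub>R axis j 1"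
    have a: "((\<lambda>\<tau>. x + \<tau> *\<^sub>R axis j 1) has_derivative (\<lambda>v. v *\<^sub>R axis j 1)) (at \<tau>)"
      by (auto intro!: derivative_eq_intros)
    have "((\<lambda>\<tau>. \<Psi> (x + \<tau> *\<^sub>R axis j 1) $ i) has_derivative (\<lambda>v. (J ?y *v (v *\<^sub>R axis j 1)) $ i)) (at \<tau>)"
      by (rule bounded_linear.has_derivative[OF bounded_linear_vec_nth has_derivative_compose[OF a der]])
    moreover have "(J ?y *v (v *\<^sub>R axis j 1)) $ i = v * J ?y $ i $ j" for v
      by (simp add: matrix_vector_mult_scaleR matrix_vector_mult_basis column_def)
    ultimately have b: "((\<lambda>\<tau>. \<Psi> (x + \<tau> *\<^sub>R axis j 1) $ i) has_derivative (\<lambda>v. v * J ?y $ i $ j)) (at \<tau>)" by simp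
    have "((\<lambda>\<tau>. \<phi> (x + \<tau> *\<^sub>R axis j 1)) has_derivative (\<lambda>v. \<Sum>k\<in>UNIV. partial_deriv k \<phi> ?y * (v *\<^sub>R axis j 1) $ k)) (at \<tau>)"
      by (rule has_derivative_compose[OF a test_function_has_derivative[OF phi]])
    moreover have "(\<Sum>k\<in>UNIV. partial_deriv k \<phi> ?y * (v *\<^sub>R axis j 1) $ k) = v * partial_deriv j \<phi> ?y" for v
      by (simp add: axis_def if_distrib cong: if_cong)
    ultimately have c: "((\<lambda>\<tau>. \<phi> (x + \<tau> *\<^sub>R axis j 1)) has_derivative (\<lambda>v. v * partial_deriv j \<phi> ?y)) (at \<tau>)" by simp
    show ?thesis unfolding u_def u'_def
      using has_derivative_mult[OF b c] by (simp add: algebra_simps)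
  qed
  have lip: "\<bar>u (x + \<tau> *\<^sub>R axis j 1) - u (x + 0 *\<^sub>R axis j 1)\<bar> \<le> C * \<bar>\<tau>\<bar>" for x \<tau>
  proof -
    have "norm (u (x + \<tau> *\<^sub>R axis j 1) - u (x + 0 *\<^sub>R axis j 1)) \<le> C * norm (\<tau> - 0)"
    proof (rule differentiable_bound[of UNIV "\<lambda>\<tau>. u (x + \<tau> *\<^sub>R axis j 1)" "\<lambda>\<tau> v. v * u' (x + \<tau> *\<^sub>R axis j 1)"])
      show "onorm (\<lambda>v. v * u' (x + t *\<^sub>R axis j 1)) \<le> C" for t
      proof (rule onorm_le)
        fix v :: real
        show "norm (v * u' (x + t *\<^sub>R axis j 1)) \<le> C * norm v"
          using mult_left_mono[OF u'_le abs_ge_zero[of v]] by (simp add: abs_mult mult.commute)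
      qed
    qed (use line in auto)
    then show ?thesis by simp
  qed
  have [measurable]: "u \<in> borel_measurable borel" unfolding u_def by measurable
  have u0: "u x = 0" if "x \<notin> cball 0 R" for x using R(2)[OF that] by (simp add: u_def)
  have intu: "integrable lborel u"
    using loc_integrable_times_bounded[OF continuous_loc_integrable[OF conti], of \<phi> B R] B R
    unfolding u_def by (simp add: mult.commute)
  have shift: "integrable lborel (\<lambda>x. u (x + \<tau> *\<^sub>R axis j 1))" "(LINT x|lborel. u (x + \<tau> *\<^sub>R axis j 1)) = integral\<^sup>L lborel u" for \<tau>
  proof -
    have "integrable (distr lborel borel (\<lambda>x. \<tau> *\<^sub>R axis j 1 + x)) u"
      using intu by (simp add: lborel_distr_plus)
    then show "integrable lborel (\<lambda>x. u (x + \<tau> *\<^sub>R axis j 1))"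
      by (subst (asm) integrable_distr_eq) (auto simp: add.commute)
    show "(LINT x|lborel. u (x + \<tau> *\<^sub>R axis j 1)) = integral\<^sup>L lborel u"
      using integral_lborel_shift[of u "\<tau> *\<^sub>R axis j 1"] by (simp add: add.commute)
  qed
  have intu': "integrable lborel u'" unfolding u'_def using int1 int2 by simp
  have "((\<lambda>\<tau>. LINT x|lborel. u (x + \<tau> *\<^sub>R axis j 1)) has_derivative (\<lambda>v. LINT x|lborel. v * u' x)) (at 0)"
  proof (rule has_derivative_integral[of 1 0 lborel _ _ "\<lambda>x. C * indicator (cball 0 (R + 1)) x"])
    show "integrable lborel (\<lambda>x :: real ^ 'n. C * indicator (cball 0 (R + 1)) x :: real)"
      by (intro integrable_mult_right integrable_real_indicator) (auto simp: ball_fin)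
    show "AE x in lborel. ((\<lambda>\<tau>. u (x + \<tau> *\<^sub>R axis j 1)) has_derivative (\<lambda>v. v * u' x)) (at 0)"
      using line[where \<tau> = 0] by simp
    show "AE x in lborel. norm (u (x + \<tau> *\<^sub>R axis j 1) - u (x + 0 *\<^sub>R axis j 1)) \<le> C * indicator (cball 0 (R + 1)) x * norm (\<tau> - 0)"
      if \<tau>: "\<tau> \<in> ball 0 1" for \<tau>
    proof (rule AE_I2)
      fix x
      show "norm (u (x + \<tau> *\<^sub>R axis j 1) - u (x + 0 *\<^sub>R axis j 1)) \<le> C * indicator (cball 0 (R + 1)) x * norm (\<tau> - 0)"
      proof (cases "x \<in> cball 0 (R + 1)")
        case True
        then show ?thesis using lip[of x \<tau>] by simp
      next
        case False
        have "norm (\<tau> *\<^sub>R axis j 1 :: real ^ 'n) < 1" using \<tau> by simp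
        then have "norm (x + \<tau> *\<^sub>R axis j 1) > R" using False norm_diff_ineq[of x "\<tau> *\<^sub>R axis j 1"] by simp
        then show ?thesis using False u0[of x] u0[of "x + \<tau> *\<^sub>R axis j 1"] by simp
      qed
    qed
    show "AE x in lborel. norm (v * u' x) \<le> C * indicator (cball 0 (R + 1)) x * norm v" for v
    proof (rule AE_I2)
      fix x
      show "norm (v * u' x) \<le> C * indicator (cball 0 (R + 1)) x * norm v"
      proof (cases "x \<in> cball 0 (R + 1)")
        case True
        then show ?thesis using mult_left_mono[OF u'_le[of x] abs_ge_zero[of v]] by (simp add: abs_mult mult.commute)
      next
        case False
        then have "u' x = 0" using R by (simp add: u'_def)
        then show ?thesis using False by simp
      qed
    qed
  qed (use shift intu' in auto)
  then have "((\<lambda>\<tau>::real. integral\<^sup>L lborel u) has_derivative (\<lambda>v. LINT x|lborel. v * u' x)) (at 0)"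
    by (simp only: shift)
  from has_derivative_unique[OF this has_derivative_const]
  have "(LINT x|lborel. 1 * u' x) = 0" by metis
  then show ?thesis using int1 int2 unfolding u'_def by simp
qed

lemma ennreal_term_le_suminf: "f n \<le> suminf f" for f :: "nat \<Rightarrow> ennreal"
  using sum_le_suminf[of f "{n}"] by simp

text \<open>The local \<open>L2\<close> bounds are combined into one: the density \<open>\<omega>\<close> gives every ball a weight so small
  that the squared norms have integral at most \<open>2\<close>, and it is bounded below on every ball.\<close>

lemma Mazur_L2_local:
  fixes f :: "nat \<Rightarrow> real ^ 'n \<Rightarrow> 'b::euclidean_space"
  assumes meas [measurable]: "\<And>k. f k \<in> borel_measurable borel"
    and bound: "\<And>R. \<exists>C::real. \<forall>k. (\<integral>\<^sup>+x\<in>cball 0 R. ennreal ((norm (f k x))\<^sup>2) \<partial>lborel) \<le> ennreal C"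
  obtains c g where "\<And>n. c n \<in> tail_weights n" "g \<in> borel_measurable borel"
    "AE x in lborel. (\<lambda>n. combination (c n) f x) \<longlonglongrightarrow> g x"
    "\<And>R. (\<lambda>n. \<integral>\<^sup>+x\<in>cball 0 R. ennreal (norm (combination (c n) f x - g x)) \<partial>lborel) \<longlonglongrightarrow> 0"
proof -
  obtain C :: "nat \<Rightarrow> real" where C: "\<And>n k. (\<integral>\<^sup>+x\<in>cball 0 (real n). ennreal ((norm (f k x))\<^sup>2) \<partial>lborel) \<le> ennreal (C n)"
  proof -
    have "\<forall>n::nat. \<exists>C. \<forall>k. (\<integral>\<^sup>+x\<in>cball 0 (real n). ennreal ((norm (f k x))\<^sup>2) \<partial>lborel) \<le> ennreal C"
      using bound by blast
    from choice[OF this] show ?thesis using that by blast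
  qed
  define vol where "vol n = measure lborel (cball (0 :: real ^ 'n) (real n))" for n :: nat
  have vol: "emeasure lborel (cball (0 :: real ^ 'n) (real n)) = ennreal (vol n)" for n
    unfolding vol_def using emeasure_bounded_finite[OF bounded_cball, of "0 :: real ^ 'n" "real n"]
    by (intro emeasure_eq_ennreal_measure) auto
  have vol0: "0 \<le> vol n" for n by (simp add: vol_def)
  define a where "a n = (1 / 2) ^ n / (1 + \<bar>C n\<bar> + vol n)" for n
  have den: "1 + \<bar>C n\<bar> + vol n > 0" for n using vol0[of n] by (simp add: add_pos_nonneg)
  have a: "a n > 0" for n using den[of n] by (simp add: a_def)
  have acut: "a n * y \<le> (1 / 2) ^ n" if "y \<le> 1 + \<bar>C n\<bar> + vol n" for n y
    using that den[of n] unfolding a_def by (simp add: divide_le_eq)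
  define \<omega> where "\<omega> x = (\<Sum>n. ennreal (a n) * indicator (cball 0 (real n)) x)" for x :: "real ^ 'n"
  define \<mu> where "\<mu> = density lborel \<omega>"
  have [measurable]: "cball (0 :: real ^ 'n) r \<in> sets borel" for r by simp
  have [measurable]: "\<omega> \<in> borel_measurable borel" unfolding \<omega>_def by measurable
  have key: "(\<integral>\<^sup>+x. u x \<partial>\<mu>) = (\<Sum>n. ennreal (a n) * (\<integral>\<^sup>+x\<in>cball 0 (real n). u x \<partial>lborel))"
    if [measurable]: "u \<in> borel_measurable borel" for u :: "real ^ 'n \<Rightarrow> ennreal"
  proof -
    have "(\<integral>\<^sup>+x. u x \<partial>\<mu>) = (\<integral>\<^sup>+x. \<omega> x * u x \<partial>lborel)"
      unfolding \<mu>_def by (rule nn_integral_density) auto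
    also have "\<dots> = (\<integral>\<^sup>+x. (\<Sum>n. ennreal (a n) * (u x * indicator (cball 0 (real n)) x)) \<partial>lborel)"
      unfolding \<omega>_def ennreal_suminf_multc[symmetric] by (simp add: mult_ac)
    also have "\<dots> = (\<Sum>n. \<integral>\<^sup>+x. ennreal (a n) * (u x * indicator (cball 0 (real n)) x) \<partial>lborel)"
      by (rule nn_integral_suminf) measurable
    also have "\<dots> = (\<Sum>n. ennreal (a n) * (\<integral>\<^sup>+x\<in>cball 0 (real n). u x \<partial>lborel))"
      by (intro suminf_cong nn_integral_cmult) measurable
    finally show ?thesis .
  qed
  have geo: "(\<Sum>n. ennreal ((1 / 2) ^ n)) = ennreal 2"
    using geometric_sums[of "1 / 2 :: real"] by (intro suminf_ennreal_eq) auto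
  have sq2: "(\<integral>\<^sup>+x. ennreal ((norm (f k x))\<^sup>2) \<partial>\<mu>) \<le> ennreal 2" for k
  proof -
    have "(\<integral>\<^sup>+x. ennreal ((norm (f k x))\<^sup>2) \<partial>\<mu>) = (\<Sum>n. ennreal (a n) * (\<integral>\<^sup>+x\<in>cball 0 (real n). ennreal ((norm (f k x))\<^sup>2) \<partial>lborel))"
      by (rule key) measurable
    also have "\<dots> \<le> (\<Sum>n. ennreal ((1 / 2) ^ n))"
    proof (rule suminf_le)
      fix n
      have "ennreal (a n) * (\<integral>\<^sup>+x\<in>cball 0 (real n). ennreal ((norm (f k x))\<^sup>2) \<partial>lborel) \<le> ennreal (a n) * ennreal (1 + \<bar>C n\<bar> + vol n)"
        using vol0[of n] by (intro mult_left_mono order_trans[OF C ennreal_leI]) auto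
      also have "\<dots> \<le> ennreal ((1 / 2) ^ n)"
        using acut[of "1 + \<bar>C n\<bar> + vol n" n] a[of n] den[of n] by (simp add: ennreal_mult[symmetric] ennreal_leI less_imp_le)
      finally show "ennreal (a n) * (\<integral>\<^sup>+x\<in>cball 0 (real n). ennreal ((norm (f k x))\<^sup>2) \<partial>lborel) \<le> ennreal ((1 / 2) ^ n)" .
    qed auto
    finally show ?thesis by (simp only: geo)
  qed
  have fin: "emeasure \<mu> (space \<mu>) \<noteq> \<infinity>"
  proof -
    have "emeasure \<mu> (space \<mu>) = (\<integral>\<^sup>+x. 1 \<partial>\<mu>)" by simp
    also have "\<dots> = (\<Sum>n. ennreal (a n) * (\<integral>\<^sup>+x\<in>cball 0 (real n). 1 \<partial>(lborel :: (real ^ 'n) measure)))"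
      by (rule key) simp
    also have "\<dots> \<le> (\<Sum>n. ennreal ((1 / 2) ^ n))"
    proof (rule suminf_le)
      fix n
      have "ennreal (a n) * ennreal (vol n) \<le> ennreal ((1 / 2) ^ n)"
        using acut[of "vol n" n] a[of n] vol0[of n] by (simp add: ennreal_mult[symmetric] ennreal_leI less_imp_le)
      then show "ennreal (a n) * (\<integral>\<^sup>+x\<in>cball 0 (real n). 1 \<partial>(lborel :: (real ^ 'n) measure)) \<le> ennreal ((1 / 2) ^ n)"
        by (simp add: vol)
    qed auto
    also have "\<dots> < \<infinity>" by (simp add: geo)
    finally show ?thesis by simp
  qed
  have sets\<mu>1 [measurable_cong]: "sets \<mu> = sets borel" unfolding \<mu>_def by simp
  note sets\<mu> = measurable_cong_sets[OF sets\<mu>1 refl]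
  have int: "integrable \<mu> (\<lambda>x. (norm (f k x))\<^sup>2)" for k
    using sq2[of k] by (intro integrableI_nonneg) (auto simp: sets\<mu> order_le_less_trans)
  have le2: "(LINT x|\<mu>. (norm (f k x))\<^sup>2) \<le> 2" for k
  proof -
    have "ennreal (LINT x|\<mu>. (norm (f k x))\<^sup>2) \<le> ennreal 2"
      using sq2[of k] nn_integral_eq_integral[OF int[of k]] by simp
    then show ?thesis by (subst (asm) ennreal_le_iff) auto
  qed
  obtain c g where cg: "\<And>n. c n \<in> tail_weights n" "g \<in> borel_measurable \<mu>"
    "AE x in \<mu>. (\<lambda>n. combination (c n) f x) \<longlonglongrightarrow> g x"
    "(\<lambda>n. \<integral>\<^sup>+x. ennreal (norm (combination (c n) f x - g x)) \<partial>\<mu>) \<longlonglongrightarrow> 0"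
    using Mazur_L2[of \<mu> f 2, OF fin meas[folded sets\<mu>] int le2] by blast
  have g [measurable]: "g \<in> borel_measurable borel" using cg(2) sets\<mu> by simp
  have [measurable]: "combination c f \<in> borel_measurable borel" for c
    unfolding combination_def[abs_def] by measurable
  have \<omega>pos: "\<omega> x > 0" for x
  proof -
    obtain n :: nat where n: "norm x \<le> real n" using real_arch_simple by blast
    have "0 < ennreal (a n) * indicator (cball 0 (real n)) x" using a[of n] n by simp
    also have "\<dots> \<le> \<omega> x" unfolding \<omega>_def
      by (rule ennreal_term_le_suminf)
    finally show ?thesis .
  qed
  have "AE x in lborel. (\<lambda>n. combination (c n) f x) \<longlonglongrightarrow> g x"
    using cg(3) unfolding \<mu>_def by (subst (asm) AE_density) (auto simp: \<omega>pos)
  moreover have "(\<lambda>n. \<integral>\<^sup>+x\<in>cball 0 R. ennreal (norm (combination (c n) f x - g x)) \<partial>lborel) \<longlonglongrightarrow> 0" for R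
  proof (rule tendsto_0_if_eventually_le)
    fix e :: real assume e: "e > 0"
    obtain r :: nat where r: "R \<le> real r" using real_arch_simple by blast
    have "0 < ennreal (e * a r)" using e a[of r] by simp
    then have "\<forall>\<^sub>F n in sequentially. (\<integral>\<^sup>+x. ennreal (norm (combination (c n) f x - g x)) \<partial>\<mu>) < ennreal (e * a r)"
      using cg(4) order_tendstoD(2) by blast
    then show "\<forall>\<^sub>F n in sequentially. (\<integral>\<^sup>+x\<in>cball 0 R. ennreal (norm (combination (c n) f x - g x)) \<partial>lborel) \<le> ennreal e"
    proof eventually_elim
      case (elim n)
      let ?u = "\<lambda>x. ennreal (norm (combination (c n) f x - g x))"
      have "(\<integral>\<^sup>+x\<in>cball 0 R. ?u x \<partial>lborel) \<le> (\<integral>\<^sup>+x\<in>cball 0 (real r). ?u x \<partial>lborel)"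
        using r by (intro nn_integral_mono) (auto simp: indicator_def)
      also have "\<dots> = ennreal (1 / a r) * (ennreal (a r) * (\<integral>\<^sup>+x\<in>cball 0 (real r). ?u x \<partial>lborel))"
        using a[of r] by (simp add: mult.assoc[symmetric] ennreal_mult[symmetric])
      also have "\<dots> \<le> ennreal (1 / a r) * (\<integral>\<^sup>+x. ?u x \<partial>\<mu>)"
      proof (rule mult_left_mono)
        have "(\<integral>\<^sup>+x. ?u x \<partial>\<mu>) = (\<Sum>n. ennreal (a n) * (\<integral>\<^sup>+x\<in>cball 0 (real n). ?u x \<partial>lborel))"
          by (rule key) measurable
        then show "ennreal (a r) * (\<integral>\<^sup>+x\<in>cball 0 (real r). ?u x \<partial>lborel) \<le> (\<integral>\<^sup>+x. ?u x \<partial>\<mu>)"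
          using ennreal_term_le_suminf[of "\<lambda>n. ennreal (a n) * (\<integral>\<^sup>+x\<in>cball 0 (real n). ?u x \<partial>lborel)" r] by simp
      qed simp
      also have "\<dots> \<le> ennreal (1 / a r) * ennreal (e * a r)" using elim by (intro mult_left_mono) auto
      also have "\<dots> = ennreal e" using a[of r] e by (simp add: ennreal_mult[symmetric])
      finally show ?case .
    qed
  qed
  ultimately show ?thesis using cg(1) g by (intro that[of c g]) auto
qed

section \<open>Approximation of the flow\<close>

lemma good_field_mono_divergence:
  assumes "good_field D M f" "D \<le> D'" shows "good_field D' M f"
proof -
  have "AE x in lborel. \<bar>trace (H x)\<bar> \<le> D'" if "AE x in lborel. \<bar>trace (H x)\<bar> \<le> D" for H :: "real ^ 'a \<Rightarrow> real ^ 'a ^ 'a"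
    using that by eventually_elim (use assms(2) in simp)
  then show ?thesis using assms(1) unfolding good_field_def by blast
qed

lemma borel_measurable_matrix:
  fixes F :: "'x \<Rightarrow> real ^ 'n ^ 'm"
  assumes "\<And>i j. (\<lambda>p. F p $ i $ j) \<in> borel_measurable M"
  shows "F \<in> borel_measurable M"
  unfolding borel_measurable_euclidean_space[of F]
proof
  fix e :: "real ^ 'n ^ 'm" assume "e \<in> Basis"
  then obtain i j where "e = axis i (axis j 1)" by (auto simp: Basis_vec_def)
  then show "(\<lambda>p. F p \<bullet> e) \<in> borel_measurable M" using assms[of i j] by (simp add: inner_axis)
qed

lemma borel_measurable_nth:
  fixes F :: "'x \<Rightarrow> 'b::real_normed_vector ^ 'n"
  shows "F \<in> borel_measurable M \<Longrightarrow> (\<lambda>p. F p $ i) \<in> borel_measurable M"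
  by (rule measurable_compose[OF _ borel_measurable_continuous_onI[OF linear_continuous_on[OF bounded_linear_vec_nth]]])

text \<open>Mollify at scale \<open>1 / 16 ^ k\<close> and run the Euler scheme with very small steps. The factor
  \<open>exp (T * L k)\<close> in the error estimate is at most of order \<open>2 ^ k\<close>, since the Lipschitz constant
  \<open>L k\<close> grows logarithmically with a factor at our disposal, while the mollification error is of
  order \<open>1 / 8 ^ k\<close>. The bounds on powers of \<open>w k\<close> do not depend on \<open>k\<close>, because the exponential
  integrals of the mollified gradients do not.\<close>

lemma flow_approximations:
  fixes b :: "real \<Rightarrow> real ^ 'n \<Rightarrow> real ^ 'n" and g :: "real \<Rightarrow> real ^ 'n \<Rightarrow> real ^ 'n"
  assumes T: "T > 0"
    and gm: "(\<lambda>(s, x). g s x) \<in> borel_measurable (borel \<Otimes>\<^sub>M borel)"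
    and bg: "AE s in lborel. s \<in> {0..T} \<longrightarrow> (AE x in lborel. b s x = g s x)"
    and good: "AE s in lborel. s \<in> {0..T} \<longrightarrow> good_field D M (b s)"
    and \<gamma>0: "trajectory T b \<gamma>0"
  obtains \<Psi> :: "nat \<Rightarrow> real ^ 'n \<Rightarrow> real ^ 'n" and J :: "nat \<Rightarrow> real ^ 'n \<Rightarrow> real ^ 'n ^ 'n"
    and w :: "nat \<Rightarrow> real ^ 'n \<Rightarrow> real" and K :: "nat \<Rightarrow> real" and C :: real where
    "\<And>k x. (\<Psi> k has_derivative (\<lambda>v. J k x *v v)) (at x)"
    "\<And>k i j. (\<lambda>x. J k x $ i $ j) \<in> borel_measurable borel"
    "\<And>k x i j. \<bar>J k x $ i $ j\<bar> \<le> w k x"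
    "\<And>k x. 0 < w k x" "\<And>k x. w k x \<le> K k" "\<And>k. w k \<in> borel_measurable borel"
    "\<And>R q. q > 0 \<Longrightarrow> \<exists>C::real. \<forall>k. (\<integral>\<^sup>+x\<in>cball 0 R. ennreal (w k x powr q) \<partial>lborel) \<le> ennreal C"
    "\<And>k \<gamma>. trajectory T b \<gamma> \<Longrightarrow> norm (\<gamma> T - \<Psi> k (\<gamma> 0)) \<le> C / 4 ^ k"
proof -
  define D' where "D' = max D 0"
  have D': "D' \<ge> 0" by (simp add: D'_def)
  have good': "AE s in lborel. s \<in> {0..T} \<longrightarrow> good_field D' M (b s)"
    using good by (auto elim!: eventually_mono intro: good_field_mono_divergence simp: D'_def)
  obtain C0 where C0: "C0 > 0" "\<And>(f :: real ^ 'n \<Rightarrow> real ^ 'n) k x. good_field D' M f \<Longrightarrow> exp ((T + 1) * norm (mollify_grad (mscale k) f x)) \<le> C0 * 2 ^ k"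
    using mollify_grad_exp_bound[of "T + 1" D' M] T by auto
  define C1 where "C1 = max 1 C0"
  have C1: "C1 \<ge> 1" "\<And>(f :: real ^ 'n \<Rightarrow> real ^ 'n) k x. good_field D' M f \<Longrightarrow> exp ((T + 1) * norm (mollify_grad (mscale k) f x)) \<le> C1 * 2 ^ k"
  proof -
    show "C1 \<ge> 1" by (simp add: C1_def)
    have "C0 * 2 ^ k \<le> C1 * 2 ^ k" for k :: nat by (intro mult_right_mono) (auto simp: C1_def)
    then show "exp ((T + 1) * norm (mollify_grad (mscale k) f x)) \<le> C1 * 2 ^ k" if "good_field D' M f"
      for f :: "real ^ 'n \<Rightarrow> real ^ 'n" and k x
      using C0(2)[OF that] order_trans by blast
  qed
  obtain C2 where C2: "C2 > 0"
    "\<And>(f :: real ^ 'n \<Rightarrow> real ^ 'n) k x. good_field D' M f \<Longrightarrow> norm (mollify (mscale k) f x - f x) \<le> C2 / 8 ^ k"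
    "\<And>(f :: real ^ 'n \<Rightarrow> real ^ 'n) x y. good_field D' M f \<Longrightarrow> norm (f x - f y) \<le> C2"
    using mollify_error_bound[of D' M] by metis
  \<comment> \<open>By the bound on the oscillation, one trajectory controls the field everywhere.\<close>
  define m0 where "m0 s = indicator {0..T} s * (norm (b s (\<gamma>0 s)) + C2)" for s
  have m0: "integrable lebesgue m0"
  proof -
    have "integrable lebesgue (\<lambda>s. norm (indicator {0..T} s *\<^sub>R b s (\<gamma>0 s)) + C2 * indicator {0..T} s)"
      using \<gamma>0 T unfolding trajectory_def set_integrable_def
      by (intro Bochner_Integration.integrable_add integrable_norm integrable_mult_right integrable_real_indicator) auto
    moreover have "norm (indicator {0..T} s *\<^sub>R b s (\<gamma>0 s)) + C2 * indicator {0..T} s = m0 s" for s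
      by (simp add: m0_def indicator_def)
    ultimately show ?thesis by simp
  qed
  obtain m1 where m1: "m1 \<in> borel_measurable lborel" "AE s in lborel. m0 s = m1 s"
    using completion_ex_borel_measurable_real[OF borel_measurable_integrable[OF m0]] by blast
  define m where "m s = \<bar>m1 s\<bar>" for s
  have m: "integrable lborel m"
  proof -
    have "integrable lebesgue m1"
      using m0 by (rule integrable_cong_AE_imp) (use m1 in \<open>auto intro: AE_completion measurable_completion\<close>)
    then have "integrable lborel m1" using integrable_completion[OF m1(1)] by simp
    then show ?thesis unfolding m_def by simp
  qed
  define P where "P s \<longleftrightarrow> (s \<in> {0..T} \<longrightarrow> good_field D' M (b s) \<and> (AE x in lborel. b s x = g s x) \<and> m s = norm (b s (\<gamma>0 s)) + C2)" for s
  have "AE s in lborel. P s"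
    using good' bg m1(2)
  proof eventually_elim
    case (elim s)
    then show ?case using add_nonneg_nonneg[OF norm_ge_zero[of "b s (\<gamma>0 s)"] less_imp_le[OF C2(1)]]
      by (auto simp: P_def m_def m0_def indicator_def)
  qed
  then obtain Z where Z: "Z \<in> null_sets lborel" "{s. \<not> P s} \<subseteq> Z"
    unfolding eventually_ae_filter by auto
  define E where "E = {0..T} - Z"
  have E [measurable]: "E \<in> sets borel" using Z(1) by (auto simp: E_def)
  have PE: "good_field D' M (b s)" "AE x in lborel. b s x = g s x" "m s = norm (b s (\<gamma>0 s)) + C2" if "s \<in> E" for s
    using that Z(2) unfolding E_def P_def by blast+
  have AE_E: "AE s in lebesgue. s \<in> {0..T} \<longrightarrow> s \<in> E"
    using AE_not_in[OF Z(1)] by (intro AE_completion) (auto simp: E_def elim!: eventually_mono)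
  have gs [measurable]: "g s \<in> borel_measurable borel" for s
    using measurable_compose[OF _ gm, of "\<lambda>x. (s, x)" borel] by simp
  have [measurable]: "(\<lambda>p. g (fst p) (snd p)) \<in> borel_measurable (borel \<Otimes>\<^sub>M borel)"
    using gm by (simp add: case_prod_beta')
  have bs: "continuous_on UNIV (b s)" "b s \<in> borel_measurable borel" if "s \<in> E" for s
    using PE(1)[OF that] by (auto simp: good_field_def intro: borel_measurable_continuous_onI)
  \<comment> \<open>Exceptional times are removed, so that the scheme has its properties at every time.\<close>
  define c where "c k s x = indicator E s *\<^sub>R mollify (mscale k) (g s) x" for k s x
  define A where "A k s x = indicator E s *\<^sub>R mollify_grad (mscale k) (g s) x" for k s x
  have cE: "c k s x = mollify (mscale k) (b s) x" if s: "s \<in> E" for k s x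
  proof -
    have [measurable]: "b s \<in> borel_measurable borel" using bs(2)[OF s] .
    have [measurable]: "mollifier (mscale k) \<in> borel_measurable (borel :: (real ^ 'n) measure)"
      by (rule mollifier_measurable) simp
    have "mollify (mscale k) (g s) x = mollify (mscale k) (b s) x"
      unfolding mollify_def using PE(2)[OF s] by (intro integral_cong_AE) (auto elim!: eventually_mono)
    then show ?thesis using s by (simp add: c_def)
  qed
  have AE': "A k s x = mollify_grad (mscale k) (b s) x" if s: "s \<in> E" for k s x
  proof -
    have [measurable]: "b s \<in> borel_measurable borel" using bs(2)[OF s] .
    have [measurable]: "partial_deriv j (mollifier (mscale k)) \<in> borel_measurable (borel :: (real ^ 'n) measure)" for j
      by (rule mollifier_partial_measurable) simp
    have "mollify_grad (mscale k) (g s) x = mollify_grad (mscale k) (b s) x"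
    proof -
      have [measurable]: "(\<lambda>y. g s y $ i) \<in> borel_measurable borel" "(\<lambda>y. b s y $ i) \<in> borel_measurable borel" for i
        by (intro borel_measurable_nth; measurable)+
      have "(LINT y|lborel. partial_deriv j (mollifier (mscale k)) (x - y) * g s y $ i)
        = (LINT y|lborel. partial_deriv j (mollifier (mscale k)) (x - y) * b s y $ i)" for i j
      proof (rule integral_cong_AE)
        show "AE y in lborel. partial_deriv j (mollifier (mscale k)) (x - y) * g s y $ i
            = partial_deriv j (mollifier (mscale k)) (x - y) * b s y $ i"
          using PE(2)[OF s] by eventually_elim simp
      qed measurable
      then show ?thesis unfolding mollify_grad_def by simp
    qed
    then show ?thesis using s by (simp add: A_def)
  qed
  have c0: "c k s x = 0" and A0: "A k s x = 0" if "s \<notin> E" for k s x using that by (simp_all add: c_def A_def)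
  define L where "L k = ln (C1 * 2 ^ k) / (T + 1)" for k :: nat
  have C1k: "1 \<le> C1 * 2 ^ k" for k :: nat using C1(1) mult_mono[of 1 C1 1 "2 ^ k"] by simp
  have L0: "0 \<le> L k" for k using C1k[of k] T by (simp add: L_def)
  have A_le: "norm (A k s x) \<le> L k" for k s x
  proof (cases "s \<in> E")
    case True
    have "exp ((T + 1) * norm (A k s x)) \<le> C1 * 2 ^ k" using C1(2)[OF PE(1)[OF True]] by (simp add: AE'[OF True])
    then have "(T + 1) * norm (A k s x) \<le> ln (C1 * 2 ^ k)" using C1k[of k] by (subst ln_ge_iff) auto
    then show ?thesis using T by (simp add: L_def field_simps)
  qed (simp add: A0 L0)
  have expL: "exp (T * L k) \<le> C1 * 2 ^ k" for k
  proof -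
    have "T * L k \<le> (T + 1) * L k" using L0[of k] by (simp add: distrib_right)
    also have "\<dots> = ln (C1 * 2 ^ k)" using T by (simp add: L_def)
    finally have "exp (T * L k) \<le> exp (ln (C1 * 2 ^ k))" by simp
    also have "\<dots> = C1 * 2 ^ k" using C1k[of k] by simp
    finally show ?thesis .
  qed
  define M1 where "M1 = (LINT s|lborel. m s)"
  have M1: "M1 \<ge> 0" unfolding M1_def m_def by (intro Bochner_Integration.integral_nonneg) auto
  \<comment> \<open>Large enough for all four smallness conditions, one summand for each.\<close>
  define N where "N k = nat \<lceil>T * (2 * L k + 2 * (D' + 1) + det_remainder CARD('n) * (L k)\<^sup>2 + 8 ^ k * L k * M1)\<rceil> + 1" for k :: nat
  have Nsmall: "T / real (N k) * X \<le> 1" if "X \<le> 2 * L k + 2 * (D' + 1) + det_remainder CARD('n) * (L k)\<^sup>2 + 8 ^ k * L k * M1" for k X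
  proof -
    have "T * X \<le> T * (2 * L k + 2 * (D' + 1) + det_remainder CARD('n) * (L k)\<^sup>2 + 8 ^ k * L k * M1)"
      using that T by (intro mult_left_mono) auto
    also have "\<dots> \<le> real (N k)" unfolding N_def by linarith
    finally have "T * X \<le> real (N k)" .
    moreover have "real (N k) > 0" by (simp add: N_def)
    ultimately show ?thesis by (simp add: field_simps)
  qed
  have pos4: "0 \<le> 2 * L k" "0 \<le> det_remainder CARD('n) * (L k)\<^sup>2" "0 \<le> 8 ^ k * L k * M1" for k
    using L0[of k] D' M1 det_remainder_pos[of "CARD('n)"] by auto
  have lin: "a \<le> a + b + c + d" "b \<le> a + b + c + d" "c \<le> a + b + c + d" "d \<le> a + b + c + d"
    if "0 \<le> a" "0 \<le> b" "0 \<le> c" "0 \<le> d" for a b c d :: real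
    using that by linarith+
  have "0 \<le> 2 * (D' + 1)" using D' by simp
  note terms_le = lin[OF pos4(1) this pos4(2) pos4(3)]
  have es: "euler_scheme T (c k) (A k) m (L k) D' (N k)" for k
  proof
    have [measurable]: "mollifier (mscale k) \<in> borel_measurable (borel :: (real ^ 'n) measure)"
      by (rule mollifier_measurable) simp
    have [measurable]: "partial_deriv j (mollifier (mscale k)) \<in> borel_measurable (borel :: (real ^ 'n) measure)" for j
      by (rule mollifier_partial_measurable) simp
    show "T > 0" by fact
    show "N k > 0" by (simp add: N_def)
    have "(\<lambda>p. LINT y|lborel. mollifier (mscale k) (snd p - y) *\<^sub>R g (fst p) y) \<in> borel_measurable (borel \<Otimes>\<^sub>M borel)"
    proof (rule lborel.borel_measurable_lebesgue_integral)
      have "(\<lambda>q. g (fst (fst q)) (snd q)) \<in> borel_measurable ((borel \<Otimes>\<^sub>M borel) \<Otimes>\<^sub>M lborel)"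
        using measurable_compose[OF _ gm, of "\<lambda>q. (fst (fst q), snd q)" "(borel \<Otimes>\<^sub>M borel) \<Otimes>\<^sub>M lborel"] by simp
      then show "(\<lambda>(p, y). mollifier (mscale k) (snd p - y) *\<^sub>R g (fst p) y) \<in> borel_measurable ((borel \<Otimes>\<^sub>M borel) \<Otimes>\<^sub>M lborel)"
        unfolding case_prod_beta' by measurable
    qed
    then show "(\<lambda>(s, x). c k s x) \<in> borel_measurable (borel \<Otimes>\<^sub>M borel)"
      unfolding c_def mollify_def case_prod_beta' by measurable
    have comp: "(\<lambda>p. LINT y|lborel. partial_deriv j (mollifier (mscale k)) (snd p - y) * g (fst p) y $ i) \<in> borel_measurable (borel \<Otimes>\<^sub>M borel)" for i j
    proof (rule lborel.borel_measurable_lebesgue_integral)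
      have "(\<lambda>q. g (fst (fst q)) (snd q)) \<in> borel_measurable ((borel \<Otimes>\<^sub>M borel) \<Otimes>\<^sub>M lborel)"
        using measurable_compose[OF _ gm, of "\<lambda>q. (fst (fst q), snd q)" "(borel \<Otimes>\<^sub>M borel) \<Otimes>\<^sub>M lborel"] by simp
      then have [measurable]: "(\<lambda>q. g (fst (fst q)) (snd q) $ i) \<in> borel_measurable ((borel \<Otimes>\<^sub>M borel) \<Otimes>\<^sub>M lborel)"
        by (rule measurable_compose[OF _ borel_measurable_continuous_onI[OF linear_continuous_on[OF bounded_linear_vec_nth]]])
      show "(\<lambda>(p, y). partial_deriv j (mollifier (mscale k)) (snd p - y) * g (fst p) y $ i) \<in> borel_measurable ((borel \<Otimes>\<^sub>M borel) \<Otimes>\<^sub>M lborel)"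
        unfolding case_prod_beta' by measurable
    qed
    show "(\<lambda>(s, x). A k s x) \<in> borel_measurable (borel \<Otimes>\<^sub>M borel)"
    proof -
      have "(\<lambda>p. mollify_grad (mscale k) (g (fst p)) (snd p)) \<in> borel_measurable (borel \<Otimes>\<^sub>M borel)"
        using comp by (intro borel_measurable_matrix) (simp add: mollify_grad_def)
      then show ?thesis unfolding A_def case_prod_beta' by measurable
    qed
    show "integrable lborel m" by (rule m)
    show "norm (c k s x) \<le> m s" for s x
    proof (cases "s \<in> E")
      case True
      have "norm (mollify (mscale k) (b s) x - 0) \<le> m s"
      proof (rule mollify_dist_le[OF _ continuous_loc_integrable[OF bs(1)[OF True]]])
        fix z
        have "norm (b s (x - z)) \<le> norm (b s (\<gamma>0 s)) + norm (b s (x - z) - b s (\<gamma>0 s))" by norm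
        then show "norm (b s (x - z) - 0) \<le> m s" using C2(3)[OF PE(1)[OF True], of "x - z" "\<gamma>0 s"] PE(3)[OF True] by simp
      qed simp
      then show ?thesis by (simp add: cE[OF True])
    qed (simp add: c0 m_def)
    show "(c k s has_derivative (\<lambda>v. A k s x *v v)) (at x)" for s x
    proof (cases "s \<in> E")
      case True
      have "c k s = mollify (mscale k) (b s)" using cE[OF True] by blast
      then show ?thesis unfolding AE'[OF True]
        using mollify_has_derivative[OF _ continuous_loc_integrable[OF bs(1)[OF True]], of "mscale k"] by simp
    next
      case False
      have "c k s = (\<lambda>_. 0)" using c0[OF False] by blast
      then show ?thesis by (simp add: A0[OF False])
    qed
    show "norm (A k s x) \<le> L k" for s x by (rule A_le)
    show "\<bar>trace (A k s x)\<bar> \<le> D'" for s x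
    proof (cases "s \<in> E")
      case True
      then show ?thesis unfolding AE'[OF True] using trace_mollify_grad_le[OF _ PE(1)[OF True], of "mscale k"] by simp
    qed (simp add: A0 D' trace_def)
    have "T / N k * (2 * L k) \<le> 1" by (rule Nsmall) (rule terms_le(1))
    then have "2 * (T / N k * L k) \<le> 1" by (simp only: mult.left_commute)
    then show "T / N k * L k \<le> 1 / 2" by linarith
    have "T / N k * (2 * (D' + 1)) \<le> 1" by (rule Nsmall) (rule terms_le(2))
    then have "2 * (T / N k * (D' + 1)) \<le> 1" by (simp only: mult.left_commute)
    then show "T / N k * (D' + 1) \<le> 1 / 2" by linarith
    have "T / N k * (det_remainder CARD('n) * (L k)\<^sup>2) \<le> 1" by (rule Nsmall) (rule terms_le(3))
    then show "det_remainder CARD('n) * (T / N k) * (L k)\<^sup>2 \<le> 1" by (simp add: mult_ac)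
  qed
  define Q where "Q k \<Psi> J w \<longleftrightarrow>
    (\<forall>x. (\<Psi> has_derivative (\<lambda>v. J x *v v)) (at x)) \<and>
    (\<forall>i j. (\<lambda>x. J x $ i $ j) \<in> borel_measurable borel) \<and>
    (\<forall>x i j. \<bar>J x $ i $ j\<bar> \<le> w x) \<and> (\<forall>x. 0 < w x) \<and> (\<forall>x. w x \<le> C1 * 2 ^ k) \<and> w \<in> borel_measurable borel \<and>
    (\<forall>R q C. q \<ge> 0 \<longrightarrow>
       (\<forall>s. (\<integral>\<^sup>+y\<in>cball 0 (R + M1). ennreal (exp (q * T * norm (A k s y))) \<partial>lborel) \<le> C) \<longrightarrow>
       (\<integral>\<^sup>+x\<in>cball 0 R. ennreal (w x powr q) \<partial>lborel) \<le> ennreal (exp (2 * T * (D' + 1))) * C) \<and>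
    (\<forall>\<gamma>. trajectory T b \<gamma> \<longrightarrow> norm (\<gamma> T - \<Psi> (\<gamma> 0)) \<le> C1 * (T * C2 + 1) / 4 ^ k)"
    for k and \<Psi> :: "real ^ 'n \<Rightarrow> real ^ 'n" and J :: "real ^ 'n \<Rightarrow> real ^ 'n ^ 'n" and w
  have ex: "\<exists>\<Psi> J w. Q k \<Psi> J w" for k
  proof -
    obtain \<Psi> :: "real ^ 'n \<Rightarrow> real ^ 'n" and J :: "real ^ 'n \<Rightarrow> real ^ 'n ^ 'n" and w :: "real ^ 'n \<Rightarrow> real" where
      ap: "\<And>x. (\<Psi> has_derivative (\<lambda>v. J x *v v)) (at x)"
      "\<And>i j. (\<lambda>x. J x $ i $ j) \<in> borel_measurable borel"
      "\<And>x i j. \<bar>J x $ i $ j\<bar> \<le> w x" "\<And>x. 0 < w x"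
      "\<And>x. w x \<le> exp (T * L k)" "w \<in> borel_measurable borel"
      "\<And>R q C. q \<ge> 0 \<Longrightarrow>
         (\<And>s. (\<integral>\<^sup>+y\<in>cball 0 (R + (LINT s|lborel. m s)). ennreal (exp (q * T * norm (A k s y))) \<partial>lborel) \<le> C) \<Longrightarrow>
         (\<integral>\<^sup>+x\<in>cball 0 R. ennreal (w x powr q) \<partial>lborel) \<le> ennreal (exp (2 * T * (D' + 1))) * C"
      "\<And>b \<gamma> \<eta>. trajectory T b \<gamma> \<Longrightarrow>
         AE s in lebesgue. s \<in> {0..T} \<longrightarrow> norm (b s (\<gamma> s) - c k s (\<gamma> s)) \<le> \<eta> \<Longrightarrow>
         AE s in lebesgue. s \<in> {0..T} \<longrightarrow> norm (b s (\<gamma> s)) \<le> m s \<Longrightarrow>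
         norm (\<gamma> T - \<Psi> (\<gamma> 0)) \<le> exp (T * L k) * (T * \<eta> + T / N k * L k * (LINT s|lborel. m s))"
    proof -
      show ?thesis by (rule euler_scheme.approximation[OF es[of k]]) (fact that)
    qed
    have err: "norm (\<gamma> T - \<Psi> (\<gamma> 0)) \<le> C1 * (T * C2 + 1) / 4 ^ k" if \<gamma>: "trajectory T b \<gamma>" for \<gamma>
    proof -
      have "norm (\<gamma> T - \<Psi> (\<gamma> 0)) \<le> exp (T * L k) * (T * (C2 / 8 ^ k) + T / N k * L k * M1)"
        unfolding M1_def
      proof (rule ap(8)[OF \<gamma>])
        show "AE s in lebesgue. s \<in> {0..T} \<longrightarrow> norm (b s (\<gamma> s) - c k s (\<gamma> s)) \<le> C2 / 8 ^ k"
          using AE_E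
        proof eventually_elim
          case (elim s)
          have "norm (b s (\<gamma> s) - c k s (\<gamma> s)) \<le> C2 / 8 ^ k" if s: "s \<in> E"
          proof -
            have "norm (mollify (mscale k) (b s) (\<gamma> s) - b s (\<gamma> s)) \<le> C2 / 8 ^ k"
              by (rule C2(2)[OF PE(1)[OF s]])
            then show ?thesis by (simp add: cE[OF s] norm_minus_commute)
          qed
          then show ?case using elim by blast
        qed
        show "AE s in lebesgue. s \<in> {0..T} \<longrightarrow> norm (b s (\<gamma> s)) \<le> m s"
          using AE_E
        proof eventually_elim
          case (elim s)
          have "norm (b s (\<gamma> s)) \<le> norm (b s (\<gamma>0 s)) + norm (b s (\<gamma> s) - b s (\<gamma>0 s))" by norm
          moreover have "norm (b s (\<gamma> s) - b s (\<gamma>0 s)) \<le> C2" if s: "s \<in> E"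
            by (rule C2(3)[OF PE(1)[OF s]])
          ultimately show ?case using elim PE(3)[of s] by auto
        qed
      qed
      also have "\<dots> \<le> (C1 * 2 ^ k) * (T * (C2 / 8 ^ k) + 1 / 8 ^ k)"
      proof (rule mult_mono[OF expL add_left_mono])
        have "T / N k * (8 ^ k * L k * M1) \<le> 1" by (rule Nsmall) (rule terms_le(4))
        then show "T / N k * L k * M1 \<le> 1 / 8 ^ k" by (simp add: field_simps)
        show "0 \<le> T * (C2 / 8 ^ k) + T / N k * L k * M1" using T C2(1) L0[of k] M1 by simp
      qed (use C1k[of k] in simp)
      also have "\<dots> = C1 * (T * C2 + 1) * (2 ^ k / 8 ^ k)" by (simp add: field_simps)
      also have "(2::real) ^ k / 8 ^ k = (1 / 4) ^ k" by (simp add: power_divide[symmetric])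
      also have "\<dots> = 1 / 4 ^ k" by (rule power_one_over)
      finally show ?thesis by simp
    qed
    show ?thesis
      unfolding Q_def
    proof (intro exI[of _ \<Psi>] exI[of _ J] exI[of _ w] conjI allI impI)
      show "(\<integral>\<^sup>+x\<in>cball 0 R. ennreal (w x powr q) \<partial>lborel) \<le> ennreal (exp (2 * T * (D' + 1))) * C"
        if "0 \<le> q" "\<forall>s. (\<integral>\<^sup>+y\<in>cball 0 (R + M1). ennreal (exp (q * T * norm (A k s y))) \<partial>lborel) \<le> C" for R q C
        using ap(7)[folded M1_def, OF that(1) that(2)[rule_format]] .
      show "norm (\<gamma> T - \<Psi> (\<gamma> 0)) \<le> C1 * (T * C2 + 1) / 4 ^ k" if "trajectory T b \<gamma>" for \<gamma>
        by (rule err[OF that])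
    qed (rule ap(1) ap(2) ap(3) ap(4) order_trans[OF ap(5) expL] ap(6))+
  qed
  then obtain \<Psi> J w where "\<And>k. Q k (\<Psi> k) (J k) (w k)" by metis
  note PJW = this[unfolded Q_def]
  have bound: "\<exists>C::real. \<forall>k. (\<integral>\<^sup>+x\<in>cball 0 R. ennreal (w k x powr q) \<partial>lborel) \<le> ennreal C" if q: "q > 0" for R q
  proof -
    obtain C3 where C3: "C3 > 0" "\<And>(f :: real ^ 'n \<Rightarrow> real ^ 'n) k. good_field D' M f \<Longrightarrow>
     (\<integral>\<^sup>+x\<in>cball 0 (R + M1). ennreal (exp ((q * T) * norm (mollify_grad (mscale k) f x))) \<partial>lborel) \<le> ennreal C3"
    proof -
      have "q * T > 0" using q T by simp
      then show ?thesis
        by (rule mollify_grad_exp_integral_bound[where D = D' and M = M and R = "R + M1"]) (fact that)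
    qed
    define v where "v = measure lborel (cball (0 :: real ^ 'n) (R + M1))"
    have v: "emeasure lborel (cball (0 :: real ^ 'n) (R + M1)) = ennreal v"
      unfolding v_def using emeasure_bounded_finite[OF bounded_cball, of "0 :: real ^ 'n" "R + M1"]
      by (intro emeasure_eq_ennreal_measure) auto
    have v0: "0 \<le> v" by (simp add: v_def)
    have "(\<integral>\<^sup>+y\<in>cball 0 (R + M1). ennreal (exp (q * T * norm (A k s y))) \<partial>lborel) \<le> ennreal (C3 + v)" for k s
    proof (cases "s \<in> E")
      case True
      have "(\<integral>\<^sup>+y\<in>cball 0 (R + M1). ennreal (exp (q * T * norm (A k s y))) \<partial>lborel) \<le> ennreal C3"
        unfolding AE'[OF True] by (rule C3(2)[OF PE(1)[OF True]])
      also have "\<dots> \<le> ennreal (C3 + v)" using v0 by (intro ennreal_leI) simp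
      finally show ?thesis .
    next
      case False
      have "(\<integral>\<^sup>+y\<in>cball 0 (R + M1). ennreal (exp (q * T * norm (A k s y))) \<partial>lborel) = ennreal v"
        unfolding A0[OF False] by (simp add: v)
      also have "\<dots> \<le> ennreal (C3 + v)" using C3(1) by (intro ennreal_leI) simp
      finally show ?thesis .
    qed
    then have "(\<integral>\<^sup>+x\<in>cball 0 R. ennreal (w k x powr q) \<partial>lborel) \<le> ennreal (exp (2 * T * (D' + 1))) * ennreal (C3 + v)" for k
      using PJW[of k] q by auto
    also have "ennreal (exp (2 * T * (D' + 1))) * ennreal (C3 + v) = ennreal (exp (2 * T * (D' + 1)) * (C3 + v))"
      using C3(1) v0 by (intro ennreal_mult[symmetric]) auto
    finally show ?thesis by blast
  qed
  show ?thesis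
  proof (rule that[of \<Psi> J w "\<lambda>k. C1 * 2 ^ k" "C1 * (T * C2 + 1)"])
    fix k x i j
    note P = PJW[of k]
    show "(\<Psi> k has_derivative (\<lambda>v. J k x *v v)) (at x)" by (rule P[THEN conjunct1, rule_format])
    show "(\<lambda>x. J k x $ i $ j) \<in> borel_measurable borel"
      by (rule P[THEN conjunct2, THEN conjunct1, rule_format])
    show "\<bar>J k x $ i $ j\<bar> \<le> w k x"
      by (rule P[THEN conjunct2, THEN conjunct2, THEN conjunct1, rule_format])
    show "0 < w k x"
      by (rule P[THEN conjunct2, THEN conjunct2, THEN conjunct2, THEN conjunct1, rule_format])
    show "w k x \<le> C1 * 2 ^ k"
      by (rule P[THEN conjunct2, THEN conjunct2, THEN conjunct2, THEN conjunct2, THEN conjunct1, rule_format])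
    show "w k \<in> borel_measurable borel"
      by (rule P[THEN conjunct2, THEN conjunct2, THEN conjunct2, THEN conjunct2, THEN conjunct2, THEN conjunct1])
    show "norm (\<gamma> T - \<Psi> k (\<gamma> 0)) \<le> C1 * (T * C2 + 1) / 4 ^ k" if "trajectory T b \<gamma>" for \<gamma>
      by (rule P[THEN conjunct2, THEN conjunct2, THEN conjunct2, THEN conjunct2, THEN conjunct2, THEN conjunct2,
            THEN conjunct2, rule_format, OF that])
  qed (rule bound)
qed

section \<open>From the hypotheses to good fields\<close>

lemma loc_integrable_comp':
  fixes f :: "'a::euclidean_space \<Rightarrow> real ^ 'm ^ 'k"
  assumes "loc_integrable f"
  shows "loc_integrable (\<lambda>x. f x $ i)"
proof -
  have "integrable lborel (\<lambda>x. (indicat_real (cball 0 R) x *\<^sub>R f x) $ i)" for R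
    using assms unfolding loc_integrable_def set_integrable_def
    by (intro integrable_bounded_linear[OF bounded_linear_vec_nth]) auto
  then show ?thesis using borel_measurable_nth[OF loc_integrable_measurable[OF assms], of i]
    unfolding loc_integrable_def set_integrable_def by simp
qed

lemma trajectory_restrict:
  assumes "trajectory T b \<gamma>" "t \<le> T"
  shows "trajectory t b \<gamma>"
  unfolding trajectory_def
proof (intro conjI ballI)
  have sub: "{0..t} \<subseteq> {0..T}" using assms(2) by auto
  show "set_integrable lebesgue {0..t} (\<lambda>s. b s (\<gamma> s))"
    by (rule set_integrable_subset[OF conjunct1[OF assms(1)[unfolded trajectory_def]] _ sub]) simp
  show "\<gamma> r = \<gamma> 0 + (LINT s:{0..r}|lebesgue. b s (\<gamma> s))" if "r \<in> {0..t}" for r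
    using that sub by (intro bspec[OF conjunct2[OF assms(1)[unfolded trajectory_def]]]) auto
qed

text \<open>Reversing time turns trajectories of \<open>b\<close> into trajectories of the reversed field, whose endpoint
  map is the inverse of the original one.\<close>

lemma trajectory_reverse:
  fixes b :: "real \<Rightarrow> real ^ 'n \<Rightarrow> real ^ 'n"
  assumes tr: "trajectory T b \<gamma>" and T: "T > 0"
  shows "trajectory T (\<lambda>s x. - b (T - s) x) (\<lambda>s. \<gamma> (T - s))"
proof -
  define f where "f = (\<lambda>s. b s (\<gamma> s))"
  have fi: "set_integrable lebesgue {0..T} f" using tr by (simp add: trajectory_def f_def)
  have \<gamma>: "\<gamma> t = \<gamma> 0 + (LINT s:{0..t}|lebesgue. f s)" if "t \<in> {0..T}" for t
    using tr that unfolding trajectory_def f_def by blast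
  have ind: "indicator {T - t..T} (T + -1 * s) = (indicator {0..t} s :: real)" for s t
    by (auto simp: indicator_def)
  have refl: "(LINT s:{0..t}|lebesgue. f (T - s)) = (LINT s:{T - t..T}|lebesgue. f s)" for t
  proof -
    have e: "(LINT s|lebesgue. indicator {T - t..T} s *\<^sub>R f s)
      = \<bar>-1 :: real\<bar> *\<^sub>R (LINT s|lebesgue. indicator {T - t..T} (T + -1 * s) *\<^sub>R f (T + -1 * s))"
      by (rule lebesgue_integral_real_affine) simp
    have "(LINT s|lebesgue. indicator {T - t..T} (T + -1 * s) *\<^sub>R f (T + -1 * s))
      = (LINT s|lebesgue. indicator {0..t} s *\<^sub>R f (T - s))"
      unfolding ind by simp
    with e have "(LINT s|lebesgue. indicator {T - t..T} s *\<^sub>R f s) = (LINT s|lebesgue. indicator {0..t} s *\<^sub>R f (T - s))"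
      by (simp only: abs_minus_cancel abs_one scaleR_one)
    then show ?thesis unfolding set_lebesgue_integral_def by (rule sym)
  qed
  have "integrable lebesgue (\<lambda>s. indicator {T - T..T} (T + -1 * s) *\<^sub>R f (T + -1 * s))"
    using fi lebesgue_integrable_real_affine_iff[of "-1" "\<lambda>s. indicator {T - T..T} s *\<^sub>R f s" T]
    by (simp add: set_integrable_def)
  then have "set_integrable lebesgue {0..T} (\<lambda>s. f (T - s))"
    unfolding ind set_integrable_def by simp
  then have i: "set_integrable lebesgue {0..T} (\<lambda>s. - f (T - s))"
    unfolding set_integrable_def by simp
  have "\<gamma> (T - t) = \<gamma> T + (LINT s:{0..t}|lebesgue. - f (T - s))" if t: "t \<in> {0..T}" for t
  proof -
    have s1: "set_integrable lebesgue {0..T - t} f" and s2: "set_integrable lebesgue {T - t..T} f"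
      by (rule set_integrable_subset[OF fi]; use t in auto)+
    have "{0..T} = {0..T - t} \<union> {T - t..T}" using t by auto
    then have "(LINT s:{0..T}|lebesgue. f s) = (LINT s:{0..T - t} \<union> {T - t..T}|lebesgue. f s)" by simp
    also have "\<dots> = (LINT s:{0..T - t}|lebesgue. f s) + (LINT s:{T - t..T}|lebesgue. f s)"
    proof (rule set_integral_Un_AE[OF _ _ _ s1 s2])
      have "{T - t} \<in> null_sets lebesgue" using countable_imp_null_set_lborel[of "{T - t}"] null_sets_completionI by auto
      then have "AE s in lebesgue. s \<notin> {T - t}" by (rule AE_not_in)
      then show "AE s in lebesgue. \<not> (s \<in> {0..T - t} \<and> s \<in> {T - t..T})"
        by eventually_elim auto
    qed auto
    finally have "\<gamma> T = \<gamma> (T - t) + (LINT s:{T - t..T}|lebesgue. f s)"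
      using \<gamma>[of T] \<gamma>[of "T - t"] t T by (simp add: add.assoc)
    moreover have "(LINT s:{0..t}|lebesgue. - f (T - s)) = - (LINT s:{T - t..T}|lebesgue. f s)"
    proof -
      have "(LINT s:{0..t}|lebesgue. - f (T - s)) = - (LINT s:{0..t}|lebesgue. f (T - s))"
        unfolding set_lebesgue_integral_def by simp
      then show ?thesis by (simp only: refl)
    qed
    ultimately show ?thesis by simp
  qed
  then show ?thesis using i unfolding trajectory_def f_def by simp
qed

lemma good_field_uminus:
  assumes "good_field D M f" shows "good_field D M (\<lambda>x. - f x)"
proof -
  obtain H where H: "loc_integrable H"
    "\<And>\<phi> i j. test_function \<phi> \<Longrightarrow>
      (LINT x|lborel. f x $ i * partial_deriv j \<phi> x) = - (LINT x|lborel. H x $ i $ j * \<phi> x)"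
    "\<And>\<beta> k. \<beta> > 0 \<Longrightarrow> (\<forall>i. k $ i \<in> \<int>) \<Longrightarrow>
      (\<integral>\<^sup>+x\<in>unit_cell. ennreal (exp (\<beta> * norm (H (x + k)))) \<partial>lborel) \<le> ennreal (M \<beta>)"
    "AE x in lborel. \<bar>trace (H x)\<bar> \<le> D"
    using assms unfolding good_field_def by blast
  show ?thesis unfolding good_field_def
  proof (intro conjI exI[of _ "\<lambda>x. - H x"])
    show "periodic (\<lambda>x. - f x)" "continuous_on UNIV (\<lambda>x. - f x)"
      using assms by (auto simp: good_field_def periodic_def intro: continuous_on_minus)
    show "loc_integrable (\<lambda>x. - H x)" by (rule loc_integrable_minus[OF H(1)])
    show "AE x in lborel. \<bar>trace (- H x)\<bar> \<le> D"
      using H(4) by eventually_elim (simp add: trace_def sum_negf)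
  qed (use H in auto)
qed

lemma AE_reflect:
  fixes P :: "'a::euclidean_space \<Rightarrow> bool"
  assumes "AE s in lborel. P s" shows "AE s in lborel. P (t - s)"
proof (rule AE_distrD[of "\<lambda>s. t - s" lborel borel])
  show "AE s in distr lborel borel (\<lambda>s. t - s). P s" unfolding lborel_distr_reflect by (rule assms)
qed simp

lemma AE_translate:
  fixes P :: "'a::euclidean_space \<Rightarrow> bool"
  assumes "AE s in lborel. P s" shows "AE s in lborel. P (t + s)"
proof (rule AE_distrD[of "\<lambda>s. t + s" lborel borel])
  show "AE s in distr lborel borel (\<lambda>s. t + s). P s" unfolding lborel_distr_plus by (rule assms)
qed simp

lemma Ck_translate: "Ck m \<phi> \<Longrightarrow> Ck m (\<lambda>y. \<phi> (y - k))"
  and partial_deriv_translate: "test_function \<phi> \<Longrightarrow> partial_deriv j (\<lambda>y. \<phi> (y - k)) y = partial_deriv j \<phi> (y - k)"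
proof -
  have pd: "(\<lambda>y. \<phi> (y - k)) differentiable (at y) \<and> partial_deriv j (\<lambda>y. \<phi> (y - k)) y = partial_deriv j \<phi> (y - k)"
    if "\<phi> differentiable (at (y - k))" for \<phi> :: "real ^ 'x \<Rightarrow> real" and j k y
  proof -
    have fd: "(\<phi> has_derivative frechet_derivative \<phi> (at (y - k))) (at (y - k))"
      using that frechet_derivative_works by blast
    have d: "((\<lambda>y. \<phi> (y - k)) has_derivative frechet_derivative \<phi> (at (y - k))) (at y)"
      by (rule has_derivative_compose[of "\<lambda>y. y - k" "\<lambda>v. v", OF _ fd]) (auto intro!: derivative_eq_intros)
    then show ?thesis using partial_deriv_eq[OF d, of j] by (auto simp: partial_deriv_def differentiable_def)
  qed
  show "Ck m \<phi> \<Longrightarrow> Ck m (\<lambda>y. \<phi> (y - k))"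
  proof (induction m arbitrary: \<phi>)
    case 0
    then show ?case by (auto intro!: continuous_on_compose2[of UNIV \<phi>] continuous_intros)
  next
    case (Suc m)
    have "partial_deriv j (\<lambda>y. \<phi> (y - k)) = (\<lambda>y. partial_deriv j \<phi> (y - k))" for j
    proof
      fix y
      have "\<phi> differentiable (at (y - k))" using Suc.prems by (simp add: differentiable_on_def)
      from pd[OF this] show "partial_deriv j (\<lambda>y. \<phi> (y - k)) y = partial_deriv j \<phi> (y - k)" by blast
    qed
    moreover have "(\<lambda>y. \<phi> (y - k)) differentiable (at y)" for y
    proof -
      have "\<phi> differentiable (at (y - k))" using Suc.prems by (simp add: differentiable_on_def)
      from pd[OF this] show ?thesis by blast
    qed
    ultimately show ?case using Suc by (auto simp: differentiable_on_def)
  qed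
  show "test_function \<phi> \<Longrightarrow> partial_deriv j (\<lambda>y. \<phi> (y - k)) y = partial_deriv j \<phi> (y - k)"
    using pd test_function_differentiable by blast
qed

lemma test_function_translate:
  assumes "test_function \<phi>" shows "test_function (\<lambda>y. \<phi> (y - k))"
  unfolding test_function_def
proof (intro conjI allI)
  show "Ck m (\<lambda>y. \<phi> (y - k))" for m using assms Ck_translate unfolding test_function_def by blast
  obtain R where R: "\<And>x. x \<notin> cball 0 R \<Longrightarrow> \<phi> x = 0" using test_function_support_bounded[OF assms] by metis
  have "{x. \<phi> (x - k) \<noteq> 0} \<subseteq> cball k R"
  proof
    fix x assume "x \<in> {x. \<phi> (x - k) \<noteq> 0}"
    then have "x - k \<in> cball 0 R" using R by blast
    then show "x \<in> cball k R" by (simp add: dist_norm norm_minus_commute)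
  qed
  then show "compact (closure {x. \<phi> (x - k) \<noteq> 0})" using bounded_subset[OF bounded_cball] by auto
qed

lemma ex_borel_version:
  fixes F :: "'a \<Rightarrow> 'b::euclidean_space"
  assumes F: "F \<in> borel_measurable (completion M)"
  shows "\<exists>G\<in>borel_measurable M. AE x in M. F x = G x"
proof -
  have "\<exists>g\<in>borel_measurable M. AE x in M. F x \<bullet> e = g x" if "e \<in> Basis" for e
    using F by (intro completion_ex_borel_measurable_real) simp
  then obtain g where g: "\<And>e. e \<in> Basis \<Longrightarrow> g e \<in> borel_measurable M"
    "\<And>e. e \<in> Basis \<Longrightarrow> AE x in M. F x \<bullet> e = g e x" by metis
  have "AE x in M. \<forall>e\<in>Basis. F x \<bullet> e = g e x" using g(2) by (intro AE_finite_allI) auto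
  then have "AE x in M. F x = (\<Sum>e\<in>Basis. g e x *\<^sub>R e)"
    by eventually_elim (metis (no_types, lifting) euclidean_representation sum.cong)
  moreover have "(\<lambda>x. \<Sum>e\<in>Basis. g e x *\<^sub>R e) \<in> borel_measurable M"
    using g(1) by (intro borel_measurable_sum borel_measurable_scaleR) auto
  ultimately show ?thesis by (rule bexI[where x = "\<lambda>x. \<Sum>e\<in>Basis. g e x *\<^sub>R e"])
qed

lemma locally_integrable_borel_version:
  fixes F :: "real ^ 'n \<Rightarrow> 'b::euclidean_space"
  assumes F: "locally_integrable F"
  obtains G where "loc_integrable G" "AE x in lborel. F x = G x"
proof -
  have int: "integrable lebesgue (\<lambda>x. indicator (cball 0 R) x *\<^sub>R F x)" for R
    using F unfolding locally_integrable_def set_integrable_def by auto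
  have "F \<in> borel_measurable lebesgue"
  proof (rule borel_measurable_LIMSEQ_metric)
    show "(\<lambda>x. indicator (cball 0 (real n)) x *\<^sub>R F x) \<in> borel_measurable lebesgue" for n :: nat
      using int borel_measurable_integrable by blast
    show "(\<lambda>n. indicator (cball 0 (real n)) x *\<^sub>R F x) \<longlonglongrightarrow> F x" for x
    proof -
      obtain n0 :: nat where "norm x \<le> real n0" using real_arch_simple by blast
      then have "\<forall>\<^sub>F n in sequentially. indicator (cball 0 (real n)) x *\<^sub>R F x = F x"
        unfolding eventually_sequentially by (intro exI[of _ n0]) auto
      then show ?thesis by (rule tendsto_eventually)
    qed
  qed
  then obtain G where G: "G \<in> borel_measurable lborel" "AE x in lborel. F x = G x"
    using ex_borel_version[of F lborel] by blast
  have "loc_integrable G"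
    unfolding loc_integrable_def set_integrable_def
  proof (intro conjI allI)
    show "G \<in> borel_measurable borel" using G(1) by simp
    fix R
    have [measurable]: "G \<in> borel_measurable borel" "cball (0 :: real ^ 'n) R \<in> sets borel" using G(1) by simp_all
    have m: "(\<lambda>x. indicat_real (cball 0 R) x *\<^sub>R G x) \<in> borel_measurable lborel" by measurable
    have "integrable lebesgue (\<lambda>x. indicat_real (cball 0 R) x *\<^sub>R G x)"
    proof (rule integrable_cong_AE_imp[OF int[of R]])
      show "(\<lambda>x. indicat_real (cball 0 R) x *\<^sub>R G x) \<in> borel_measurable lebesgue" using m by (rule measurable_completion)
      show "AE x in lebesgue. indicat_real (cball 0 R) x *\<^sub>R F x = indicat_real (cball 0 R) x *\<^sub>R G x"
        using AE_completion[OF G(2)] by eventually_elim simp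
    qed
    then show "integrable lborel (\<lambda>x. indicat_real (cball 0 R) x *\<^sub>R G x)"
      using integrable_completion[OF m] by simp
  qed
  then show ?thesis using G(2) by (rule that)
qed

lemma integral_lebesgue_eq_lborel:
  fixes F G :: "real ^ 'n \<Rightarrow> real"
  assumes F: "AE x in lborel. F x = G x" and G: "G \<in> borel_measurable borel"
  shows "(LINT x|lebesgue. F x) = (LINT x|lborel. G x)"
proof -
  have F': "AE x in lebesgue. F x = G x" using F by (rule AE_completion)
  have Gm: "G \<in> borel_measurable lebesgue" using G by (intro measurable_completion) simp
  have Fm: "F \<in> borel_measurable lebesgue"
    by (rule borel_measurable_AE[OF Gm]) (use F' in \<open>auto elim!: eventually_mono\<close>)
  have "(LINT x|lebesgue. F x) = (LINT x|lebesgue. G x)"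
    by (rule integral_cong_AE[OF Fm Gm F'])
  also have "\<dots> = (LINT x|lborel. G x)" using G by (intro integral_completion) simp
  finally show ?thesis .
qed

text \<open>Weak derivatives are unique by the lemma of du Bois-Reymond. Applied to translates by integer
  vectors this shows that the weak gradient of a periodic function is periodic almost everywhere,
  although it is only assumed to be locally integrable; applied to the trace it identifies the
  weak divergence with the trace. Hence bounds on one cell hold on all its translates.\<close>

lemma good_field_of_hypotheses:
  fixes f :: "real ^ 'n \<Rightarrow> real ^ 'n" and Df :: "real ^ 'n \<Rightarrow> real ^ 'n ^ 'n" and divf :: "real ^ 'n \<Rightarrow> real"
  assumes per: "periodic f" and cont: "continuous_on UNIV f"
    and wg: "weak_gradient f Df"
    and ex: "\<And>\<beta>. \<beta> > 0 \<Longrightarrow> (\<integral>\<^sup>+x\<in>unit_cell. ennreal (exp (\<beta> * norm (Df x))) \<partial>lebesgue) \<le> ennreal (M \<beta>)"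
    and wd: "weak_divergence f divf"
    and bd: "AE x in lborel. x \<in> unit_cell \<longrightarrow> \<bar>divf x\<bar> \<le> D"
  shows "good_field D M f"
proof -
  obtain H where H: "loc_integrable H" and HD: "AE x in lborel. Df x = H x"
    using locally_integrable_borel_version[of Df] wg unfolding weak_gradient_def by blast
  obtain d where d: "loc_integrable d" and dd: "AE x in lborel. divf x = d x"
    using locally_integrable_borel_version[of divf] wd unfolding weak_divergence_def by blast
  note [measurable] = loc_integrable_measurable[OF H] loc_integrable_measurable[OF d]
  have [measurable]: "(\<lambda>x. f x $ i) \<in> borel_measurable borel" for i
    by (intro borel_measurable_continuous_onI continuous_intros cont)
  have Hij: "loc_integrable (\<lambda>x. H x $ i $ j)" for i j
    by (rule loc_integrable_comp[OF loc_integrable_comp'[OF H]])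
  note [measurable] = loc_integrable_measurable[OF Hij]
  have fi: "loc_integrable (\<lambda>x. f x $ i)" for i
    by (intro continuous_loc_integrable continuous_intros cont)
  have times: "integrable lborel (\<lambda>x. F x * \<phi> x)" "integrable lborel (\<lambda>x. F x * partial_deriv j \<phi> x)"
    and meas: "\<phi> \<in> borel_measurable borel" "partial_deriv j \<phi> \<in> borel_measurable borel"
    if F: "loc_integrable F" and phi: "test_function \<phi>" for F \<phi> :: "real ^ 'n \<Rightarrow> real" and j
  proof -
    obtain R where R: "\<And>x. x \<notin> cball 0 R \<Longrightarrow> \<phi> x = 0" "\<And>x j. x \<notin> cball 0 R \<Longrightarrow> partial_deriv j \<phi> x = 0"
      using test_function_support_bounded[OF phi] by metis
    obtain B where B: "\<And>x. \<bar>\<phi> x\<bar> \<le> B" "\<And>x j. \<bar>partial_deriv j \<phi> x\<bar> \<le> B"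
      using test_function_bounded[OF phi] by metis
    show m: "\<phi> \<in> borel_measurable borel" "partial_deriv j \<phi> \<in> borel_measurable borel"
      by (intro borel_measurable_continuous_onI test_function_continuous test_function_partial_continuous phi)+
    show "integrable lborel (\<lambda>x. F x * \<phi> x)" "integrable lborel (\<lambda>x. F x * partial_deriv j \<phi> x)"
      using loc_integrable_times_bounded[OF F m(1) B(1) R(1)] loc_integrable_times_bounded[OF F m(2) B(2) R(2)]
      by (simp_all add: mult.commute)
  qed
  have weak: "(LINT x|lborel. f x $ i * partial_deriv j \<phi> x) = - (LINT x|lborel. H x $ i $ j * \<phi> x)"
    if phi: "test_function \<phi>" for \<phi> i j
  proof -
    note [measurable] = meas[OF fi phi]
    have "(LINT x|lebesgue. f x $ i * partial_deriv j \<phi> x) = (LINT x|lborel. f x $ i * partial_deriv j \<phi> x)"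
      by (rule integral_lebesgue_eq_lborel) simp_all
    moreover have "(LINT x|lebesgue. Df x $ i $ j * \<phi> x) = (LINT x|lborel. H x $ i $ j * \<phi> x)"
      by (rule integral_lebesgue_eq_lborel) (use HD in \<open>auto elim!: eventually_mono\<close>)
    moreover have "(LINT x|lebesgue. f x $ i * partial_deriv j \<phi> x) = - (LINT x|lebesgue. Df x $ i $ j * \<phi> x)"
      using wg phi unfolding weak_gradient_def by blast
    ultimately show ?thesis by (simp only:)
  qed
  have perk: "AE x in lborel. H (x + k) = H x" if k: "\<forall>i. k $ i \<in> \<int>" for k
  proof -
    have "AE x in lborel. H (x + k) $ i $ j - H x $ i $ j = 0" for i j
    proof (rule du_bois_reymond)
      have "loc_integrable (\<lambda>x. H (x + k) $ i $ j)"
        unfolding loc_integrable_def set_integrable_def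
      proof (intro conjI allI)
        show "(\<lambda>x. H (x + k) $ i $ j) \<in> borel_measurable borel" by measurable
        fix R
        have [measurable]: "cball k R \<in> sets borel" by simp
        have "integrable lborel (\<lambda>y. indicat_real (cball k R) y *\<^sub>R H y $ i $ j)"
        proof (rule loc_integrable_times_bounded[OF Hij, of _ 1 "norm k + R"])
          fix y :: "real ^ 'n" assume "y \<notin> cball 0 (norm k + R)"
          then have "y \<notin> cball k R" using norm_triangle_sub[of y k] by (auto simp: dist_norm norm_minus_commute)
          then show "indicat_real (cball k R) y = 0" by simp
        qed (auto simp: indicator_def)
        then have "integrable (distr lborel borel (\<lambda>x. k + x)) (\<lambda>y. indicat_real (cball k R) y *\<^sub>R H y $ i $ j)"
          by (simp add: lborel_distr_plus)
        then have "integrable lborel (\<lambda>x. indicat_real (cball k R) (k + x) *\<^sub>R H (k + x) $ i $ j)"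
          by (subst (asm) integrable_distr_eq) auto
        moreover have "indicat_real (cball k R) (k + x) = indicat_real (cball 0 R) x" for x
          by (simp add: indicator_def dist_norm)
        ultimately show "integrable lborel (\<lambda>x. indicat_real (cball 0 R) x *\<^sub>R H (x + k) $ i $ j)"
          by (simp add: add.commute)
      qed
      then show "loc_integrable (\<lambda>x. H (x + k) $ i $ j - H x $ i $ j)"
        using Hij[of i j] unfolding loc_integrable_def set_integrable_def by (auto simp: right_diff_distrib)
      fix \<phi> :: "real ^ 'n \<Rightarrow> real" assume phi: "test_function \<phi>"
      note [measurable] = meas[OF fi phi]
      have "(LINT x|lborel. H (x + k) $ i $ j * \<phi> x) = (LINT y|lborel. H y $ i $ j * \<phi> (y - k))"
        using integral_lborel_shift[of "\<lambda>y. H y $ i $ j * \<phi> (y - k)" k] by (simp add: add.commute)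
      also have "\<dots> = - (LINT y|lborel. f y $ i * partial_deriv j (\<lambda>y. \<phi> (y - k)) y)"
        using weak[OF test_function_translate[OF phi]] by simp
      also have "\<dots> = - (LINT y|lborel. f y $ i * partial_deriv j \<phi> (y - k))"
        by (simp add: partial_deriv_translate[OF phi])
      also have "(LINT y|lborel. f y $ i * partial_deriv j \<phi> (y - k)) = (LINT x|lborel. f (x + k) $ i * partial_deriv j \<phi> x)"
        using integral_lborel_shift[of "\<lambda>y. f y $ i * partial_deriv j \<phi> (y - k)" k] by (simp add: add.commute)
      also have "\<dots> = (LINT x|lborel. f x $ i * partial_deriv j \<phi> x)"
        using per k by (simp add: periodic_def)
      also have "- \<dots> = (LINT x|lborel. H x $ i $ j * \<phi> x)" by (simp add: weak[OF phi])
      finally have e: "(LINT x|lborel. H (x + k) $ i $ j * \<phi> x) = (LINT x|lborel. H x $ i $ j * \<phi> x)" .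
      show "(LINT x|lborel. (H (x + k) $ i $ j - H x $ i $ j) * \<phi> x) = 0"
        unfolding left_diff_distrib
        using e times(1)[OF \<open>loc_integrable (\<lambda>x. H (x + k) $ i $ j)\<close> phi] times(1)[OF Hij phi] by simp
    qed
    then have "AE x in lborel. \<forall>i j. H (x + k) $ i $ j - H x $ i $ j = 0" by (simp add: AE_all_countable)
    then show ?thesis by eventually_elim (simp add: vec_eq_iff)
  qed
  have trd: "AE x in lborel. trace (H x) - d x = 0"
  proof (rule du_bois_reymond)
    have trm: "(\<lambda>x. trace (H x)) \<in> borel_measurable borel" unfolding trace_def by measurable
    have "loc_integrable (\<lambda>x. trace (H x))"
      unfolding loc_integrable_def set_integrable_def
    proof (intro conjI allI trm)
      fix R
      have "integrable lborel (\<lambda>x. trace (indicat_real (cball 0 R) x *\<^sub>R H x))"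
        using H unfolding loc_integrable_def set_integrable_def
        by (intro integrable_bounded_linear[OF trace_bounded_linear]) auto
      then show "integrable lborel (\<lambda>x. indicat_real (cball 0 R) x *\<^sub>R trace (H x))"
        by (simp add: trace_def sum_distrib_left)
    qed
    then show trl: "loc_integrable (\<lambda>x. trace (H x) - d x)"
      using d unfolding loc_integrable_def set_integrable_def by (auto simp: right_diff_distrib)
    fix \<phi> :: "real ^ 'n \<Rightarrow> real" assume phi: "test_function \<phi>"
    note [measurable] = meas[OF fi phi]
    have "(LINT x|lebesgue. f x \<bullet> (\<chi> j. partial_deriv j \<phi> x)) = (LINT x|lborel. (\<Sum>i\<in>UNIV. f x $ i * partial_deriv i \<phi> x))"
      by (rule integral_lebesgue_eq_lborel) (simp_all add: inner_vec_def)
    also have "\<dots> = (\<Sum>i\<in>UNIV. LINT x|lborel. f x $ i * partial_deriv i \<phi> x)"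
      by (rule Bochner_Integration.integral_sum) (rule times(2)[OF fi phi])
    also have "\<dots> = - (\<Sum>i\<in>UNIV. LINT x|lborel. H x $ i $ i * \<phi> x)"
      using weak[OF phi] by (simp add: sum_negf)
    also have "(\<Sum>i\<in>UNIV. LINT x|lborel. H x $ i $ i * \<phi> x) = (LINT x|lborel. trace (H x) * \<phi> x)"
      unfolding trace_def sum_distrib_right
      by (rule Bochner_Integration.integral_sum[symmetric]) (rule times(1)[OF Hij phi])
    finally have "(LINT x|lebesgue. f x \<bullet> (\<chi> j. partial_deriv j \<phi> x)) = - (LINT x|lborel. trace (H x) * \<phi> x)" .
    moreover have "(LINT x|lebesgue. divf x * \<phi> x) = (LINT x|lborel. d x * \<phi> x)"
      by (rule integral_lebesgue_eq_lborel) (use dd in \<open>auto elim!: eventually_mono\<close>)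
    moreover have "(LINT x|lebesgue. f x \<bullet> (\<chi> j. partial_deriv j \<phi> x)) = - (LINT x|lebesgue. divf x * \<phi> x)"
      using wd phi unfolding weak_divergence_def by blast
    ultimately have "(LINT x|lborel. trace (H x) * \<phi> x) = (LINT x|lborel. d x * \<phi> x)"
      by (simp only: neg_equal_iff_equal)
    then show "(LINT x|lborel. (trace (H x) - d x) * \<phi> x) = 0"
      unfolding left_diff_distrib
      using times(1)[OF \<open>loc_integrable (\<lambda>x. trace (H x))\<close> phi] times(1)[OF d phi] by simp
  qed
  \<comment> \<open>A countable union of null sets: the translates of the bad points by integer vectors.\<close>
  define Z where "Z = {k :: real ^ 'n. \<forall>i. k $ i \<in> \<int>}"
  have Zc: "countable Z" unfolding Z_def by (rule countable_vector) (simp add: Ints_def)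
  have perZ: "AE x in lborel. \<forall>k\<in>Z. H (x + k) = H x"
    using perk by (intro AE_ball_countable[THEN iffD2] Zc ballI) (auto simp: Z_def)
  have "AE x in lborel. (x \<in> unit_cell \<longrightarrow> \<bar>trace (H x)\<bar> \<le> D) \<and> (\<forall>k\<in>Z. H (x + k) = H x)"
    using trd dd bd perZ by eventually_elim auto
  then have "AE x in lborel. ((- m + x) \<in> unit_cell \<longrightarrow> \<bar>trace (H (- m + x))\<bar> \<le> D) \<and> (\<forall>k\<in>Z. H ((- m + x) + k) = H (- m + x))" for m
    by (rule AE_translate)
  then have "AE x in lborel. \<forall>m\<in>Z. ((- m + x) \<in> unit_cell \<longrightarrow> \<bar>trace (H (- m + x))\<bar> \<le> D) \<and> (\<forall>k\<in>Z. H ((- m + x) + k) = H (- m + x))"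
    by (intro AE_ball_countable[THEN iffD2] Zc ballI)
  then have trD: "AE x in lborel. \<bar>trace (H x)\<bar> \<le> D"
  proof eventually_elim
    case (elim x)
    define m :: "real ^ 'n" where "m = (\<chi> i. of_int \<lfloor>x $ i\<rfloor>)"
    have m: "m \<in> Z" by (simp add: Z_def m_def)
    have "- m + x \<in> unit_cell"
      unfolding unit_cell_def mem_box_cart
    proof
      fix i
      have "(- m + x) $ i = frac (x $ i)" by (simp add: m_def frac_def)
      then show "0 $ i \<le> (- m + x) $ i \<and> (- m + x) $ i \<le> 1 $ i" using frac_lt_1[of "x $ i"] by simp
    qed
    then have "\<bar>trace (H (- m + x))\<bar> \<le> D" "H ((- m + x) + m) = H (- m + x)" using elim m by blast+
    then show ?case by simp
  qed
  have "(\<integral>\<^sup>+x\<in>unit_cell. ennreal (exp (\<beta> * norm (H (x + k)))) \<partial>lborel) \<le> ennreal (M \<beta>)"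
    if b: "\<beta> > 0" and k: "\<forall>i. k $ i \<in> \<int>" for \<beta> k
  proof -
    have "(\<integral>\<^sup>+x\<in>unit_cell. ennreal (exp (\<beta> * norm (H (x + k)))) \<partial>lborel)
      = (\<integral>\<^sup>+x\<in>unit_cell. ennreal (exp (\<beta> * norm (Df x))) \<partial>lborel)"
    proof (rule nn_integral_cong_AE)
      show "AE x in lborel. ennreal (exp (\<beta> * norm (H (x + k)))) * indicator unit_cell x = ennreal (exp (\<beta> * norm (Df x))) * indicator unit_cell x"
        using perk[OF k] HD by eventually_elim simp
    qed
    also have "\<dots> = (\<integral>\<^sup>+x\<in>unit_cell. ennreal (exp (\<beta> * norm (Df x))) \<partial>lebesgue)"
      by (simp add: nn_integral_completion)
    also have "\<dots> \<le> ennreal (M \<beta>)" by (rule ex[OF b])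
    finally show ?thesis .
  qed
  then show ?thesis unfolding good_field_def using per cont H weak trD by blast
qed

section \<open>Sobolev regularity of the endpoint map\<close>

lemma loc_integrable_bounded:
  fixes f :: "'a::euclidean_space \<Rightarrow> real"
  assumes [measurable]: "f \<in> borel_measurable borel" and K: "\<And>x. \<bar>f x\<bar> \<le> K"
  shows "loc_integrable f"
  unfolding loc_integrable_def set_integrable_def
proof (intro conjI allI)
  fix R
  have "integrable lborel (\<lambda>x :: 'a. K * indicator (cball 0 R) x :: real)"
    using emeasure_bounded_finite[OF bounded_cball, of "0 :: 'a" R]
    by (intro integrable_mult_right integrable_real_indicator) auto
  then show "integrable lborel (\<lambda>x. indicat_real (cball 0 R) x *\<^sub>R f x)"
    by (rule Bochner_Integration.integrable_bound)
       (use K in \<open>auto simp: indicator_def intro: order_trans[OF _ abs_ge_self]\<close>)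
qed simp

lemma norm_matrix_le_entries:
  fixes A :: "real ^ 'n ^ 'm"
  assumes "\<And>i j. \<bar>A $ i $ j\<bar> \<le> w"
  shows "norm A \<le> (real CARD('m) * real CARD('n)) * w"
proof -
  have "norm A = L2_set (\<lambda>i. norm (A $ i)) UNIV" by (simp add: norm_vec_def)
  also have "\<dots> \<le> (\<Sum>i\<in>UNIV. norm (A $ i))" by (rule L2_set_le_sum) simp
  also have "\<dots> \<le> (\<Sum>i\<in>(UNIV :: 'm set). \<Sum>j\<in>(UNIV :: 'n set). w)"
    using assms by (intro sum_mono order_trans[OF norm_le_l1_cart]) auto
  finally show ?thesis by simp
qed

text \<open>The approximations converge uniformly to \<open>S\<close>; this gives continuity, and also uniqueness of
  trajectories, because the approximations depend on the starting point only. Convex combinations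
  of their derivatives converge locally in \<open>L1\<close> and almost everywhere to some \<open>G\<close>, the same
  combinations of the maps still converge uniformly to \<open>S\<close>, and integration by parts passes to the
  limit. The bound for the power \<open>q\<close> follows from convexity and Fatou's lemma. Any map \<open>S\<close> that
  selects endpoints of trajectories is admitted, so that the statement also applies to inverses.\<close>

lemma flow_endpoint:
  fixes b :: "real \<Rightarrow> real ^ 'n \<Rightarrow> real ^ 'n" and g :: "real \<Rightarrow> real ^ 'n \<Rightarrow> real ^ 'n"
    and S :: "real ^ 'n \<Rightarrow> real ^ 'n"
  assumes T: "T > 0"
    and gm: "(\<lambda>(s, x). g s x) \<in> borel_measurable (borel \<Otimes>\<^sub>M borel)"
    and bg: "AE s in lborel. s \<in> {0..T} \<longrightarrow> (AE x in lborel. b s x = g s x)"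
    and good: "AE s in lborel. s \<in> {0..T} \<longrightarrow> good_field D M (b s)"
    and S: "\<And>x. \<exists>\<gamma>. trajectory T b \<gamma> \<and> \<gamma> 0 = x \<and> \<gamma> T = S x"
  obtains G :: "real ^ 'n \<Rightarrow> real ^ 'n ^ 'n" where
    "continuous_on UNIV S" "\<And>\<gamma>. trajectory T b \<gamma> \<Longrightarrow> \<gamma> T = S (\<gamma> 0)"
    "loc_integrable G"
    "\<And>q R. q \<ge> 1 \<Longrightarrow> (\<integral>\<^sup>+x\<in>cball 0 R. ennreal (norm (G x) powr q) \<partial>lborel) < \<infinity>"
    "\<And>\<phi> i j. test_function \<phi> \<Longrightarrow>
      (LINT x|lborel. S x $ i * partial_deriv j \<phi> x) = - (LINT x|lborel. G x $ i $ j * \<phi> x)"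
proof -
  obtain \<gamma>0 where \<gamma>0: "trajectory T b \<gamma>0" using S by blast
  obtain \<Psi> :: "nat \<Rightarrow> real ^ 'n \<Rightarrow> real ^ 'n" and J :: "nat \<Rightarrow> real ^ 'n \<Rightarrow> real ^ 'n ^ 'n"
    and w :: "nat \<Rightarrow> real ^ 'n \<Rightarrow> real" and K :: "nat \<Rightarrow> real" and C :: real where
    der: "\<And>k x. (\<Psi> k has_derivative (\<lambda>v. J k x *v v)) (at x)" and
    Jm [measurable]: "\<And>k i j. (\<lambda>x. J k x $ i $ j) \<in> borel_measurable borel" and
    Jw: "\<And>k x i j. \<bar>J k x $ i $ j\<bar> \<le> w k x" and
    wpos: "\<And>k x. 0 < w k x" and wK: "\<And>k x. w k x \<le> K k" and wm [measurable]: "\<And>k. w k \<in> borel_measurable borel" and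
    wq: "\<And>R q. q > 0 \<Longrightarrow> \<exists>C::real. \<forall>k. (\<integral>\<^sup>+x\<in>cball 0 R. ennreal (w k x powr q) \<partial>lborel) \<le> ennreal C" and
    err: "\<And>k \<gamma>. trajectory T b \<gamma> \<Longrightarrow> norm (\<gamma> T - \<Psi> k (\<gamma> 0)) \<le> C / 4 ^ k"
  proof -
    show ?thesis by (rule flow_approximations[OF T gm bg good \<gamma>0]) (fact that)
  qed
  have near: "norm (\<Psi> k x - S x) \<le> C / 4 ^ k" for k x
  proof -
    obtain \<gamma> where "trajectory T b \<gamma>" "\<gamma> 0 = x" "\<gamma> T = S x" using S by blast
    then show ?thesis using err[of \<gamma> k] by (simp add: norm_minus_commute)
  qed
  have lim0: "(\<lambda>k. C / 4 ^ k) \<longlonglongrightarrow> 0"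
  proof -
    have "(\<lambda>k. C * (1 / 4) ^ k) \<longlonglongrightarrow> C * 0" by (intro tendsto_mult tendsto_const LIMSEQ_power_zero) simp
    moreover have "C * (1 / 4) ^ k = C / 4 ^ k" for k :: nat unfolding power_one_over by simp
    ultimately show ?thesis by simp
  qed
  have uniq: "\<gamma> T = S (\<gamma> 0)" if \<gamma>: "trajectory T b \<gamma>" for \<gamma>
  proof -
    have "(\<lambda>k. \<Psi> k (\<gamma> 0)) \<longlonglongrightarrow> S (\<gamma> 0)"
      by (rule LIM_zero_cancel, rule Lim_null_comparison[OF _ lim0]) (simp add: near)
    moreover have "(\<lambda>k. \<Psi> k (\<gamma> 0)) \<longlonglongrightarrow> \<gamma> T"
    proof (rule LIM_zero_cancel, rule Lim_null_comparison[OF _ lim0])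
      have "norm (\<Psi> k (\<gamma> 0) - \<gamma> T) \<le> C / 4 ^ k" for k
        using err[OF \<gamma>, of k] by (simp only: norm_minus_commute)
      then show "\<forall>\<^sub>F k in sequentially. norm (\<Psi> k (\<gamma> 0) - \<gamma> T) \<le> C / 4 ^ k" by simp
    qed
    ultimately show ?thesis using LIMSEQ_unique by blast
  qed
  have cont\<Psi>: "continuous_on UNIV (\<Psi> k)" for k
    by (rule continuous_at_imp_continuous_on) (use has_derivative_continuous[OF der] in blast)
  have contS: "continuous_on UNIV S"
  proof (rule uniform_limit_theorem[where F = sequentially and f = \<Psi>])
    show "uniform_limit UNIV \<Psi> S sequentially"
    proof (rule uniform_limitI)
      fix e :: real assume "e > 0"
      then have "\<forall>\<^sub>F k in sequentially. C / 4 ^ k < e" using lim0 order_tendstoD(2) by blast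
      then show "\<forall>\<^sub>F k in sequentially. \<forall>x\<in>UNIV. dist (\<Psi> k x) (S x) < e"
        by eventually_elim (use near in \<open>auto simp: dist_norm intro: order_le_less_trans\<close>)
    qed
  qed (use cont\<Psi> in auto)
  define n2 where "n2 = real CARD('n) * real CARD('n)"
  have n2: "n2 > 0" by (simp add: n2_def)
  have normJ: "norm (J k x) \<le> n2 * w k x" for k x
    unfolding n2_def by (rule norm_matrix_le_entries) (rule Jw)
  have Jmm [measurable]: "J k \<in> borel_measurable borel" for k by (rule borel_measurable_matrix) (rule Jm)
  have sq: "\<exists>C::real. \<forall>k. (\<integral>\<^sup>+x\<in>cball 0 R. ennreal ((norm (J k x))\<^sup>2) \<partial>lborel) \<le> ennreal C" for R
  proof -
    obtain C where C: "\<And>k. (\<integral>\<^sup>+x\<in>cball 0 R. ennreal (w k x powr 2) \<partial>lborel) \<le> ennreal C" using wq[of 2 R] by auto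
    have [measurable]: "cball (0 :: real ^ 'n) R \<in> sets borel" by simp
    have "(\<integral>\<^sup>+x\<in>cball 0 R. ennreal ((norm (J k x))\<^sup>2) \<partial>lborel) \<le> ennreal (n2\<^sup>2 * C)" for k
    proof -
      have "(\<integral>\<^sup>+x\<in>cball 0 R. ennreal ((norm (J k x))\<^sup>2) \<partial>lborel)
        \<le> (\<integral>\<^sup>+x. ennreal (n2\<^sup>2) * (ennreal (w k x powr 2) * indicator (cball 0 R) x) \<partial>lborel)"
      proof (rule nn_integral_mono)
        fix x
        have "(norm (J k x))\<^sup>2 \<le> (n2 * w k x)\<^sup>2" by (intro power_mono normJ) simp
        also have "\<dots> = n2\<^sup>2 * w k x powr 2" using wpos[of k x] by (simp add: power_mult_distrib powr_numeral)
        finally have "ennreal ((norm (J k x))\<^sup>2) \<le> ennreal (n2\<^sup>2) * ennreal (w k x powr 2)"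
          by (simp add: ennreal_mult[symmetric] ennreal_leI)
        from mult_right_mono[OF this, of "indicator (cball 0 R) x"]
        show "ennreal ((norm (J k x))\<^sup>2) * indicator (cball 0 R) x \<le> ennreal (n2\<^sup>2) * (ennreal (w k x powr 2) * indicator (cball 0 R) x)"
          by (simp add: mult.assoc)
      qed
      also have "\<dots> = ennreal (n2\<^sup>2) * (\<integral>\<^sup>+x\<in>cball 0 R. ennreal (w k x powr 2) \<partial>lborel)"
        by (rule nn_integral_cmult) measurable
      also have "\<dots> \<le> ennreal (n2\<^sup>2) * ennreal C" by (intro mult_left_mono C) simp
      finally show ?thesis by (simp add: ennreal_mult')
    qed
    then show ?thesis by blast
  qed
  obtain c G where c: "\<And>n. c n \<in> tail_weights n" and G [measurable]: "G \<in> borel_measurable borel"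
    and ae: "AE x in lborel. (\<lambda>n. combination (c n) J x) \<longlonglongrightarrow> G x"
    and L1: "\<And>R. (\<lambda>n. \<integral>\<^sup>+x\<in>cball 0 R. ennreal (norm (combination (c n) J x - G x)) \<partial>lborel) \<longlonglongrightarrow> 0"
  proof -
    show ?thesis by (rule Mazur_L2_local[of J, OF Jmm sq]) (fact that)
  qed
  have cp: "finite {k. c n k \<noteq> 0}" "(\<Sum>k | c n k \<noteq> 0. c n k) = 1" "0 \<le> c n k" for n k
    using c[of n] by (auto simp: tail_weights_def)
  have cne: "{k. c n k \<noteq> 0} \<noteq> {}" for n
  proof
    assume "{k. c n k \<noteq> 0} = {}"
    with cp(2)[of n] show False by simp
  qed
  have cJm [measurable]: "combination (c n) J \<in> borel_measurable borel" for n
    unfolding combination_def[abs_def] by measurable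
  have Gq: "(\<integral>\<^sup>+x\<in>cball 0 R. ennreal (norm (G x) powr q) \<partial>lborel) < \<infinity>" if q: "q \<ge> 1" for q R
  proof -
    have [measurable]: "cball (0 :: real ^ 'n) R \<in> sets borel" by simp
    obtain C where C: "\<And>k. (\<integral>\<^sup>+x\<in>cball 0 R. ennreal (w k x powr q) \<partial>lborel) \<le> ennreal C"
      using wq[of q R] q by auto
    have pw: "norm (combination (c n) J x) powr q \<le> n2 powr q * (\<Sum>k | c n k \<noteq> 0. c n k * w k x powr q)" for n x
    proof -
      have "norm (combination (c n) J x) \<le> (\<Sum>k | c n k \<noteq> 0. c n k * (n2 * w k x))"
        unfolding combination_def
        by (intro sum_norm_le) (use cp normJ in \<open>auto intro!: mult_left_mono\<close>)
      also have "\<dots> = n2 * (\<Sum>k | c n k \<noteq> 0. c n k * w k x)" by (simp add: sum_distrib_left mult_ac)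
      finally have "norm (combination (c n) J x) powr q \<le> (n2 * (\<Sum>k | c n k \<noteq> 0. c n k * w k x)) powr q"
        using q by (intro powr_mono2) auto
      also have "\<dots> = n2 powr q * (\<Sum>k | c n k \<noteq> 0. c n k * w k x) powr q"
        by (rule powr_mult)
      also have "\<dots> \<le> n2 powr q * (\<Sum>k | c n k \<noteq> 0. c n k * w k x powr q)"
      proof (rule mult_left_mono)
        have "(\<Sum>k | c n k \<noteq> 0. c n k *\<^sub>R w k x) powr q \<le> (\<Sum>k | c n k \<noteq> 0. c n k * (w k x powr q))"
          by (rule convex_on_sum[OF cp(1) cne powr_convex[OF q] cp(2)]) (use cp(3) wpos in auto)
        then show "(\<Sum>k | c n k \<noteq> 0. c n k * w k x) powr q \<le> (\<Sum>k | c n k \<noteq> 0. c n k * w k x powr q)" by simp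
      qed simp
      finally show ?thesis .
    qed
    have cb: "(\<integral>\<^sup>+x\<in>cball 0 R. ennreal (norm (combination (c n) J x) powr q) \<partial>lborel) \<le> ennreal (n2 powr q) * ennreal C" for n
    proof -
      have "(\<integral>\<^sup>+x\<in>cball 0 R. ennreal (norm (combination (c n) J x) powr q) \<partial>lborel)
        \<le> (\<integral>\<^sup>+x. ennreal (n2 powr q) * (\<Sum>k | c n k \<noteq> 0. ennreal (c n k) * (ennreal (w k x powr q) * indicator (cball 0 R) x)) \<partial>lborel)"
      proof (rule nn_integral_mono)
        fix x
        have "ennreal (norm (combination (c n) J x) powr q) \<le> ennreal (n2 powr q) * (\<Sum>k | c n k \<noteq> 0. ennreal (c n k) * ennreal (w k x powr q))"
          using pw[of n x] cp(3) by (simp add: ennreal_mult[symmetric] sum_ennreal ennreal_leI sum_nonneg)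
        from mult_right_mono[OF this, of "indicator (cball 0 R) x"]
        show "ennreal (norm (combination (c n) J x) powr q) * indicator (cball 0 R) x \<le>
          ennreal (n2 powr q) * (\<Sum>k | c n k \<noteq> 0. ennreal (c n k) * (ennreal (w k x powr q) * indicator (cball 0 R) x))"
          by (simp add: sum_distrib_right mult.assoc)
      qed
      also have "\<dots> = ennreal (n2 powr q) * (\<Sum>k | c n k \<noteq> 0. ennreal (c n k) * (\<integral>\<^sup>+x\<in>cball 0 R. ennreal (w k x powr q) \<partial>lborel))"
        by (simp add: nn_integral_cmult nn_integral_sum)
      also have "\<dots> \<le> ennreal (n2 powr q) * (\<Sum>k | c n k \<noteq> 0. ennreal (c n k) * ennreal C)"
        by (intro mult_left_mono sum_mono C) auto
      also have "(\<Sum>k | c n k \<noteq> 0. ennreal (c n k) * ennreal C) = ennreal C"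
        using cp by (simp add: sum_distrib_right[symmetric] sum_ennreal)
      finally show ?thesis .
    qed
    have "(\<integral>\<^sup>+x\<in>cball 0 R. ennreal (norm (G x) powr q) \<partial>lborel)
      = (\<integral>\<^sup>+x. liminf (\<lambda>n. ennreal (norm (combination (c n) J x) powr q) * indicator (cball 0 R) x) \<partial>lborel)"
    proof (rule nn_integral_cong_AE)
      show "AE x in lborel. ennreal (norm (G x) powr q) * indicator (cball 0 R) x
        = liminf (\<lambda>n. ennreal (norm (combination (c n) J x) powr q) * indicator (cball 0 R) x)"
        using ae
      proof eventually_elim
        case (elim x)
        have "(\<lambda>n. norm (combination (c n) J x) powr q) \<longlonglongrightarrow> norm (G x) powr q"
          by (intro tendsto_powr2 tendsto_norm elim tendsto_const) (use q in auto)
        then have "(\<lambda>n. ennreal (norm (combination (c n) J x) powr q) * indicator (cball 0 R) x) \<longlonglongrightarrow> ennreal (norm (G x) powr q) * indicator (cball 0 R) x"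
          by (cases "x \<in> cball 0 R") (auto intro!: tendsto_ennrealI)
        then show ?case by (rule lim_imp_Liminf[OF sequentially_bot, symmetric])
      qed
    qed
    also have "\<dots> \<le> liminf (\<lambda>n. \<integral>\<^sup>+x\<in>cball 0 R. ennreal (norm (combination (c n) J x) powr q) \<partial>lborel)"
      by (rule nn_integral_liminf) measurable
    also have "\<dots> \<le> ennreal (n2 powr q) * ennreal C"
      by (rule Liminf_le) (simp_all add: cb)
    also have "\<dots> < \<infinity>" by (simp add: ennreal_mult_less_top)
    finally show ?thesis .
  qed
  have Gloc: "loc_integrable G"
    unfolding loc_integrable_def set_integrable_def
  proof (intro conjI allI G)
    fix R
    have "(\<integral>\<^sup>+x. ennreal (norm (indicat_real (cball 0 R) x *\<^sub>R G x)) \<partial>lborel) = (\<integral>\<^sup>+x\<in>cball 0 R. ennreal (norm (G x) powr 1) \<partial>lborel)"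
      by (intro nn_integral_cong) (auto simp: indicator_def)
    moreover have [measurable]: "cball (0 :: real ^ 'n) R \<in> sets borel" by simp
    have "(\<lambda>x. indicat_real (cball 0 R) x *\<^sub>R G x) \<in> borel_measurable lborel" by measurable
    ultimately show "integrable lborel (\<lambda>x. indicat_real (cball 0 R) x *\<^sub>R G x)"
      using Gq[of 1 R] by (intro integrableI_bounded) simp_all
  qed
  have weak: "(LINT x|lborel. S x $ i * partial_deriv j \<phi> x) = - (LINT x|lborel. G x $ i $ j * \<phi> x)"
    if phi: "test_function \<phi>" for \<phi> i j
  proof -
    obtain R where R: "R > 0" "\<And>x. x \<notin> cball 0 R \<Longrightarrow> \<phi> x = 0" "\<And>x j. x \<notin> cball 0 R \<Longrightarrow> partial_deriv j \<phi> x = 0"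
      using test_function_support_bounded[OF phi] by metis
    obtain B where B: "B > 0" "\<And>x. \<bar>\<phi> x\<bar> \<le> B" "\<And>x j. \<bar>partial_deriv j \<phi> x\<bar> \<le> B"
      using test_function_bounded[OF phi] by metis
    have [measurable]: "cball (0 :: real ^ 'n) R \<in> sets borel" by simp
    have [measurable]: "\<phi> \<in> borel_measurable borel" "partial_deriv j \<phi> \<in> borel_measurable borel"
      by (intro borel_measurable_continuous_onI test_function_continuous test_function_partial_continuous phi)+
    have cont_i: "continuous_on UNIV (\<lambda>x. F x $ i)" if "continuous_on UNIV F" for F :: "real ^ 'n \<Rightarrow> real ^ 'n"
      using that by (intro continuous_intros)
    have times: "integrable lborel (\<lambda>x. F x * \<phi> x)" "integrable lborel (\<lambda>x. F x * partial_deriv j \<phi> x)"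
      if "loc_integrable F" for F :: "real ^ 'n \<Rightarrow> real"
      using loc_integrable_times_bounded[OF that, of \<phi> B R] loc_integrable_times_bounded[OF that, of "partial_deriv j \<phi>" B R] B R
      by (simp_all add: mult.commute)
    have i\<Psi>: "integrable lborel (\<lambda>x. \<Psi> k x $ i * partial_deriv j \<phi> x)" for k
      by (rule times(2)[OF continuous_loc_integrable[OF cont_i[OF cont\<Psi>]]])
    have iS: "integrable lborel (\<lambda>x. S x $ i * partial_deriv j \<phi> x)"
      by (rule times(2)[OF continuous_loc_integrable[OF cont_i[OF contS]]])
    have iJ: "integrable lborel (\<lambda>x. J k x $ i $ j * \<phi> x)" for k
      by (rule times(1)[OF loc_integrable_bounded[OF Jm order_trans[OF Jw wK]]])
    have iG: "integrable lborel (\<lambda>x. G x $ i $ j * \<phi> x)"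
      by (rule times(1)[OF loc_integrable_comp[OF loc_integrable_comp'[OF Gloc]]])
    define l where "l n = (LINT x|lborel. combination (c n) \<Psi> x $ i * partial_deriv j \<phi> x)" for n
    define r where "r n = (LINT x|lborel. combination (c n) J x $ i $ j * \<phi> x)" for n
    have cl: "combination (c n) \<Psi> x $ i * partial_deriv j \<phi> x = (\<Sum>k | c n k \<noteq> 0. c n k * (\<Psi> k x $ i * partial_deriv j \<phi> x))" for n x
      by (simp add: combination_def sum_distrib_right mult.assoc)
    have cr: "combination (c n) J x $ i $ j * \<phi> x = (\<Sum>k | c n k \<noteq> 0. c n k * (J k x $ i $ j * \<phi> x))" for n x
      by (simp add: combination_def sum_distrib_right mult.assoc)
    have il: "integrable lborel (\<lambda>x. combination (c n) \<Psi> x $ i * partial_deriv j \<phi> x)" for n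
      unfolding cl using i\<Psi> by (intro Bochner_Integration.integrable_sum integrable_mult_right)
    have ir: "integrable lborel (\<lambda>x. combination (c n) J x $ i $ j * \<phi> x)" for n
      unfolding cr using iJ by (intro Bochner_Integration.integrable_sum integrable_mult_right)
    have lr: "l n = - r n" for n
    proof -
      have "l n = (\<Sum>k | c n k \<noteq> 0. c n k * (LINT x|lborel. \<Psi> k x $ i * partial_deriv j \<phi> x))"
        unfolding l_def cl using i\<Psi> by (subst Bochner_Integration.integral_sum) auto
      also have "\<dots> = (\<Sum>k | c n k \<noteq> 0. c n k * - (LINT x|lborel. J k x $ i $ j * \<phi> x))"
        using integration_by_parts_test[OF der Jm order_trans[OF Jw wK] phi] by simp
      also have "\<dots> = - r n"
        unfolding r_def cr using iJ by (subst Bochner_Integration.integral_sum) (auto simp: sum_negf)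
      finally show ?thesis .
    qed
    have "l \<longlonglongrightarrow> (LINT x|lborel. S x $ i * partial_deriv j \<phi> x)"
    proof (rule LIM_zero_cancel, rule Lim_null_comparison)
      have iabs: "integrable lborel (\<lambda>x. \<bar>partial_deriv j \<phi> x\<bar>)"
        using times(2)[OF continuous_loc_integrable[of "\<lambda>_. 1"]] by simp
      show "\<forall>\<^sub>F n in sequentially. norm (l n - (LINT x|lborel. S x $ i * partial_deriv j \<phi> x)) \<le> C / 4 ^ n * (LINT x|lborel. \<bar>partial_deriv j \<phi> x\<bar>)"
      proof (rule always_eventually, rule allI)
        fix n
        have "l n - (LINT x|lborel. S x $ i * partial_deriv j \<phi> x) = (LINT x|lborel. combination (c n) \<Psi> x $ i * partial_deriv j \<phi> x - S x $ i * partial_deriv j \<phi> x)"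
          unfolding l_def using il iS by simp
        also have "norm \<dots> \<le> (LINT x|lborel. C / 4 ^ n * \<bar>partial_deriv j \<phi> x\<bar>)"
        proof (rule Bochner_Integration.integral_norm_bound_integral)
          show "integrable lborel (\<lambda>x. combination (c n) \<Psi> x $ i * partial_deriv j \<phi> x - S x $ i * partial_deriv j \<phi> x)"
            using il iS by simp
          show "integrable lborel (\<lambda>x. C / 4 ^ n * \<bar>partial_deriv j \<phi> x\<bar>)" using iabs by simp
          fix x
          have tail: "norm (\<Psi> k x - S x) \<le> C / 4 ^ n" if "k \<ge> n" for k
          proof -
            have "0 \<le> C" using order_trans[OF norm_ge_zero near[of 0 0]] by simp
            then have "C / 4 ^ k \<le> C / 4 ^ n" using that by (intro divide_left_mono power_increasing) auto
            then show ?thesis using near[of k x] by linarith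
          qed
          have "norm (combination (c n) \<Psi> x - S x) \<le> C / 4 ^ n"
            by (rule combination_dist_le[where f = \<Psi>, OF c tail])
          then have "\<bar>(combination (c n) \<Psi> x - S x) $ i\<bar> \<le> C / 4 ^ n"
            using component_le_norm_cart order_trans by blast
          then have "\<bar>combination (c n) \<Psi> x $ i - S x $ i\<bar> * \<bar>partial_deriv j \<phi> x\<bar> \<le> C / 4 ^ n * \<bar>partial_deriv j \<phi> x\<bar>"
            by (intro mult_right_mono) auto
          then show "norm (combination (c n) \<Psi> x $ i * partial_deriv j \<phi> x - S x $ i * partial_deriv j \<phi> x) \<le> C / 4 ^ n * \<bar>partial_deriv j \<phi> x\<bar>"
            by (simp add: left_diff_distrib[symmetric] abs_mult)
        qed
        finally show "norm (l n - (LINT x|lborel. S x $ i * partial_deriv j \<phi> x)) \<le> C / 4 ^ n * (LINT x|lborel. \<bar>partial_deriv j \<phi> x\<bar>)"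
          by simp
      qed
      show "(\<lambda>n. C / 4 ^ n * (LINT x|lborel. \<bar>partial_deriv j \<phi> x\<bar>)) \<longlonglongrightarrow> 0"
        using tendsto_mult_right[OF lim0, of "LINT x|lborel. \<bar>partial_deriv j \<phi> x\<bar>"] by simp
    qed
    moreover have "r \<longlonglongrightarrow> (LINT x|lborel. G x $ i $ j * \<phi> x)"
    proof (rule LIMSEQ_I)
      fix e :: real assume e: "e > 0"
      have "0 < ennreal (e / (2 * B))" using e B(1) by simp
      then have "\<forall>\<^sub>F n in sequentially. (\<integral>\<^sup>+x\<in>cball 0 R. ennreal (norm (combination (c n) J x - G x)) \<partial>lborel) < ennreal (e / (2 * B))"
        using L1[of R] order_tendstoD(2) by blast
      then obtain n0 where n0: "\<And>n. n \<ge> n0 \<Longrightarrow> (\<integral>\<^sup>+x\<in>cball 0 R. ennreal (norm (combination (c n) J x - G x)) \<partial>lborel) < ennreal (e / (2 * B))"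
        unfolding eventually_sequentially by blast
      have "norm (r n - (LINT x|lborel. G x $ i $ j * \<phi> x)) < e" if n: "n \<ge> n0" for n
      proof -
        have d: "integrable lborel (\<lambda>x. combination (c n) J x $ i $ j * \<phi> x - G x $ i $ j * \<phi> x)" using ir iG by simp
        have "r n - (LINT x|lborel. G x $ i $ j * \<phi> x) = (LINT x|lborel. combination (c n) J x $ i $ j * \<phi> x - G x $ i $ j * \<phi> x)"
          unfolding r_def using ir iG by simp
        then have "ennreal (norm (r n - (LINT x|lborel. G x $ i $ j * \<phi> x))) \<le> (\<integral>\<^sup>+x. ennreal (norm (combination (c n) J x $ i $ j * \<phi> x - G x $ i $ j * \<phi> x)) \<partial>lborel)"
          using integral_norm_bound_ennreal[OF d] by simp
        also have "\<dots> \<le> (\<integral>\<^sup>+x. ennreal B * (ennreal (norm (combination (c n) J x - G x)) * indicator (cball 0 R) x) \<partial>lborel)"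
        proof (rule nn_integral_mono)
          fix x
          show "ennreal (norm (combination (c n) J x $ i $ j * \<phi> x - G x $ i $ j * \<phi> x)) \<le> ennreal B * (ennreal (norm (combination (c n) J x - G x)) * indicator (cball 0 R) x)"
          proof (cases "x \<in> cball 0 R")
            case True
            have "\<bar>(combination (c n) J x - G x) $ i $ j\<bar> * \<bar>\<phi> x\<bar> \<le> norm (combination (c n) J x - G x) * B"
              using B by (intro mult_mono matrix_entry_le_norm) auto
            then have "norm (combination (c n) J x $ i $ j * \<phi> x - G x $ i $ j * \<phi> x) \<le> B * norm (combination (c n) J x - G x)"
              by (simp only: left_diff_distrib[symmetric] real_norm_def abs_mult vector_minus_component mult.commute[of B])
            then show ?thesis using True B(1) by (simp add: ennreal_mult[symmetric] ennreal_leI)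
          next
            case False
            then show ?thesis using R(2) by simp
          qed
        qed
        also have "\<dots> = ennreal B * (\<integral>\<^sup>+x\<in>cball 0 R. ennreal (norm (combination (c n) J x - G x)) \<partial>lborel)"
          by (rule nn_integral_cmult) measurable
        also have "\<dots> \<le> ennreal B * ennreal (e / (2 * B))" using n0[OF n] by (intro mult_left_mono) auto
        also have "\<dots> = ennreal (e / 2)" using B(1) e by (simp add: ennreal_mult[symmetric])
        finally have "norm (r n - (LINT x|lborel. G x $ i $ j * \<phi> x)) \<le> e / 2"
          using e by (subst (asm) ennreal_le_iff) auto
        then show ?thesis using e by linarith
      qed
      then show "\<exists>n0. \<forall>n\<ge>n0. norm (r n - (LINT x|lborel. G x $ i $ j * \<phi> x)) < e" by blast
    qed
    then have "l \<longlonglongrightarrow> - (LINT x|lborel. G x $ i $ j * \<phi> x)"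
      unfolding lr[abs_def] by (rule tendsto_minus)
    ultimately show ?thesis using LIMSEQ_unique by blast
  qed
  show ?thesis by (rule that[of G, OF contS uniq Gloc Gq weak])
qed

section \<open>The flow map and its inverse\<close>

lemma locally_integrable_of_loc_integrable:
  fixes F :: "real ^ 'n \<Rightarrow> 'b::{banach, second_countable_topology}"
  assumes F: "loc_integrable F"
  shows "locally_integrable F"
  unfolding locally_integrable_def
proof (intro allI impI)
  fix K :: "(real ^ 'n) set" assume K: "compact K"
  then obtain R where R: "K \<subseteq> cball 0 R"
    using bounded_subset_ballD[OF compact_imp_bounded, of K 0] ball_subset_cball by (meson subset_trans)
  note [measurable] = loc_integrable_measurable[OF F]
  have "integrable lborel (\<lambda>x. indicat_real (cball 0 R) x *\<^sub>R F x)"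
    using F unfolding loc_integrable_def set_integrable_def by blast
  then have "set_integrable lebesgue (cball 0 R) F"
    unfolding set_integrable_def by (subst integrable_completion) auto
  then show "set_integrable lebesgue K F"
    by (rule set_integrable_subset[OF _ _ R]) (simp add: K compact_imp_closed borel_closed sets_completionI_sets)
qed

lemma Lp_on_unit_cellI:
  fixes F :: "real ^ 'n \<Rightarrow> 'b::euclidean_space"
  assumes [measurable]: "F \<in> borel_measurable borel"
    and fin: "(\<integral>\<^sup>+x\<in>unit_cell. ennreal (norm (F x) powr p) \<partial>lborel) < \<infinity>"
  shows "Lp_on p unit_cell F"
  unfolding Lp_on_def
proof
  have [measurable]: "(unit_cell :: (real ^ 'n) set) \<in> sets borel" by (simp add: unit_cell_def)
  show "F \<in> borel_measurable (lebesgue_on unit_cell)"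
    by (intro measurable_restrict_space1 measurable_completion) simp
  have "integrable lborel (\<lambda>x. indicat_real unit_cell x *\<^sub>R (norm (F x) powr p))"
  proof (rule integrableI_bounded)
    have "(\<integral>\<^sup>+x. ennreal (norm (indicat_real unit_cell x *\<^sub>R (norm (F x) powr p))) \<partial>lborel) = (\<integral>\<^sup>+x\<in>unit_cell. ennreal (norm (F x) powr p) \<partial>lborel)"
      by (intro nn_integral_cong) (auto simp: indicator_def)
    then show "(\<integral>\<^sup>+x. ennreal (norm (indicat_real unit_cell x *\<^sub>R (norm (F x) powr p))) \<partial>lborel) < \<infinity>"
      using fin by simp
  qed measurable
  then show "set_integrable lebesgue unit_cell (\<lambda>x. norm (F x) powr p)"
    unfolding set_integrable_def by (subst integrable_completion) auto
qed

lemma in_W1pI: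
  fixes S :: "real ^ 'n \<Rightarrow> real ^ 'n" and G :: "real ^ 'n \<Rightarrow> real ^ 'n ^ 'n"
  assumes per: "periodic (\<lambda>x. S x - x)" and cont: "continuous_on UNIV S" and G: "loc_integrable G"
    and Gq: "\<And>R. (\<integral>\<^sup>+x\<in>cball 0 R. ennreal (norm (G x) powr p) \<partial>lborel) < \<infinity>"
    and weak: "\<And>\<phi> i j. test_function \<phi> \<Longrightarrow>
      (LINT x|lborel. S x $ i * partial_deriv j \<phi> x) = - (LINT x|lborel. G x $ i $ j * \<phi> x)"
    and p: "p \<ge> 1"
  shows "in_W1p p S"
  unfolding in_W1p_def
proof (intro conjI exI[of _ G])
  show "periodic (\<lambda>x. S x - x)" by fact
  have Sm [measurable]: "S \<in> borel_measurable borel" by (rule borel_measurable_continuous_onI[OF cont])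
  note [measurable] = loc_integrable_measurable[OF G]
  have "compact (S ` unit_cell)"
    unfolding unit_cell_def by (intro compact_continuous_image continuous_on_subset[OF cont]) auto
  then have "bounded (S ` unit_cell)" by (rule compact_imp_bounded)
  then obtain B where B: "B > 0" "\<forall>y\<in>S ` unit_cell. norm y \<le> B" unfolding bounded_pos by blast
  have "(\<integral>\<^sup>+x\<in>unit_cell. ennreal (norm (S x) powr p) \<partial>lborel) \<le> (\<integral>\<^sup>+x. ennreal (B powr p) * indicator unit_cell x \<partial>(lborel :: (real ^ 'n) measure))"
  proof (rule nn_integral_mono)
    fix x
    show "ennreal (norm (S x) powr p) * indicator unit_cell x \<le> ennreal (B powr p) * indicator unit_cell x"
    proof (cases "x \<in> unit_cell")
      case True
      then have "norm (S x) powr p \<le> B powr p" using B p by (intro powr_mono2) auto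
      then show ?thesis by (intro mult_right_mono ennreal_leI) auto
    qed simp
  qed
  also have "\<dots> = ennreal (B powr p) * emeasure lborel (unit_cell :: (real ^ 'n) set)"
    by (rule nn_integral_cmult_indicator) (simp add: unit_cell_def)
  also have "\<dots> < \<infinity>"
    using emeasure_bounded_finite[of "unit_cell :: (real ^ 'n) set"] by (simp add: unit_cell_def ennreal_mult_less_top)
  finally show "Lp_on p unit_cell S" by (intro Lp_on_unit_cellI Sm)
  obtain R where R: "(unit_cell :: (real ^ 'n) set) \<subseteq> cball 0 R"
    using bounded_subset_ballD[OF bounded_cbox, of 0 1 0] ball_subset_cball unfolding unit_cell_def by (meson subset_trans)
  have "(\<integral>\<^sup>+x\<in>unit_cell. ennreal (norm (G x) powr p) \<partial>lborel) \<le> (\<integral>\<^sup>+x\<in>cball 0 R. ennreal (norm (G x) powr p) \<partial>lborel)"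
    using R by (intro nn_integral_mono) (auto simp: indicator_def)
  then show "Lp_on p unit_cell G"
    using Gq[of R] by (intro Lp_on_unit_cellI) (auto intro: order_le_less_trans)
  show "weak_gradient S G"
    unfolding weak_gradient_def
  proof (intro conjI allI impI)
    show "locally_integrable S"
      by (rule locally_integrable_of_loc_integrable[OF continuous_loc_integrable[OF cont]])
    show "locally_integrable G" by (rule locally_integrable_of_loc_integrable[OF G])
    fix \<phi> :: "real ^ 'n \<Rightarrow> real" and i j assume phi: "test_function \<phi>"
    have [measurable]: "\<phi> \<in> borel_measurable borel" "partial_deriv j \<phi> \<in> borel_measurable borel"
      by (intro borel_measurable_continuous_onI test_function_continuous test_function_partial_continuous phi)+
    have [measurable]: "(\<lambda>x. S x $ i) \<in> borel_measurable borel"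
      by (rule borel_measurable_nth[OF Sm])
    have [measurable]: "(\<lambda>x. G x $ i $ j) \<in> borel_measurable borel"
      by (rule borel_measurable_nth[OF borel_measurable_nth[OF loc_integrable_measurable[OF G]]])
    have "(LINT x|lebesgue. S x $ i * partial_deriv j \<phi> x) = (LINT x|lborel. S x $ i * partial_deriv j \<phi> x)"
      by (rule integral_lebesgue_eq_lborel) simp_all
    moreover have "(LINT x|lebesgue. G x $ i $ j * \<phi> x) = (LINT x|lborel. G x $ i $ j * \<phi> x)"
      by (rule integral_lebesgue_eq_lborel) simp_all
    ultimately show "(LINT x|lebesgue. S x $ i * partial_deriv j \<phi> x) = - (LINT x|lebesgue. G x $ i $ j * \<phi> x)"
      by (simp only: weak[OF phi])
  qed
qed

lemma periodic_continuous_bounded: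
  fixes u :: "real ^ 'n \<Rightarrow> 'b::real_normed_vector"
  assumes per: "periodic u" and cont: "continuous_on UNIV u"
  obtains r where "r > 0" "\<And>x. norm (u x) \<le> r"
proof -
  have "compact (u ` unit_cell)"
    unfolding unit_cell_def by (intro compact_continuous_image continuous_on_subset[OF cont]) auto
  then have "bounded (u ` unit_cell)" by (rule compact_imp_bounded)
  then obtain r where r: "r > 0" "\<forall>y\<in>u ` unit_cell. norm y \<le> r" unfolding bounded_pos by blast
  have "norm (u x) \<le> r" for x
  proof -
    define m :: "real ^ 'n" where "m = (\<chi> i. of_int \<lfloor>x $ i\<rfloor>)"
    have "x - m \<in> unit_cell"
      unfolding unit_cell_def mem_box_cart
    proof
      fix i
      have "(x - m) $ i = frac (x $ i)" by (simp add: m_def frac_def)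
      then show "0 $ i \<le> (x - m) $ i \<and> (x - m) $ i \<le> 1 $ i" using frac_lt_1[of "x $ i"] by simp
    qed
    then have "norm (u (x - m)) \<le> r" using r(2) by blast
    moreover have "\<forall>i. m $ i \<in> \<int>" by (simp add: m_def)
    then have "u ((x - m) + m) = u (x - m)" using per unfolding periodic_def by blast
    ultimately show ?thesis by simp
  qed
  then show ?thesis using r(1) that by blast
qed

text \<open>A solution of \<open>S x = y\<close> is a fixed point of \<open>x \<mapsto> y - (S x - x)\<close>, which maps a ball around \<open>y\<close> into
  itself.\<close>

lemma surj_of_bounded_displacement:
  fixes S :: "'a::euclidean_space \<Rightarrow> 'a"
  assumes cont: "continuous_on UNIV S" and r: "\<And>x. norm (S x - x) \<le> r" "r > 0"
  shows "surj S"
proof (rule surjI[of S "\<lambda>y. SOME x. S x = y"])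
  fix y
  have "\<exists>x. S x = y"
  proof (rule brouwer[of "cball y r" "\<lambda>x. y - (S x - x)"])
    show "continuous_on (cball y r) (\<lambda>x. y - (S x - x))"
      by (intro continuous_intros continuous_on_subset[OF cont]) auto
    show "(\<lambda>x. y - (S x - x)) \<in> cball y r \<rightarrow> cball y r" using r(1) by (auto simp: dist_norm)
    show "\<exists>x. S x = y" if "y - (S x - x) = x" for x
      using that by (intro exI[of _ x]) (simp add: algebra_simps)
  qed (use r(2) in auto)
  then show "S (SOME x. S x = y) = y" by (rule someI_ex)
qed

text \<open>Surjectivity comes from Brouwer's theorem. Then \<open>inv S\<close> selects endpoints of reversed
  trajectories, and uniqueness of these makes it a left inverse of \<open>S\<close> as well, so that the result
  on endpoint maps applies to the inverse.\<close>

lemma flow_map_bij_sobolev: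
  fixes b :: "real \<Rightarrow> real ^ 'n \<Rightarrow> real ^ 'n" and g :: "real \<Rightarrow> real ^ 'n \<Rightarrow> real ^ 'n"
    and S :: "real ^ 'n \<Rightarrow> real ^ 'n"
  assumes T: "T > 0"
    and gm: "(\<lambda>(s, x). g s x) \<in> borel_measurable (borel \<Otimes>\<^sub>M borel)"
    and bg: "AE s in lborel. s \<in> {0..T} \<longrightarrow> (AE x in lborel. b s x = g s x)"
    and good: "AE s in lborel. s \<in> {0..T} \<longrightarrow> good_field D M (b s)"
    and S: "\<And>x. \<exists>\<gamma>. trajectory T b \<gamma> \<and> \<gamma> 0 = x \<and> \<gamma> T = S x"
    and per: "periodic (\<lambda>x. S x - x)"
  shows "bij S \<and> (\<forall>p\<ge>1. in_W1p p S \<and> in_W1p p (inv S))"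
proof -
  obtain G :: "real ^ 'n \<Rightarrow> real ^ 'n ^ 'n" where
    G: "continuous_on UNIV S" "loc_integrable G"
    "\<And>q R. q \<ge> 1 \<Longrightarrow> (\<integral>\<^sup>+x\<in>cball 0 R. ennreal (norm (G x) powr q) \<partial>lborel) < \<infinity>"
    "\<And>\<phi> i j. test_function \<phi> \<Longrightarrow>
      (LINT x|lborel. S x $ i * partial_deriv j \<phi> x) = - (LINT x|lborel. G x $ i $ j * \<phi> x)"
  proof -
    show ?thesis by (rule flow_endpoint[OF T gm bg good S]) (rule that)
  qed
  obtain r where r: "r > 0" "\<And>x. norm (S x - x) \<le> r"
  proof -
    have c: "continuous_on UNIV (\<lambda>x. S x - x)" by (intro continuous_intros G(1))
    show ?thesis by (rule periodic_continuous_bounded[OF per c]) (rule that)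
  qed
  have surj: "surj S" by (rule surj_of_bounded_displacement[OF G(1) r(2) r(1)])
  define b' where "b' s x = - b (T - s) x" for s x
  define g' where "g' s x = - g (T - s) x" for s x
  have gm': "(\<lambda>(s, x). g' s x) \<in> borel_measurable (borel \<Otimes>\<^sub>M borel)"
    using borel_measurable_uminus[OF measurable_compose[OF _ gm, of "\<lambda>p. (T - fst p, snd p)" "borel \<Otimes>\<^sub>M borel"]]
    by (simp add: g'_def case_prod_beta')
  have bg': "AE s in lborel. s \<in> {0..T} \<longrightarrow> (AE x in lborel. b' s x = g' s x)"
    using AE_reflect[OF bg, of T] by eventually_elim (auto simp: b'_def g'_def)
  have good': "AE s in lborel. s \<in> {0..T} \<longrightarrow> good_field D M (b' s)"
    using AE_reflect[OF good, of T]
  proof eventually_elim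
    case (elim s)
    then show ?case using good_field_uminus[of D M "b (T - s)"] by (auto simp: b'_def[abs_def])
  qed
  have rev: "trajectory T b' (\<lambda>s. \<gamma> (T - s))" if "trajectory T b \<gamma>" for \<gamma>
    using trajectory_reverse[OF that T] by (simp add: b'_def[abs_def])
  have S': "\<exists>\<gamma>. trajectory T b' \<gamma> \<and> \<gamma> 0 = z \<and> \<gamma> T = inv S z" for z
  proof -
    obtain \<gamma> where \<gamma>: "trajectory T b \<gamma>" "\<gamma> 0 = inv S z" "\<gamma> T = S (inv S z)" using S by blast
    then show ?thesis using rev[OF \<gamma>(1)] surj_f_inv_f[OF surj, of z]
      by (intro exI[of _ "\<lambda>s. \<gamma> (T - s)"]) simp
  qed
  obtain G' :: "real ^ 'n \<Rightarrow> real ^ 'n ^ 'n" where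
    G': "continuous_on UNIV (inv S)" "\<And>\<gamma>. trajectory T b' \<gamma> \<Longrightarrow> \<gamma> T = inv S (\<gamma> 0)" "loc_integrable G'"
    "\<And>q R. q \<ge> 1 \<Longrightarrow> (\<integral>\<^sup>+x\<in>cball 0 R. ennreal (norm (G' x) powr q) \<partial>lborel) < \<infinity>"
    "\<And>\<phi> i j. test_function \<phi> \<Longrightarrow>
      (LINT x|lborel. inv S x $ i * partial_deriv j \<phi> x) = - (LINT x|lborel. G' x $ i $ j * \<phi> x)"
  proof -
    show ?thesis by (rule flow_endpoint[OF T gm' bg' good' S']) (rule that)
  qed
  have left: "inv S (S x) = x" for x
  proof -
    obtain \<gamma> where \<gamma>: "trajectory T b \<gamma>" "\<gamma> 0 = x" "\<gamma> T = S x" using S by blast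
    from G'(2)[OF rev[OF \<gamma>(1)]] show ?thesis using \<gamma> by simp
  qed
  have inj: "inj S" by (rule inj_on_inverseI[of _ "inv S"]) (rule left)
  have per': "periodic (\<lambda>x. inv S x - x)"
    unfolding periodic_def
  proof (intro allI impI)
    fix x k :: "real ^ 'n" assume k: "\<forall>i. k $ i \<in> \<int>"
    have "S (inv S x + k) - (inv S x + k) = S (inv S x) - inv S x" using per k unfolding periodic_def by blast
    then have "S (inv S x + k) = x + k" by (simp add: surj_f_inv_f[OF surj] algebra_simps)
    then have "inv S (x + k) = inv S x + k" by (metis left)
    then show "inv S (x + k) - (x + k) = inv S x - x" by simp
  qed
  show ?thesis
    using inj surj in_W1pI[OF per G(1,2) G(3) G(4)] in_W1pI[OF per' G'(1,3) G'(4) G'(5)]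
    by (auto simp: bij_def)
qed

text \<open>At time \<open>0\<close> the flow map is the identity, which is treated as the time-one map of the zero
  field. The constant bound is the exponential integral of the zero gradient over the cell.\<close>

lemma good_field_zero: "good_field 0 (\<lambda>_. measure lborel (unit_cell :: (real ^ 'n) set)) (\<lambda>_ :: real ^ 'n. 0)"
  unfolding good_field_def
proof (intro conjI exI[of _ "\<lambda>_. 0"])
  have "emeasure lborel (unit_cell :: (real ^ 'n) set) = ennreal (measure lborel (unit_cell :: (real ^ 'n) set))"
    using emeasure_bounded_finite[of "unit_cell :: (real ^ 'n) set"]
    by (intro emeasure_eq_ennreal_measure) (auto simp: unit_cell_def)
  then show "\<forall>\<beta>>0. \<forall>k. (\<forall>i. k $ i \<in> \<int>) \<longrightarrow>
      (\<integral>\<^sup>+x\<in>unit_cell. ennreal (exp (\<beta> * norm (0 :: real ^ 'n ^ 'n))) \<partial>(lborel :: (real ^ 'n) measure)) \<le> ennreal (measure lborel (unit_cell :: (real ^ 'n) set))"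
    by (simp add: unit_cell_def)
  show "loc_integrable (\<lambda>_ :: real ^ 'n. 0 :: real ^ 'n ^ 'n)" by (rule continuous_loc_integrable) simp
qed (auto simp: periodic_def trace_def)

theorem corollary1p8:
  fixes T :: real
    and b :: "real \<Rightarrow> real ^ 'n \<Rightarrow> real ^ 'n"
    and Db :: "real \<Rightarrow> real ^ 'n \<Rightarrow> real ^ 'n ^ 'n"
    and divb :: "real \<Rightarrow> real ^ 'n \<Rightarrow> real"
    and X :: "real \<Rightarrow> real ^ 'n \<Rightarrow> real ^ 'n"
  assumes "T > 0"
    and "(\<lambda>(t, x). b t x) \<in> borel_measurable (lebesgue_on ({0..T} \<times> UNIV))"
    and "\<And>t. t \<in> {0..T} \<Longrightarrow> periodic (b t)"
    and "\<And>t. t \<in> {0..T} \<Longrightarrow> continuous_on UNIV (b t)"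
    and "\<And>t. t \<in> {0..T} \<Longrightarrow> weak_gradient (b t) (Db t)"
    and "\<And>\<beta>. \<beta> > 0 \<Longrightarrow>
           (SUP t\<in>{0..T}. \<integral>\<^sup>+x\<in>unit_cell. ennreal (exp (\<beta> * norm (Db t x))) \<partial>lebesgue) < \<infinity>"
    and "AE t in lebesgue_on {0..T}. weak_divergence (b t) (divb t)"
    and "Linfty_on ({0..T} \<times> unit_cell) (\<lambda>(t, x). divb t x)"
    and "is_flow T b X"
  shows "\<forall>t\<in>{0..T}. bij (X t) \<and> (\<forall>p\<ge>1. in_W1p p (X t) \<and> in_W1p p (inv (X t)))"
proof
  fix t assume t: "t \<in> {0..T}"
  have per: "periodic (\<lambda>x. X t x - x)" using assms(9) t unfolding is_flow_def by blast
  have X0: "X 0 x = x" for x using assms(9) unfolding is_flow_def by blast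
  show "bij (X t) \<and> (\<forall>p\<ge>1. in_W1p p (X t) \<and> in_W1p p (inv (X t)))"
  proof (cases "t = 0")
    case True
    show ?thesis
    proof (rule flow_map_bij_sobolev[where T = 1 and g = "\<lambda>_ _. 0" and b = "\<lambda>_ _. 0"])
      show "\<exists>\<gamma>. trajectory 1 (\<lambda>_ _. 0) \<gamma> \<and> \<gamma> 0 = x \<and> \<gamma> 1 = X t x" for x
        using True X0[of x] by (intro exI[of _ "\<lambda>_. x"]) (simp add: trajectory_def set_integrable_def set_lebesgue_integral_def)
    qed (use per good_field_zero in auto)
  next
    case False
    have t0: "t > 0" "t \<le> T" using t False by auto
    let ?S = "{0..T} \<times> (UNIV :: (real ^ 'n) set)"
    let ?S' = "{0..T} \<times> (unit_cell :: (real ^ 'n) set)"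
    have Sm: "?S \<in> sets lebesgue" "?S' \<in> sets lebesgue"
      by (auto intro!: closed_Times borel_closed sets_completionI_sets simp: unit_cell_def)
    have "(\<lambda>p. indicator ?S p *\<^sub>R (case p of (t, x) \<Rightarrow> b t x)) \<in> borel_measurable lebesgue"
      using assms(2) Sm(1) by (subst (asm) borel_measurable_restrict_space_iff) auto
    then obtain F where F: "F \<in> borel_measurable lborel"
      "AE p in lborel. indicator ?S p *\<^sub>R (case p of (t, x) \<Rightarrow> b t x) = F p"
      using ex_borel_version by blast
    define g where "g s x = F (s, x)" for s x
    have gm: "(\<lambda>(s, x). g s x) \<in> borel_measurable (borel \<Otimes>\<^sub>M borel)"
      using F(1) by (simp add: g_def borel_prod)
    have "AE p in (lborel \<Otimes>\<^sub>M lborel). indicator ?S p *\<^sub>R (case p of (t, x) \<Rightarrow> b t x) = F p"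
      using F(2) by (simp only: lborel_prod)
    from lborel_pair.AE_pair[OF this]
    have bg: "AE s in lborel. s \<in> {0..T} \<longrightarrow> (AE x in lborel. b s x = g s x)"
      by eventually_elim (auto simp: g_def)
    \<comment> \<open>A bound for the essential supremum; it is turned into a statement on almost every time slice.\<close>
    define e where "e = esssup (lebesgue_on ?S') (\<lambda>p. ereal \<bar>case p of (t, x) \<Rightarrow> divb t x\<bar>)"
    have "e < \<infinity>" using assms(8) unfolding Linfty_on_def e_def by blast
    then obtain D :: nat where D: "e < ereal (real D)" using less_PInf_Ex_of_nat by auto
    have "AE p in lebesgue_on ?S'. ereal \<bar>case p of (t, x) \<Rightarrow> divb t x\<bar> \<le> e"
      unfolding e_def by (rule esssup_AE)
    then have "AE p in lebesgue_on ?S'. \<bar>case p of (t, x) \<Rightarrow> divb t x\<bar> \<le> real D"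
    proof eventually_elim
      case (elim p)
      then have "ereal \<bar>case p of (t, x) \<Rightarrow> divb t x\<bar> < ereal (real D)" using D by (rule order_le_less_trans)
      then show ?case by simp
    qed
    then have "AE p in lebesgue. p \<in> ?S' \<longrightarrow> \<bar>case p of (t, x) \<Rightarrow> divb t x\<bar> \<le> real D"
      using Sm(2) by (subst (asm) AE_restrict_space_iff) auto
    then have "AE p in (lborel \<Otimes>\<^sub>M lborel). p \<in> ?S' \<longrightarrow> \<bar>case p of (t, x) \<Rightarrow> divb t x\<bar> \<le> real D"
      by (simp only: AE_completion_iff lborel_prod)
    from lborel_pair.AE_pair[OF this]
    have bd: "AE s in lborel. s \<in> {0..T} \<longrightarrow> (AE x in lborel. x \<in> unit_cell \<longrightarrow> \<bar>divb s x\<bar> \<le> real D)"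
      by eventually_elim auto
    have "AE s in lebesgue. s \<in> {0..T} \<longrightarrow> weak_divergence (b s) (divb s)"
      using assms(7) by (subst (asm) AE_restrict_space_iff) auto
    then have wd: "AE s in lborel. s \<in> {0..T} \<longrightarrow> weak_divergence (b s) (divb s)"
      by (simp only: AE_completion_iff)
    define M where "M \<beta> = enn2real (SUP t\<in>{0..T}. \<integral>\<^sup>+x\<in>unit_cell. ennreal (exp (\<beta> * norm (Db t x))) \<partial>lebesgue)" for \<beta>
    have exM: "(\<integral>\<^sup>+x\<in>unit_cell. ennreal (exp (\<beta> * norm (Db s x))) \<partial>lebesgue) \<le> ennreal (M \<beta>)"
      if "\<beta> > 0" "s \<in> {0..T}" for \<beta> s
    proof -
      have "(\<integral>\<^sup>+x\<in>unit_cell. ennreal (exp (\<beta> * norm (Db s x))) \<partial>lebesgue)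
        \<le> (SUP t\<in>{0..T}. \<integral>\<^sup>+x\<in>unit_cell. ennreal (exp (\<beta> * norm (Db t x))) \<partial>lebesgue)"
        using that(2) by (rule SUP_upper)
      also have "\<dots> = ennreal (M \<beta>)"
        unfolding M_def using assms(6)[OF that(1)] by (intro ennreal_enn2real[symmetric]) simp
      finally show ?thesis .
    qed
    have good: "AE s in lborel. s \<in> {0..T} \<longrightarrow> good_field (real D) M (b s)"
      using wd bd
    proof eventually_elim
      case (elim s)
      show ?case
        using elim assms(3-5)[of s] exM[of _ s]
        by (intro impI good_field_of_hypotheses[of "b s" "Db s" M "divb s" "real D"]) auto
    qed
    have "trajectory T b (\<lambda>s. X s x)" for x
      using assms(9) unfolding is_flow_def trajectory_def by blast
    then have tr: "trajectory t b (\<lambda>s. X s x)" for x using trajectory_restrict t0(2) by blast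
    show ?thesis
    proof (rule flow_map_bij_sobolev[OF t0(1) gm _ _ _ per])
      show "AE s in lborel. s \<in> {0..t} \<longrightarrow> (AE x in lborel. b s x = g s x)"
        using bg by eventually_elim (use t0 in auto)
      show "AE s in lborel. s \<in> {0..t} \<longrightarrow> good_field (real D) M (b s)"
        using good by eventually_elim (use t0 in auto)
      show "\<exists>\<gamma>. trajectory t b \<gamma> \<and> \<gamma> 0 = x \<and> \<gamma> t = X t x" for x
        using tr[of x] X0[of x] by blast
    qed
  qed
qed

end
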